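(* Let $2\le r\le k$ and $C\ge 1$ be integers. Let $\mathcal{H}_N$ be a sequence of (possibly weighted) $k$-uniform hypergraphs with $V(\mathcal{H}_N)=[N]$, $\Delta_r(\mathcal{H}_N)\le C$ and $\sigma^2(\mathcal{H}_N)\ge N^{2r-2}/C$ for all $N$. Let $m=m_N$ be a sequence of positive integers, put $t=t_N=m/N$, and suppose $t\le 1/2$. Let $a_N$ be a sequence such that $$t^{k-1/2}N^{r-1/2}(\log N)^{1/2}\ \ll\ a_N\ \ll\ t^{k-1/2+(k-1)/(2(r-1))}N^r.$$ Then $$\mathbb{P}\left(D^{\mathcal{H}_N}(B_m)\ge a_N\right)=\exp\left(\frac{-(1+o(1))\,a_N^2}{2(1-t)\,t^{2k-1}\,\sigma^2(\mathcal{H}_N)\,N}\right).$$ Furthermore, the same formula holds for the lower tail probability $\mathbb{P}\left(D^{\mathcal{H}_N}(B_m)\le -a_N\right)$.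
   Context: $[N]=\{1,\dots,N\}$. Sequences are indexed by $N$ (all sufficiently large positive integers), and asymptotics are as $N\to\infty$: $a_N\ll b_N$ means $a_N/b_N\to 0$, and $o(1)$ denotes a quantity tending to $0$. A weighted $k$-uniform hypergraph $\mathcal{H}$ on $[N]$ has a positive weight attached to each edge (unweighted: all weights $1$); all parameters count edges with weight. $e(\mathcal{H})$ is the total weight of all edges; for $R\subseteq[N]$, $d_{\mathcal{H}}(R)$ is the total weight of edges containing $R$, and $d_{\mathcal{H}}(x)=d_{\mathcal{H}}(\{x\})$. Set $\Delta_r(\mathcal{H})=\max\{d_{\mathcal{H}}(R):|R|=r\}$, $\bar d(\mathcal{H})=\frac1N\sum_{x=1}^N d_{\mathcal{H}}(x)$, and $\sigma^2(\mathcal{H})=\frac1N\sum_{x=1}^N (d_{\mathcal{H}}(x)-\bar d(\mathcal{H}))^2$. $B_m$ is a uniformly random $m$-element subset of $[N]$. For $B\subseteq[N]$, $N^{\mathcal{H}}(B)=e(\mathcal{H}[B])$ is the total weight of edges of $\mathcal{H}$ contained in $B$, and $D^{\mathcal{H}}(B_m)=N^{\mathcal{H}}(B_m)-\mathbb{E}[N^{\mathcal{H}}(B_m)]$. *)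

theory Defs
  imports "HOL-Probability.Probability"
begin

record whypergraph =
  hedges :: "nat set set"
  hweight :: "nat set \<Rightarrow> real"

text \<open>The vertex set \<open>[N]\<close> is a parameter rather than a record field. Only the values of
  \<open>hweight\<close> on edges matter.\<close>

definition uniform_whypergraph :: "nat \<Rightarrow> nat \<Rightarrow> whypergraph \<Rightarrow> bool" where
  "uniform_whypergraph k N H \<longleftrightarrow>
     (\<forall>e\<in>hedges H. e \<subseteq> {1..N} \<and> card e = k \<and> hweight H e > 0)"

definition total_weight :: "whypergraph \<Rightarrow> real" where
  "total_weight H = (\<Sum>e\<in>hedges H. hweight H e)"

definition degree_set :: "whypergraph \<Rightarrow> nat set \<Rightarrow> real" where
  "degree_set H R = (\<Sum>e\<in>{e\<in>hedges H. R \<subseteq> e}. hweight H e)"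

definition vertex_degree :: "whypergraph \<Rightarrow> nat \<Rightarrow> real" where
  "vertex_degree H x = degree_set H {x}"

text \<open>Meaningful only for \<open>r \<le> N\<close>; otherwise this is the maximum of the empty set.\<close>

definition max_degree :: "nat \<Rightarrow> nat \<Rightarrow> whypergraph \<Rightarrow> real" where
  "max_degree r N H = Max (degree_set H ` {R. R \<subseteq> {1..N} \<and> card R = r})"

definition avg_degree :: "nat \<Rightarrow> whypergraph \<Rightarrow> real" where
  "avg_degree N H = (1 / real N) * (\<Sum>x=1..N. vertex_degree H x)"

definition degree_variance :: "nat \<Rightarrow> whypergraph \<Rightarrow> real" where
  "degree_variance N H = (1 / real N) * (\<Sum>x=1..N. (vertex_degree H x - avg_degree N H)\<^sup>2)"

definition induced :: "whypergraph \<Rightarrow> nat set \<Rightarrow> whypergraph" where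
  "induced H B = H\<lparr>hedges := {e\<in>hedges H. e \<subseteq> B}\<rparr>"

definition edge_count :: "whypergraph \<Rightarrow> nat set \<Rightarrow> real" where
  "edge_count H B = total_weight (induced H B)"

text \<open>The law of \<open>B\<^sub>m\<close>; for \<open>m > N\<close> there are no \<open>m\<close>-subsets and the value is unspecified.\<close>

definition random_subset :: "nat \<Rightarrow> nat \<Rightarrow> nat set pmf" where
  "random_subset N m = pmf_of_set {B. B \<subseteq> {1..N} \<and> card B = m}"

definition deviation :: "nat \<Rightarrow> nat \<Rightarrow> whypergraph \<Rightarrow> nat set \<Rightarrow> real" where
  "deviation N m H B =
     edge_count H B - measure_pmf.expectation (random_subset N m) (edge_count H)"

end

theory Submission
  imports Defs "HOL-Computational_Algebra.Polynomial"
begin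

text \<open>
  Let \<open>\<xi>\<^sub>x\<close> be independent Bernoulli variables of mean \<open>t\<close>; conditioning on \<open>\<Sum>x. \<xi>\<^sub>x = m\<close> gives the
  law of \<open>B\<^sub>m\<close> and costs only a factor \<open>N + 1\<close>, which is negligible because the exponent dominates
  \<open>log N\<close>. In the Bernoulli model the edge count is its mean plus the linear form
  \<open>t\<^bsup>k-1\<^esup> (\<Sum>x. d(x) (\<xi>\<^sub>x - t))\<close> plus a remainder, and on \<open>\<Sum>x. \<xi>\<^sub>x = m\<close> the degrees may be replaced
  by the centred degrees, whose sum of squares is \<open>N \<sigma>\<^sup>2\<close>.

  The remainder is a martingale \<open>\<Sum>x. (\<xi>\<^sub>x - t) G\<^sub>x\<close>, where \<open>G\<^sub>x\<close> is the deviation of the mean degree of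
  \<open>x\<close> given the smaller vertices, and \<open>G\<^sub>x\<close> is in turn a martingale whose coefficients are mean
  codegrees. Degrees and codegrees have nonnegative coefficients, so that their moments of order
  \<open>q\<close> are bounded by conditional means given at most \<open>k q\<close> vertices in \<open>B\<close>; the upper bound on
  \<open>a\<^sub>N\<close> is exactly what keeps these of the expected order. Two applications of Freedman's inequality
  then show that the remainder exceeds \<open>\<delta> a\<^sub>N\<close> with probability at most \<open>exp (- K a\<^sub>N\<^sup>2 / (t\<^bsup>2k-1\<^esup>
  N\<^bsup>2r-1\<^esup>))\<close> for any fixed \<open>K\<close>.

  The linear form is treated through its Laplace transform, whose lower bound on the slice
  \<open>\<Sum>x. \<xi>\<^sub>x = m\<close> follows from the log-concavity of the coefficients of a product of linear factors.
\<close>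

section \<open>Bernoulli random subsets\<close>

text \<open>The remainder may be estimated crudely although the constant in the exponent must be
  sharp: the rate \<rho> agrees with the exponent up to a factor depending on C only, so an error
  probability \<open>exp (- K * \<rho>)\<close> with a large fixed K is negligible. Moment bounds
  lose a factor e and see no cancellation; they are therefore applied only to nonnegative
  quantities, which control jumps and quadratic variation, and cancellation is left to Freedman's
  inequality. Moments of order about K \<rho> condition on u vertices, with u of order k K \<rho>.
  Edges through x with r - 1 further vertices among these may have total weight of order u^(r-1),
  with no power of t to reduce it; keeping this below t^(k-1) N^(r-1) is the upper hypothesis on a.
  The lower one says that \<rho> dominates log N.

  Conditioning on the size transfers upper bounds but not lower bounds, hence the separate study of
  Laplace transforms on the slice. The rescaling used there adds one constant to all coefficients of
  the linear form, which is harmless because centred degrees sum to zero.\<close>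

lemma sum_filter_of_bool:
  fixes g :: "'a \<Rightarrow> real"
  shows "finite A \<Longrightarrow> (\<Sum>x\<in>{x\<in>A. P x}. g x) = (\<Sum>x\<in>A. of_bool (P x) * g x)"
  by (simp add: sum.inter_filter of_bool_def if_distrib[of "\<lambda>c. c * _"] cong: if_cong)

text \<open>An explicit finite sum rather than a \<open>pmf\<close>: revealing the last vertex
  becomes the recursion \<open>bernoulli_exp_Suc\<close>, so martingale arguments are inductions on
  n.\<close>

definition bernoulli_exp :: "real \<Rightarrow> nat \<Rightarrow> (nat set \<Rightarrow> real) \<Rightarrow> real" where
  "bernoulli_exp p n g = (\<Sum>B\<in>Pow {1..n}. p ^ card B * (1 - p) ^ (n - card B) * g B)"

abbreviation bernoulli_prob :: "real \<Rightarrow> nat \<Rightarrow> (nat set \<Rightarrow> bool) \<Rightarrow> real" where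
  "bernoulli_prob p n Q \<equiv> bernoulli_exp p n (\<lambda>B. of_bool (Q B))"

definition centred :: "real \<Rightarrow> nat \<Rightarrow> nat set \<Rightarrow> real" where
  "centred p x B = of_bool (x \<in> B) - p"

lemma bernoulli_exp_0 [simp]: "bernoulli_exp p 0 g = g {}"
  by (simp add: bernoulli_exp_def)

lemma bernoulli_exp_Suc:
  "bernoulli_exp p (Suc n) g =
     bernoulli_exp p n (\<lambda>B. p * g (insert (Suc n) B) + (1 - p) * g B)"
proof -
  have eq: "Pow {1..Suc n} = Pow {1..n} \<union> insert (Suc n) ` Pow {1..n}"
    by (simp add: atLeastAtMostSuc_conv Pow_insert)
  have disj: "Pow {1..n} \<inter> insert (Suc n) ` Pow {1..n} = {}"
    by auto
  have inj: "inj_on (insert (Suc n)) (Pow {1..n})"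
    by (rule inj_onI) (metis Diff_insert_absorb PowD atLeastAtMost_iff in_mono not_less_eq_eq order_refl)
  have card_le: "card B \<le> n" if "B \<in> Pow {1..n}" for B
    using that card_mono[of "{1..n}" B] by simp
  have card_ins: "card (insert (Suc n) B) = Suc (card B)" if "B \<in> Pow {1..n}" for B
  proof -
    have "finite B" "Suc n \<notin> B"
      using that finite_subset by auto
    then show ?thesis by simp
  qed
  have "bernoulli_exp p (Suc n) g =
      (\<Sum>B\<in>Pow {1..n}. p ^ card B * (1 - p) ^ (Suc n - card B) * g B) +
      (\<Sum>B\<in>insert (Suc n) ` Pow {1..n}. p ^ card B * (1 - p) ^ (Suc n - card B) * g B)"
    unfolding bernoulli_exp_def eq by (rule sum.union_disjoint) (use disj in auto)
  also have "(\<Sum>B\<in>insert (Suc n) ` Pow {1..n}. p ^ card B * (1 - p) ^ (Suc n - card B) * g B) =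
      (\<Sum>B\<in>Pow {1..n}. p ^ Suc (card B) * (1 - p) ^ (n - card B) * g (insert (Suc n) B))"
    by (subst sum.reindex[OF inj]) (auto intro!: sum.cong simp: card_ins)
  also have "(\<Sum>B\<in>Pow {1..n}. p ^ card B * (1 - p) ^ (Suc n - card B) * g B) =
      (\<Sum>B\<in>Pow {1..n}. p ^ card B * (1 - p) ^ Suc (n - card B) * g B)"
    by (intro sum.cong) (auto simp: Suc_diff_le card_le)
  finally show ?thesis
    by (simp add: bernoulli_exp_def sum.distrib[symmetric] algebra_simps)
qed

lemma bernoulli_exp_cong:
  "(\<And>B. B \<subseteq> {1..n} \<Longrightarrow> f B = g B) \<Longrightarrow> bernoulli_exp p n f = bernoulli_exp p n g"
  unfolding bernoulli_exp_def by (auto intro!: sum.cong)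

lemma bernoulli_exp_mono:
  assumes "0 \<le> p" "p \<le> 1" "\<And>B. B \<subseteq> {1..n} \<Longrightarrow> f B \<le> g B"
  shows "bernoulli_exp p n f \<le> bernoulli_exp p n g"
  unfolding bernoulli_exp_def using assms by (intro sum_mono mult_left_mono) auto

lemma bernoulli_exp_add:
  "bernoulli_exp p n (\<lambda>B. f B + g B) = bernoulli_exp p n f + bernoulli_exp p n g"
  by (simp add: bernoulli_exp_def sum.distrib[symmetric] algebra_simps)

lemma bernoulli_exp_cmult:
  "bernoulli_exp p n (\<lambda>B. c * f B) = c * bernoulli_exp p n f"
  by (simp add: bernoulli_exp_def sum_distrib_left algebra_simps)

lemma bernoulli_exp_sum:
  "bernoulli_exp p n (\<lambda>B. \<Sum>i\<in>I. f i B) = (\<Sum>i\<in>I. bernoulli_exp p n (f i))"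
  unfolding bernoulli_exp_def by (subst sum.swap) (simp add: sum_distrib_left)

lemma bernoulli_prob_subset:
  assumes "U \<subseteq> {1..n}"
  shows "bernoulli_prob p n (\<lambda>B. U \<subseteq> B) = p ^ card U"
  using assms
proof (induction n arbitrary: U)
  case 0
  then show ?case by simp
next
  case (Suc n)
  let ?V = "U - {Suc n}"
  have V: "?V \<subseteq> {1..n}"
    using Suc.prems by (auto simp: le_Suc_eq)
  have fin: "finite U" using Suc.prems finite_subset by blast
  have *: "U \<subseteq> insert (Suc n) B \<longleftrightarrow> ?V \<subseteq> B" for B by auto
  show ?case
  proof (cases "Suc n \<in> U")
    case True
    have "bernoulli_prob p (Suc n) (\<lambda>B. U \<subseteq> B) = bernoulli_exp p n (\<lambda>B. p * of_bool (?V \<subseteq> B))"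
      unfolding bernoulli_exp_Suc * by (rule bernoulli_exp_cong) (use True in auto)
    also have "\<dots> = p * p ^ card ?V"
      by (simp add: bernoulli_exp_cmult Suc.IH[OF V])
    also have "\<dots> = p ^ card U"
      using card_Suc_Diff1[OF fin True] by (metis power_Suc)
    finally show ?thesis .
  next
    case False
    then have "?V = U" by auto
    then show ?thesis
      using Suc.IH[OF V] by (simp add: bernoulli_exp_Suc * algebra_simps)
  qed
qed

lemma bernoulli_markov:
  assumes p: "0 \<le> p" "p \<le> 1" and c: "0 < c"
    and f: "\<And>B. B \<subseteq> {1..n} \<Longrightarrow> 0 \<le> f B"
    and Q: "\<And>B. B \<subseteq> {1..n} \<Longrightarrow> Q B \<Longrightarrow> c \<le> f B"
  shows "bernoulli_prob p n Q \<le> bernoulli_exp p n f / c"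
proof -
  have "c * bernoulli_prob p n Q = bernoulli_exp p n (\<lambda>B. c * of_bool (Q B))"
    by (simp add: bernoulli_exp_cmult)
  also have "\<dots> \<le> bernoulli_exp p n f"
    by (rule bernoulli_exp_mono[OF p]) (use f Q in auto)
  finally show ?thesis
    using c by (simp add: field_simps)
qed

lemma bernoulli_prob_mono:
  assumes "0 \<le> p" "p \<le> 1" "\<And>B. B \<subseteq> {1..n} \<Longrightarrow> Q B \<Longrightarrow> Q' B"
  shows "bernoulli_prob p n Q \<le> bernoulli_prob p n Q'"
  using assms by (intro bernoulli_exp_mono) auto

lemma bernoulli_prob_Un:
  assumes "0 \<le> p" "p \<le> 1" "\<And>B. B \<subseteq> {1..n} \<Longrightarrow> Q B \<Longrightarrow> Q1 B \<or> Q2 B"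
  shows "bernoulli_prob p n Q \<le> bernoulli_prob p n Q1 + bernoulli_prob p n Q2"
  unfolding bernoulli_exp_add[symmetric] using assms by (intro bernoulli_exp_mono) auto

lemma bernoulli_prob_UN:
  assumes "0 \<le> p" "p \<le> 1" "finite I"
    and "\<And>i. i \<in> I \<Longrightarrow> bernoulli_prob p n (Q i) \<le> c"
  shows "bernoulli_prob p n (\<lambda>B. \<exists>i\<in>I. Q i B) \<le> real (card I) * c"
proof -
  have "bernoulli_prob p n (\<lambda>B. \<exists>i\<in>I. Q i B) \<le> bernoulli_exp p n (\<lambda>B. \<Sum>i\<in>I. of_bool (Q i B))"
  proof (rule bernoulli_exp_mono[OF assms(1,2)])
    fix B
    show "of_bool (\<exists>i\<in>I. Q i B) \<le> (\<Sum>i\<in>I. of_bool (Q i B) :: real)"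
    proof (cases "\<exists>i\<in>I. Q i B")
      case True
      then obtain i where i: "i \<in> I" "Q i B" by blast
      have "of_bool (Q i B) \<le> (\<Sum>i\<in>I. of_bool (Q i B) :: real)"
        by (rule member_le_sum[OF i(1)]) (use assms(3) in auto)
      with i True show ?thesis by simp
    qed (auto intro: sum_nonneg)
  qed
  also have "\<dots> \<le> real (card I) * c"
    unfolding bernoulli_exp_sum by (rule sum_bounded_above[OF assms(4)])
  finally show ?thesis .
qed

section \<open>Freedman's inequality in the Bernoulli model\<close>

lemma bernoulli_mgf_le:
  fixes p u \<beta> :: real
  assumes p: "0 \<le> p" "p \<le> 1" and u: "\<bar>u\<bar> \<le> \<beta>"
  shows "p * exp (u * (1 - p)) + (1 - p) * exp (- (u * p)) \<le> exp (exp \<beta> / 2 * (p * (1 - p)) * u\<^sup>2)"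
proof -
  \<comment> \<open>Second-order Taylor bound. The linear terms cancel in the mean and the quadratic
    terms add up to the variance p (1 - p). The factor \<open>exp \<beta> / 2\<close> tends to 1/2
    as \<beta> tends to 0, which later preserves the sharp constant.\<close>
  have ex: "exp x \<le> 1 + x + exp \<beta> / 2 * x\<^sup>2" if "\<bar>x\<bar> \<le> \<beta>" for x :: real
  proof -
    obtain s where s: "\<bar>s\<bar> \<le> \<bar>x\<bar>" "exp x = (\<Sum>m<2. x ^ m / fact m) + exp s / fact 2 * x ^ 2"
      using Maclaurin_exp_le[of x 2] by blast
    have "exp s \<le> exp \<beta>" using s(1) that by simp
    then have "exp s / 2 * x\<^sup>2 \<le> exp \<beta> / 2 * x\<^sup>2" by (intro mult_right_mono) auto
    then show ?thesis using s(2) by (simp add: numeral_2_eq_2)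
  qed
  have b1: "\<bar>u * (1 - p)\<bar> \<le> \<beta>" "\<bar>- (u * p)\<bar> \<le> \<beta>"
    using p u mult_left_le[of "1 - p" "\<bar>u\<bar>"] mult_left_le[of p "\<bar>u\<bar>"] by (auto simp: abs_mult)
  have "p * exp (u * (1 - p)) + (1 - p) * exp (- (u * p)) \<le>
      p * (1 + u * (1 - p) + exp \<beta> / 2 * (u * (1 - p))\<^sup>2) +
      (1 - p) * (1 + (- (u * p)) + exp \<beta> / 2 * (- (u * p))\<^sup>2)"
    using ex[OF b1(1)] ex[OF b1(2)] p by (intro add_mono mult_left_mono) auto
  also have "\<dots> = 1 + exp \<beta> / 2 * (p * (1 - p)) * u\<^sup>2"
    by (simp add: field_simps power2_eq_square)
  also have "\<dots> \<le> exp (exp \<beta> / 2 * (p * (1 - p)) * u\<^sup>2)"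
    by (rule exp_ge_add_one_self)
  finally show ?thesis .
qed

text \<open>The hypothesis \<open>pred\<close> is predictability: \<open>G x\<close> is insensitive
  to the vertices from x on. Given the vertices below x, either \<open>bernoulli_mgf_le\<close>
  bounds the mean of the last factor by 1 or the indicator makes it vanish; carrying the indicator
  along replaces a stopping time.\<close>

lemma freedman_supermartingale:
  fixes G :: "nat \<Rightarrow> nat set \<Rightarrow> real"
  assumes p: "0 \<le> p" "p \<le> 1"
    and pred: "\<And>x y B. x \<le> y \<Longrightarrow> G x (insert y B) = G x B"
  shows "bernoulli_exp p n (\<lambda>B. of_bool (\<forall>x\<in>{1..n}. \<bar>G x B\<bar> \<le> \<beta>) *
      exp (\<Sum>x=1..n. centred p x B * G x B - exp \<beta> / 2 * (p * (1 - p)) * (G x B)\<^sup>2)) \<le> 1"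
proof (induction n)
  case 0
  then show ?case by simp
next
  case (Suc n)
  define Z where "Z = (\<lambda>n B. of_bool (\<forall>x\<in>{1..n}. \<bar>G x B\<bar> \<le> \<beta>) *
      exp (\<Sum>x=1..n. centred p x B * G x B - exp \<beta> / 2 * (p * (1 - p)) * (G x B)\<^sup>2))"
  have "bernoulli_exp p (Suc n) (Z (Suc n)) \<le> bernoulli_exp p n (Z n)"
    unfolding bernoulli_exp_Suc
  proof (rule bernoulli_exp_mono[OF p])
    fix B assume B: "B \<subseteq> {1..n}"
    then have nB: "Suc n \<notin> B" by auto
    let ?g = "G (Suc n) B"
    let ?k = "exp \<beta> / 2 * (p * (1 - p)) * ?g\<^sup>2"
    have G: "G x (insert (Suc n) B) = G x B" if "x \<in> {1..Suc n}" for x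
      using that pred by simp
    have c: "centred p x (insert (Suc n) B) = centred p x B" if "x \<in> {1..n}" for x
      using that by (auto simp: centred_def)
    have cS: "centred p (Suc n) (insert (Suc n) B) = 1 - p" "centred p (Suc n) B = - p"
      using nB by (auto simp: centred_def)
    have Z1: "Z (Suc n) (insert (Suc n) B) = Z n B * of_bool (\<bar>?g\<bar> \<le> \<beta>) * exp ((1 - p) * ?g - ?k)"
    proof -
      have "(\<forall>x\<in>{1..Suc n}. \<bar>G x (insert (Suc n) B)\<bar> \<le> \<beta>) \<longleftrightarrow>
        (\<forall>x\<in>{1..n}. \<bar>G x B\<bar> \<le> \<beta>) \<and> \<bar>?g\<bar> \<le> \<beta>"
        using G by (auto simp: le_Suc_eq)
      then show ?thesis
        unfolding Z_def by (simp add: cS G c exp_add[symmetric] of_bool_conj)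
    qed
    have Z2: "Z (Suc n) B = Z n B * of_bool (\<bar>?g\<bar> \<le> \<beta>) * exp (- p * ?g - ?k)"
    proof -
      have "(\<forall>x\<in>{1..Suc n}. \<bar>G x B\<bar> \<le> \<beta>) \<longleftrightarrow> (\<forall>x\<in>{1..n}. \<bar>G x B\<bar> \<le> \<beta>) \<and> \<bar>?g\<bar> \<le> \<beta>"
        by (auto simp: le_Suc_eq)
      then show ?thesis
        unfolding Z_def by (simp add: cS exp_add[symmetric] of_bool_conj)
    qed
    have Z0: "0 \<le> Z n B" by (simp add: Z_def)
    have "p * Z (Suc n) (insert (Suc n) B) + (1 - p) * Z (Suc n) B =
       Z n B * (of_bool (\<bar>?g\<bar> \<le> \<beta>) * (exp (- ?k) *
         (p * exp (?g * (1 - p)) + (1 - p) * exp (- (?g * p)))))"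
    proof -
      have "exp ((1 - p) * ?g - ?k) = exp (- ?k) * exp (?g * (1 - p))"
        "exp (- p * ?g - ?k) = exp (- ?k) * exp (- (?g * p))"
        by (simp_all add: exp_add[symmetric] algebra_simps)
      then show ?thesis
        unfolding Z1 Z2 by (simp only: algebra_simps)
    qed
    also have "\<dots> \<le> Z n B * 1"
    proof (rule mult_left_mono[OF _ Z0], cases "\<bar>?g\<bar> \<le> \<beta>")
      case True
      have "exp (- ?k) * (p * exp (?g * (1 - p)) + (1 - p) * exp (- (?g * p))) \<le> exp (- ?k) * exp ?k"
        by (intro mult_left_mono bernoulli_mgf_le p True) auto
      then show "of_bool (\<bar>?g\<bar> \<le> \<beta>) * (exp (- ?k) *
         (p * exp (?g * (1 - p)) + (1 - p) * exp (- (?g * p)))) \<le> 1"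
        using True by (simp add: exp_minus_inverse mult.commute)
    qed auto
    finally show "p * Z (Suc n) (insert (Suc n) B) + (1 - p) * Z (Suc n) B \<le> Z n B" by simp
  qed
  with Suc.IH show ?case unfolding Z_def by linarith
qed

text \<open>Markov's inequality for the supermartingale with coefficients
  \<open>\<theta> * G x\<close>. The parameter is left free because its uses differ: the linear form
  needs the Gaussian optimum, the remainder a prescribed error probability.\<close>

lemma freedman_tail:
  fixes G :: "nat \<Rightarrow> nat set \<Rightarrow> real"
  assumes p: "0 \<le> p" "p \<le> 1" and \<theta>: "0 \<le> \<theta>"
    and pred: "\<And>x y B. x \<le> y \<Longrightarrow> G x (insert y B) = G x B"
  shows "bernoulli_prob p n (\<lambda>B. s \<le> (\<Sum>x=1..n. centred p x B * G x B) \<and>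
            (\<forall>x\<in>{1..n}. \<bar>G x B\<bar> \<le> b) \<and> p * (1 - p) * (\<Sum>x=1..n. (G x B)\<^sup>2) \<le> V)
         \<le> exp (- \<theta> * s + \<theta>\<^sup>2 / 2 * exp (\<theta> * b) * V)"
proof -
  let ?S = "\<lambda>B. \<Sum>x=1..n. centred p x B * G x B"
  let ?W = "\<lambda>B. \<Sum>x=1..n. (G x B)\<^sup>2"
  let ?\<kappa> = "exp (\<theta> * b) / 2"
  let ?Z = "\<lambda>B. of_bool (\<forall>x\<in>{1..n}. \<bar>\<theta> * G x B\<bar> \<le> \<theta> * b) *
      exp (\<Sum>x=1..n. centred p x B * (\<theta> * G x B) - ?\<kappa> * (p * (1 - p)) * (\<theta> * G x B)\<^sup>2)"
  have Zeq: "(\<Sum>x=1..n. centred p x B * (\<theta> * G x B) - ?\<kappa> * (p * (1 - p)) * (\<theta> * G x B)\<^sup>2)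
      = \<theta> * ?S B - \<theta>\<^sup>2 * ?\<kappa> * (p * (1 - p) * ?W B)" for B
    by (simp add: sum_subtractf sum_distrib_left power_mult_distrib mult_ac)
  let ?c = "exp (\<theta> * s - \<theta>\<^sup>2 * ?\<kappa> * V)"
  have "bernoulli_prob p n (\<lambda>B. s \<le> ?S B \<and> (\<forall>x\<in>{1..n}. \<bar>G x B\<bar> \<le> b) \<and> p * (1 - p) * ?W B \<le> V)
      \<le> bernoulli_exp p n ?Z / ?c"
  proof (rule bernoulli_markov[OF p])
    fix B assume "s \<le> ?S B \<and> (\<forall>x\<in>{1..n}. \<bar>G x B\<bar> \<le> b) \<and> p * (1 - p) * ?W B \<le> V"
    then have 1: "\<theta> * s \<le> \<theta> * ?S B" "\<theta>\<^sup>2 * ?\<kappa> * (p * (1 - p) * ?W B) \<le> \<theta>\<^sup>2 * ?\<kappa> * V"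
      and 2: "\<forall>x\<in>{1..n}. \<bar>\<theta> * G x B\<bar> \<le> \<theta> * b"
      using \<theta> by (auto simp: abs_mult intro!: mult_left_mono)
    show "?c \<le> ?Z B"
      using 1 2 unfolding Zeq by simp
  qed auto
  also have "\<dots> \<le> 1 / ?c"
    using freedman_supermartingale[OF p, of "\<lambda>x B. \<theta> * G x B" n "\<theta> * b"] pred
    by (intro divide_right_mono) auto
  also have "\<dots> = exp (- (\<theta> * s - \<theta>\<^sup>2 * ?\<kappa> * V))"
    by (simp only: exp_minus divide_inverse mult_1_left)
  also have "- (\<theta> * s - \<theta>\<^sup>2 * ?\<kappa> * V) = - \<theta> * s + \<theta>\<^sup>2 / 2 * exp (\<theta> * b) * V"
    by simp
  finally show ?thesis .
qed

lemma freedman_tail_abs: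
  fixes G :: "nat \<Rightarrow> nat set \<Rightarrow> real"
  assumes p: "0 \<le> p" "p \<le> 1" and \<theta>: "0 \<le> \<theta>"
    and pred: "\<And>x y B. x \<le> y \<Longrightarrow> G x (insert y B) = G x B"
  shows "bernoulli_prob p n (\<lambda>B. s \<le> \<bar>\<Sum>x=1..n. centred p x B * G x B\<bar> \<and>
            (\<forall>x\<in>{1..n}. \<bar>G x B\<bar> \<le> b) \<and> p * (1 - p) * (\<Sum>x=1..n. (G x B)\<^sup>2) \<le> V)
         \<le> 2 * exp (- \<theta> * s + \<theta>\<^sup>2 / 2 * exp (\<theta> * b) * V)"
proof -
  let ?Q = "\<lambda>G B. s \<le> (\<Sum>x=1..n. centred p x B * G x B) \<and>
            (\<forall>x\<in>{1..n}. \<bar>G x B\<bar> \<le> b) \<and> p * (1 - p) * (\<Sum>x=1..n. (G x B)\<^sup>2) \<le> V"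
  let ?G = "\<lambda>x B. - G x B"
  have "bernoulli_prob p n (\<lambda>B. s \<le> \<bar>\<Sum>x=1..n. centred p x B * G x B\<bar> \<and>
            (\<forall>x\<in>{1..n}. \<bar>G x B\<bar> \<le> b) \<and> p * (1 - p) * (\<Sum>x=1..n. (G x B)\<^sup>2) \<le> V)
      \<le> bernoulli_prob p n (?Q G) + bernoulli_prob p n (?Q ?G)"
  proof (rule bernoulli_prob_Un[OF p])
    fix B assume "s \<le> \<bar>\<Sum>x=1..n. centred p x B * G x B\<bar> \<and>
            (\<forall>x\<in>{1..n}. \<bar>G x B\<bar> \<le> b) \<and> p * (1 - p) * (\<Sum>x=1..n. (G x B)\<^sup>2) \<le> V"
    moreover have "(\<Sum>x=1..n. centred p x B * - G x B) = - (\<Sum>x=1..n. centred p x B * G x B)"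
      by (simp add: sum_negf)
    ultimately show "?Q G B \<or> ?Q ?G B" by (auto simp: abs_if split: if_splits)
  qed
  also have "\<dots> \<le> exp (- \<theta> * s + \<theta>\<^sup>2 / 2 * exp (\<theta> * b) * V) + exp (- \<theta> * s + \<theta>\<^sup>2 / 2 * exp (\<theta> * b) * V)"
    by (intro add_mono freedman_tail p \<theta>) (auto simp: pred)
  finally show ?thesis by simp
qed

text \<open>A monomial \<open>\<xi>\<^sub>U\<close> is the density of the conditioning on \<open>U \<subseteq> B\<close>; expanding one factor of the
  power at a time, each contributes the mean of the polynomial conditioned on a set of at most
  \<open>\<kappa> q\<close> elements.\<close>

lemma bernoulli_moment_bound:
  fixes c :: "'i \<Rightarrow> real" and T :: "'i \<Rightarrow> nat set"
  assumes p: "0 \<le> p" "p \<le> 1"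
    and c: "\<And>i. i \<in> I \<Longrightarrow> 0 \<le> c i"
    and T: "\<And>i. i \<in> I \<Longrightarrow> T i \<subseteq> {1..n} \<and> card (T i) \<le> \<kappa>"
    and \<Phi>: "0 \<le> \<Phi>" "\<And>U. U \<subseteq> {1..n} \<Longrightarrow> card U \<le> \<kappa> * q \<Longrightarrow> (\<Sum>i\<in>I. c i * p ^ card (T i - U)) \<le> \<Phi>"
  shows "bernoulli_exp p n (\<lambda>B. (\<Sum>i\<in>I. c i * of_bool (T i \<subseteq> B)) ^ q) \<le> \<Phi> ^ q"
proof -
  let ?P = "\<lambda>B. \<Sum>i\<in>I. c i * of_bool (T i \<subseteq> B) :: real"
  have "bernoulli_exp p n (\<lambda>B. ?P B ^ l * of_bool (U \<subseteq> B)) \<le> \<Phi> ^ l * p ^ card U"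
    if "l \<le> q" "U \<subseteq> {1..n}" "card U \<le> \<kappa> * (q - l)" for l U
    using that
  proof (induction l arbitrary: U)
    case 0
    then show ?case by (simp add: bernoulli_prob_subset)
  next
    case (Suc l)
    have finU: "finite U" using Suc.prems(2) finite_subset by blast
    have "bernoulli_exp p n (\<lambda>B. ?P B ^ Suc l * of_bool (U \<subseteq> B)) =
        (\<Sum>i\<in>I. c i * bernoulli_exp p n (\<lambda>B. ?P B ^ l * of_bool (U \<union> T i \<subseteq> B)))"
      unfolding bernoulli_exp_cmult[symmetric] bernoulli_exp_sum[symmetric]
      by (rule bernoulli_exp_cong)
         (simp add: sum_distrib_left sum_distrib_right of_bool_conj mult_ac)
    also have "\<dots> \<le> (\<Sum>i\<in>I. c i * (\<Phi> ^ l * p ^ card (U \<union> T i)))"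
    proof (intro sum_mono mult_left_mono c)
      fix i assume i: "i \<in> I"
      have "card (U \<union> T i) \<le> card U + card (T i)" by (rule card_Un_le)
      also have "\<dots> \<le> \<kappa> * (q - Suc l) + \<kappa>" using Suc.prems T[OF i] by (intro add_mono) auto
      also have "\<dots> = \<kappa> * (q - l)" using Suc.prems(1)
        by (metis Suc_diff_Suc Suc_le_lessD add.commute mult_Suc_right)
      finally show "bernoulli_exp p n (\<lambda>B. ?P B ^ l * of_bool (U \<union> T i \<subseteq> B)) \<le> \<Phi> ^ l * p ^ card (U \<union> T i)"
        using Suc.prems T[OF i] by (intro Suc.IH) auto
    qed
    also have "\<dots> = \<Phi> ^ l * p ^ card U * (\<Sum>i\<in>I. c i * p ^ card (T i - U))"
    proof -
      have "card (U \<union> T i) = card U + card (T i - U)" if "i \<in> I" for i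
      proof -
        have "finite (T i)" using T[OF that] finite_subset by blast
        then have "card (U \<union> (T i - U)) = card U + card (T i - U)"
          using finU by (intro card_Un_disjoint) auto
        then show ?thesis by simp
      qed
      then show ?thesis
        unfolding sum_distrib_left by (intro sum.cong) (auto simp: power_add mult_ac)
    qed
    also have "\<dots> \<le> \<Phi> ^ l * p ^ card U * \<Phi>"
    proof (intro mult_left_mono \<Phi>(2) mult_nonneg_nonneg)
      have "\<kappa> * (q - Suc l) \<le> \<kappa> * q" by simp
      then show "card U \<le> \<kappa> * q" using Suc.prems(3) by linarith
    qed (use Suc.prems p \<Phi>(1) in auto)
    finally show ?case by (simp add: mult_ac)
  qed
  from this[of q "{}"] show ?thesis by simp
qed

text \<open>Markov's inequality for the power q: at e times the moment bound, each of the q factors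
  gains 1/e.\<close>

lemma bernoulli_moment_tail:
  fixes c :: "'i \<Rightarrow> real" and T :: "'i \<Rightarrow> nat set"
  assumes p: "0 \<le> p" "p \<le> 1"
    and c: "\<And>i. i \<in> I \<Longrightarrow> 0 \<le> c i"
    and T: "\<And>i. i \<in> I \<Longrightarrow> T i \<subseteq> {1..n} \<and> card (T i) \<le> \<kappa>"
    and \<Phi>: "0 < \<Phi>" "\<And>U. U \<subseteq> {1..n} \<Longrightarrow> card U \<le> \<kappa> * q \<Longrightarrow> (\<Sum>i\<in>I. c i * p ^ card (T i - U)) \<le> \<Phi>"
  shows "bernoulli_prob p n (\<lambda>B. exp 1 * \<Phi> \<le> (\<Sum>i\<in>I. c i * of_bool (T i \<subseteq> B))) \<le> exp (- real q)"
proof -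
  let ?P = "\<lambda>B. \<Sum>i\<in>I. c i * of_bool (T i \<subseteq> B) :: real"
  have "bernoulli_prob p n (\<lambda>B. exp 1 * \<Phi> \<le> ?P B) \<le> bernoulli_exp p n (\<lambda>B. ?P B ^ q) / (exp 1 * \<Phi>) ^ q"
    by (rule bernoulli_markov[OF p])
       (use \<Phi>(1) c in \<open>auto intro!: power_mono zero_le_power sum_nonneg simp del: power_mult_distrib\<close>)
  also have "\<dots> \<le> \<Phi> ^ q / (exp 1 * \<Phi>) ^ q"
    by (rule divide_right_mono[OF bernoulli_moment_bound[OF p c T less_imp_le[OF \<Phi>(1)] \<Phi>(2)]])
       (use \<Phi>(1) in auto)
  also have "\<dots> = exp (- real q)"
    using \<Phi>(1) exp_of_nat_mult[of q "1::real"] by (simp add: power_mult_distrib exp_minus divide_inverse)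
  finally show ?thesis .
qed

section \<open>Hypergraphs of bounded degree\<close>

text \<open>Reveal the elements of T in increasing order: those already seen enter through their
  indicators, those still to come through their mean t. The summand at y is the change when y is
  revealed.\<close>

lemma telescope_product:
  fixes T :: "nat set"
  assumes "finite T"
  shows "of_bool (T \<subseteq> B) - t ^ card T =
    (\<Sum>y\<in>T. centred t y B * (t ^ card (T \<inter> {y<..}) * of_bool (T \<inter> {..<y} \<subseteq> B)))"
  using assms
proof (induction T rule: finite_linorder_max_induct)
  case empty
  then show ?case by simp
next
  case (insert b A)
  have b: "b \<notin> A" using insert by auto
  have 1: "insert b A \<inter> {b<..} = {}" "insert b A \<inter> {..<b} = A"
    using insert by auto
  have 2: "card (insert b A \<inter> {y<..}) = Suc (card (A \<inter> {y<..}))" if "y \<in> A" for y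
  proof -
    have "insert b A \<inter> {y<..} = insert b (A \<inter> {y<..})" using insert that by auto
    then show ?thesis using insert(1) b by simp
  qed
  have 3: "insert b A \<inter> {..<y} = A \<inter> {..<y}" if "y \<in> A" for y
    using insert that by fastforce
  have "(\<Sum>y\<in>insert b A. centred t y B * (t ^ card (insert b A \<inter> {y<..}) * of_bool (insert b A \<inter> {..<y} \<subseteq> B)))
     = centred t b B * of_bool (A \<subseteq> B) +
       (\<Sum>y\<in>A. centred t y B * (t ^ Suc (card (A \<inter> {y<..})) * of_bool (A \<inter> {..<y} \<subseteq> B)))"
    using insert(1) b by (simp add: 1 2 3)
  also have "(\<Sum>y\<in>A. centred t y B * (t ^ Suc (card (A \<inter> {y<..})) * of_bool (A \<inter> {..<y} \<subseteq> B)))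
     = t * (of_bool (A \<subseteq> B) - t ^ card A)"
    unfolding insert.IH by (simp add: sum_distrib_left mult_ac)
  also have "centred t b B * of_bool (A \<subseteq> B) + t * (of_bool (A \<subseteq> B) - t ^ card A) =
     of_bool (insert b A \<subseteq> B) - t ^ card (insert b A)"
    using insert(1) b by (simp add: centred_def algebra_simps of_bool_conj)
  finally show ?case by simp
qed

lemma choose_le_power: "n choose i \<le> n ^ i"
proof (cases "i \<le> n")
  case True
  then show ?thesis by (rule binomial_le_pow)
qed (simp add: binomial_eq_0)

text \<open>The degree bound is assumed for each r-set, not through \<open>max_degree\<close>, whose
  value for r > N is a maximum over the empty set.\<close>

locale bounded_hypergraph =
  fixes k r N :: nat and C t :: real and H :: whypergraph
  assumes uniform: "uniform_whypergraph k N H"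
    and r: "2 \<le> r" "r \<le> k"
    and C_ge_1: "1 \<le> C"
    and t: "0 < t" "t \<le> 1"
    and degree_le: "\<And>R. R \<subseteq> {1..N} \<Longrightarrow> card R = r \<Longrightarrow> degree_set H R \<le> C"
begin

lemma C: "0 < C"
  using C_ge_1 by simp

lemma edge:
  assumes "e \<in> hedges H"
  shows "e \<subseteq> {1..N}" "card e = k" "hweight H e > 0" "finite e"
  using assms uniform finite_subset unfolding uniform_whypergraph_def by blast+

lemma finite_edges [simp]: "finite (hedges H)"
  by (rule finite_subset[of _ "Pow {1..N}"]) (use edge in auto)

lemma weight_nonneg: "e \<in> hedges H \<Longrightarrow> 0 \<le> hweight H e"
  using edge(3) by (simp add: less_imp_le)

lemma degree_set_eq: "degree_set H S = (\<Sum>e\<in>hedges H. hweight H e * of_bool (S \<subseteq> e))"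
  by (simp add: degree_set_def sum.inter_filter of_bool_def if_distrib cong: if_cong)

text \<open>An edge meeting U in at least i vertices contains an i-subset of U; sum the degrees over
  these subsets.\<close>

lemma edges_meeting_le:
  assumes U: "finite U" and D: "\<And>S'. S' \<subseteq> U \<Longrightarrow> card S' = i \<Longrightarrow> degree_set H (S \<union> S') \<le> D" "0 \<le> D"
  shows "(\<Sum>e\<in>hedges H. hweight H e * of_bool (S \<subseteq> e \<and> i \<le> card (e \<inter> U))) \<le> real (card U) ^ i * D"
proof -
  let ?\<S> = "{S'. S' \<subseteq> U \<and> card S' = i}"
  have fin: "finite ?\<S>" using U by simp
  have "(\<Sum>e\<in>hedges H. hweight H e * of_bool (S \<subseteq> e \<and> i \<le> card (e \<inter> U)))
     \<le> (\<Sum>e\<in>hedges H. hweight H e * (\<Sum>S'\<in>?\<S>. of_bool (S \<union> S' \<subseteq> e)))"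
  proof (intro sum_mono mult_left_mono weight_nonneg)
    fix e
    show "of_bool (S \<subseteq> e \<and> i \<le> card (e \<inter> U)) \<le> (\<Sum>S'\<in>?\<S>. of_bool (S \<union> S' \<subseteq> e) :: real)"
    proof (cases "S \<subseteq> e \<and> i \<le> card (e \<inter> U)")
      case True
      then obtain S' where S': "S' \<subseteq> e \<inter> U" "card S' = i"
        using obtain_subset_with_card_n by metis
      have "of_bool (S \<union> S' \<subseteq> e) \<le> (\<Sum>S'\<in>?\<S>. of_bool (S \<union> S' \<subseteq> e) :: real)"
        by (rule member_le_sum[OF _ _ fin]) (use S' in auto)
      then show ?thesis using True S' by simp
    qed (auto intro: sum_nonneg)
  qed
  also have "\<dots> = (\<Sum>S'\<in>?\<S>. degree_set H (S \<union> S'))"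
    unfolding degree_set_eq sum_distrib_left by (rule sum.swap)
  also have "\<dots> \<le> real (card ?\<S>) * D"
    by (rule sum_bounded_above) (use D in auto)
  also have "card ?\<S> = card U choose i"
    by (rule n_subsets[OF U])
  also have "real (card U choose i) * D \<le> real (card U) ^ i * D"
    using choose_le_power[of "card U" i] D(2)
    by (intro mult_right_mono) (simp_all add: of_nat_power[symmetric] del: of_nat_power)
  finally show ?thesis .
qed

text \<open>An edge containing S has k - card S \<ge> r - card S vertices outside S, so it contains
  an r-set extending S, and there are at most \<open>N ^ (r - card S)\<close> extensions.\<close>

lemma degree_set_le:
  assumes S: "S \<subseteq> {1..N}" "card S \<le> r"
  shows "degree_set H S \<le> C * real N ^ (r - card S)"
proof -
  let ?U = "{1..N} - S"
  have finS: "finite S" using S finite_subset by blast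
  have "degree_set H S = (\<Sum>e\<in>hedges H. hweight H e * of_bool (S \<subseteq> e \<and> r - card S \<le> card (e \<inter> ?U)))"
    unfolding degree_set_eq
  proof (intro sum.cong refl arg_cong2[where f="(*)"])
    fix e assume e: "e \<in> hedges H"
    have "r - card S \<le> card (e \<inter> ?U)" if "S \<subseteq> e"
    proof -
      have "e \<inter> ?U = e - S" using edge[OF e] by auto
      then show ?thesis using edge[OF e] r that finS by (simp add: card_Diff_subset)
    qed
    then show "of_bool (S \<subseteq> e) = (of_bool (S \<subseteq> e \<and> r - card S \<le> card (e \<inter> ?U)) :: real)" by auto
  qed
  also have "\<dots> \<le> real (card ?U) ^ (r - card S) * C"
  proof (rule edges_meeting_le)
    fix S' assume S': "S' \<subseteq> ?U" "card S' = r - card S"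
    then have "finite S'" by (meson finite_Diff finite_atLeastAtMost finite_subset)
    then have "card (S \<union> S') = r"
      using S' S finS by (subst card_Un_disjoint) auto
    then show "degree_set H (S \<union> S') \<le> C" using S' S by (intro degree_le) auto
  qed (use C in auto)
  also have "\<dots> \<le> real N ^ (r - card S) * C"
    using C card_mono[of "{1..N}" ?U] by (intro mult_right_mono power_mono) auto
  finally show ?thesis by (simp add: mult.commute)
qed

text \<open>The mean weight of the edges containing \<open>S\<close>, given that \<open>B\<close> contains \<open>S \<union> U\<close>.\<close>

definition cond_degree :: "nat set \<Rightarrow> nat set \<Rightarrow> real" where
  "cond_degree S U = (\<Sum>e\<in>hedges H. of_bool (S \<subseteq> e) * (hweight H e * t ^ card (e - S - U)))"

text \<open>Sort the edges by the number i of their vertices in U - S. If i < r - j, choosing these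
  vertices costs u^i, the degree of S together with them is at most C N^(r-j-i), and k - j - i
  factors t remain. Once r - j vertices lie in U, the degree hypothesis gives C without a power of
  N, and the remaining powers of t are bounded by 1; this last term is the source of the upper
  restriction on a.\<close>

lemma cond_degree_le:
  assumes S: "S \<subseteq> {1..N}" "card S = j" "j \<le> r" and U: "U \<subseteq> {1..N}" "real (card U) \<le> u"
  shows "cond_degree S U \<le>
    C * ((\<Sum>i<r-j. t ^ (k - j - i) * u ^ i * real N ^ (r - j - i)) + u ^ (r - j))"
proof -
  let ?V = "U - S"
  have finU: "finite U" and finS: "finite S" using S U finite_subset by blast+
  have u0: "0 \<le> u" using U by linarith
  have cV: "real (card ?V) ^ i \<le> u ^ i" for i
    using U card_mono[OF finU, of ?V] by (intro power_mono) auto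
  have deg: "(\<Sum>e\<in>hedges H. hweight H e * of_bool (S \<subseteq> e \<and> i \<le> card (e \<inter> ?V))) \<le> u ^ i * (C * real N ^ (r - j - i))"
    if "i \<le> r - j" for i
  proof -
    have "(\<Sum>e\<in>hedges H. hweight H e * of_bool (S \<subseteq> e \<and> i \<le> card (e \<inter> ?V)))
       \<le> real (card ?V) ^ i * (C * real N ^ (r - j - i))"
    proof (rule edges_meeting_le)
      fix S' assume S': "S' \<subseteq> ?V" "card S' = i"
      then have "finite S'" by (meson finite_Diff finU finite_subset)
      then have c: "card (S \<union> S') = j + i"
        using S' S finS by (subst card_Un_disjoint) auto
      then have "degree_set H (S \<union> S') \<le> C * real N ^ (r - card (S \<union> S'))"
        using S' S U that by (intro degree_set_le) auto
      then show "degree_set H (S \<union> S') \<le> C * real N ^ (r - j - i)" using c by simp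
    qed (use C finU in auto)
    also have "\<dots> \<le> u ^ i * (C * real N ^ (r - j - i))"
      using cV C by (intro mult_right_mono) auto
    finally show ?thesis .
  qed
  have "cond_degree S U \<le> (\<Sum>e\<in>hedges H. hweight H e *
     ((\<Sum>i<r-j. t ^ (k - j - i) * of_bool (S \<subseteq> e \<and> i \<le> card (e \<inter> ?V))) + of_bool (S \<subseteq> e \<and> r - j \<le> card (e \<inter> ?V))))"
    unfolding cond_degree_def
  proof (intro sum_mono)
    fix e assume e: "e \<in> hedges H"
    let ?c = "card (e \<inter> ?V)"
    have "t ^ card (e - S - U) \<le> (\<Sum>i<r-j. t ^ (k - j - i) * of_bool (i \<le> ?c)) + of_bool (r - j \<le> ?c)"
      if Se: "S \<subseteq> e"
    proof (cases "r - j \<le> ?c")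
      case True
      have "t ^ card (e - S - U) \<le> 1" using t by (simp add: power_le_one)
      moreover have "0 \<le> (\<Sum>i<r-j. t ^ (k - j - i) * of_bool (i \<le> ?c))"
        using t by (intro sum_nonneg) auto
      ultimately show ?thesis using True by simp
    next
      case False
      have "e - S - U = (e - S) - (e \<inter> ?V)" by auto
      then have "card (e - S - U) = card (e - S) - ?c"
        using edge[OF e] by (subst card_Diff_subset[symmetric]) auto
      then have "card (e - S - U) = k - j - ?c"
        using edge[OF e] Se finS S by (simp add: card_Diff_subset)
      then have "t ^ card (e - S - U) = t ^ (k - j - ?c) * of_bool (?c \<le> ?c)" by simp
      also have "\<dots> \<le> (\<Sum>i<r-j. t ^ (k - j - i) * of_bool (i \<le> ?c))"
        by (rule member_le_sum) (use False t in auto)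
      finally show ?thesis using False by simp
    qed
    then show "of_bool (S \<subseteq> e) * (hweight H e * t ^ card (e - S - U)) \<le> hweight H e *
     ((\<Sum>i<r-j. t ^ (k - j - i) * of_bool (S \<subseteq> e \<and> i \<le> ?c)) + of_bool (S \<subseteq> e \<and> r - j \<le> ?c))"
      using weight_nonneg[OF e] by (cases "S \<subseteq> e") (auto intro!: mult_left_mono)
  qed
  also have "\<dots> = (\<Sum>i<r-j. t ^ (k - j - i) * (\<Sum>e\<in>hedges H. hweight H e * of_bool (S \<subseteq> e \<and> i \<le> card (e \<inter> ?V))))
      + (\<Sum>e\<in>hedges H. hweight H e * of_bool (S \<subseteq> e \<and> r - j \<le> card (e \<inter> ?V)))"
    unfolding distrib_left sum.distrib sum_distrib_left
    by (subst sum.swap) (simp add: mult_ac)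
  also have "\<dots> \<le> (\<Sum>i<r-j. t ^ (k - j - i) * (u ^ i * (C * real N ^ (r - j - i))))
      + u ^ (r - j) * (C * real N ^ (r - j - (r - j)))"
    using t by (intro add_mono sum_mono mult_left_mono deg) auto
  also have "\<dots> = C * ((\<Sum>i<r-j. t ^ (k - j - i) * u ^ i * real N ^ (r - j - i)) + u ^ (r - j))"
    by (simp add: distrib_left sum_distrib_left mult_ac)
  finally show ?thesis .
qed

text \<open>The scale of the mean degree of a vertex inside B: the edges at it have weight at most C
  N^(r-1), and the other k - 1 vertices of each are all present with probability t^(k-1).\<close>

definition typical_degree :: real where
  "typical_degree = t ^ (k - 1) * real N ^ (r - 1)"

text \<open>Since r \<le> k and t \<le> 1, the typical degree is at most (t N)^(r-1); take
  roots.\<close>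

lemma small_exponent_bound:
  assumes u: "0 \<le> u" "u ^ (r - 1) \<le> \<epsilon> ^ (r - 1) * typical_degree" and \<epsilon>: "0 \<le> \<epsilon>" 
  shows "u \<le> \<epsilon> * (t * real N)"
proof -
  have "t ^ (k - 1) \<le> t ^ (r - 1)"
    using t r by (intro power_decreasing) auto
  then have "\<epsilon> ^ (r - 1) * typical_degree \<le> \<epsilon> ^ (r - 1) * (t ^ (r - 1) * real N ^ (r - 1))"
    unfolding typical_degree_def using \<epsilon> by (intro mult_left_mono mult_right_mono) auto
  then have "u ^ (r - 1) \<le> (\<epsilon> * (t * real N)) ^ (r - 1)"
    using u by (simp add: power_mult_distrib)
  then show ?thesis
    using r \<epsilon> t by (subst (asm) power_mono_iff) (use u in auto)
qed

text \<open>In \<open>cond_degree_le\<close> with j = 1, replacing u by t N turns each of the terms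
  with i < r - 1 into exactly the typical degree; the last term is the hypothesis on u.\<close>

lemma cond_degree_vertex_le:
  assumes x: "x \<in> {1..N}" and U: "U \<subseteq> {1..N}" "real (card U) \<le> u"
    and u: "u ^ (r - 1) \<le> typical_degree"
  shows "cond_degree {x} U \<le> C * (real r * typical_degree)"
proof -
  have u0: "0 \<le> u" using U by linarith
  have u1: "u \<le> t * real N" using small_exponent_bound[of u 1] u u0 by simp
  have "t ^ (k - 1 - i) * u ^ i * real N ^ (r - 1 - i) \<le> typical_degree" if "i < r - 1" for i
  proof -
    have "t ^ (k - 1 - i) * u ^ i * real N ^ (r - 1 - i) \<le> t ^ (k - 1 - i) * (t * real N) ^ i * real N ^ (r - 1 - i)"
      using t u0 u1 by (intro mult_right_mono mult_left_mono power_mono) auto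
    also have "\<dots> = (t ^ (k - 1 - i) * t ^ i) * (real N ^ i * real N ^ (r - 1 - i))"
      by (simp add: power_mult_distrib mult_ac)
    also have "\<dots> = typical_degree"
      unfolding power_add[symmetric] typical_degree_def using that r by simp
    finally show ?thesis .
  qed
  then have "(\<Sum>i<r-1. t ^ (k - 1 - i) * u ^ i * real N ^ (r - 1 - i)) \<le> real (card {..<r-1}) * typical_degree"
    by (intro sum_bounded_above) auto
  then have "(\<Sum>i<r-1. t ^ (k - 1 - i) * u ^ i * real N ^ (r - 1 - i)) + u ^ (r - 1) \<le> real r * typical_degree"
    using u r by (simp add: of_nat_diff algebra_simps)
  then show ?thesis
    using cond_degree_le[of "{x}" 1 U u] x U r C
      mult_left_mono[of _ "real r * typical_degree" C] by (smt (verit) card_1_singleton_iff One_nat_def card.empty card_insert_disjoint empty_iff empty_subsetI finite.emptyI insert_subset numeral_2_eq_2 Suc_leD)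
qed

text \<open>The Freedman parameter in \<open>degree_dev_uniform\<close> is of order u divided by the
  typical degree, so the product with u is what controls parameter times jump. The extra u supplies
  at least one factor \<epsilon> in every term.\<close>

lemma cond_degree_pair_le:
  assumes xy: "x \<in> {1..N}" "y \<in> {1..N}" "x \<noteq> y" and U: "U \<subseteq> {1..N}" "real (card U) \<le> u"
    and u: "u ^ (r - 1) \<le> \<epsilon> ^ (r - 1) * typical_degree" and \<epsilon>: "0 \<le> \<epsilon>" "\<epsilon> \<le> 1"
  shows "u * cond_degree {x, y} U \<le> C * (real r * (\<epsilon> * typical_degree))"
proof -
  have u0: "0 \<le> u" using U by linarith
  have u1: "u \<le> \<epsilon> * (t * real N)" using small_exponent_bound[of u \<epsilon>] u u0 \<epsilon> by simp
  have typ0: "0 \<le> typical_degree" using t by (simp add: typical_degree_def)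
  have \<epsilon>p: "\<epsilon> ^ Suc i \<le> \<epsilon>" for i
    using \<epsilon> power_decreasing[of 1 "Suc i" \<epsilon>] by simp
  have "u * (t ^ (k - 2 - i) * u ^ i * real N ^ (r - 2 - i)) \<le> \<epsilon> * typical_degree" if "i < r - 2" for i
  proof -
    have "u * (t ^ (k - 2 - i) * u ^ i * real N ^ (r - 2 - i)) = t ^ (k - 2 - i) * u ^ Suc i * real N ^ (r - 2 - i)"
      by simp
    also have "\<dots> \<le> t ^ (k - 2 - i) * (\<epsilon> * (t * real N)) ^ Suc i * real N ^ (r - 2 - i)"
      using t u0 u1 by (intro mult_right_mono mult_left_mono power_mono) auto
    also have "\<dots> = \<epsilon> ^ Suc i * ((t ^ (k - 2 - i) * t ^ Suc i) * (real N ^ Suc i * real N ^ (r - 2 - i)))"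
      by (simp add: power_mult_distrib mult_ac)
    also have "\<dots> = \<epsilon> ^ Suc i * typical_degree"
    proof -
      have *: "k - 2 - i + Suc i = k - 1" "Suc i + (r - 2 - i) = r - 1" using that r by auto
      show ?thesis unfolding power_add[symmetric] typical_degree_def * ..
    qed
    also have "\<dots> \<le> \<epsilon> * typical_degree"
      by (intro mult_right_mono \<epsilon>p typ0)
    finally show ?thesis .
  qed
  then have "(\<Sum>i<r-2. u * (t ^ (k - 2 - i) * u ^ i * real N ^ (r - 2 - i))) \<le> real (card {..<r-2}) * (\<epsilon> * typical_degree)"
    by (intro sum_bounded_above) auto
  moreover have "u * u ^ (r - 2) \<le> \<epsilon> * typical_degree"
  proof -
    have r': "r - 1 = Suc (r - 2)" using r by simp
    have "u * u ^ (r - 2) \<le> \<epsilon> ^ Suc (r - 2) * typical_degree" using u unfolding r' by simp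
    also have "\<dots> \<le> \<epsilon> * typical_degree" by (intro mult_right_mono \<epsilon>p typ0)
    finally show ?thesis .
  qed
  moreover have "real (card {..<r-2}) * (\<epsilon> * typical_degree) + \<epsilon> * typical_degree \<le> real r * (\<epsilon> * typical_degree)"
    using r typ0 \<epsilon> by (simp add: of_nat_diff algebra_simps)
  ultimately have *: "u * ((\<Sum>i<r-2. t ^ (k - 2 - i) * u ^ i * real N ^ (r - 2 - i)) + u ^ (r - 2)) \<le> real r * (\<epsilon> * typical_degree)"
    by (simp add: distrib_left sum_distrib_left)
  have "u * cond_degree {x, y} U \<le> u * (C * ((\<Sum>i<r-2. t ^ (k - 2 - i) * u ^ i * real N ^ (r - 2 - i)) + u ^ (r - 2)))"
    using xy U r by (intro mult_left_mono cond_degree_le u0) auto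
  also have "\<dots> \<le> C * (real r * (\<epsilon> * typical_degree))"
    using mult_left_mono[OF *, of C] C by (simp add: mult_ac)
  finally show ?thesis .
qed

text \<open>In the martingale that reveals \<open>B\<close> vertex by vertex, \<open>(\<xi>\<^sub>x - t) degree_dev x\<close> is the increment
  at \<open>x\<close> of the nonlinear part of the edge count, and \<open>(\<xi>\<^sub>y - t) codegree x y\<close>, for \<open>y < x\<close>, is the
  increment at \<open>y\<close> of \<open>degree_dev x\<close>.\<close>

definition codegree :: "nat \<Rightarrow> nat \<Rightarrow> nat set \<Rightarrow> real" where
  "codegree x y B = (\<Sum>e\<in>{e\<in>hedges H. x \<in> e \<and> y \<in> e}.
     hweight H e * t ^ (card (e \<inter> {y<..}) - 1) * of_bool (e \<inter> {..<y} \<subseteq> B))"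

definition degree_dev :: "nat \<Rightarrow> nat set \<Rightarrow> real" where
  "degree_dev x B = (\<Sum>e\<in>{e\<in>hedges H. x \<in> e}. hweight H e * t ^ card (e \<inter> {x<..}) *
     (of_bool (e \<inter> {..<x} \<subseteq> B) - t ^ card (e \<inter> {..<x})))"

definition remainder :: "nat set \<Rightarrow> real" where
  "remainder B = edge_count H B - t ^ k * total_weight H -
     t ^ (k - 1) * (\<Sum>x=1..N. vertex_degree H x * centred t x B)"

lemma edge_count_eq: "edge_count H B = (\<Sum>e\<in>hedges H. hweight H e * of_bool (e \<subseteq> B))"
  by (simp add: edge_count_def total_weight_def induced_def sum.inter_filter of_bool_def if_distrib cong: if_cong)

lemma degree_dev_eq:
  "degree_dev x B = (\<Sum>y=1..N. centred t y B * (if y < x then codegree x y B else 0))"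
proof -
  let ?g = "\<lambda>e y. hweight H e * t ^ (card (e \<inter> {y<..}) - 1) * of_bool (e \<inter> {..<y} \<subseteq> B)"
  have *: "hweight H e * t ^ card (e \<inter> {x<..}) * (of_bool (e \<inter> {..<x} \<subseteq> B) - t ^ card (e \<inter> {..<x}))
     = (\<Sum>y=1..N. of_bool (y \<in> e \<and> y < x) * (centred t y B * ?g e y))"
    if e: "e \<in> hedges H" "x \<in> e" for e
  proof -
    have fin: "finite (e \<inter> {..<x})" using edge[OF e(1)] by auto
    have sub: "e \<inter> {..<x} \<inter> {..<y} = e \<inter> {..<y}" if "y \<in> e \<inter> {..<x}" for y using that by auto
    \<comment> \<open>The subtracted 1 accounts for x: the other vertices of e above y are those
      above x and those between y and x.\<close>
    have crd: "card (e \<inter> {y<..}) - 1 = card (e \<inter> {x<..}) + card (e \<inter> {..<x} \<inter> {y<..})" if "y \<in> e \<inter> {..<x}" for y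
    proof -
      have "e \<inter> {y<..} = insert x ((e \<inter> {x<..}) \<union> (e \<inter> {..<x} \<inter> {y<..}))"
        using that e by auto
      moreover have "card ((e \<inter> {x<..}) \<union> (e \<inter> {..<x} \<inter> {y<..})) = card (e \<inter> {x<..}) + card (e \<inter> {..<x} \<inter> {y<..})"
        using edge[OF e(1)] by (intro card_Un_disjoint) auto
      moreover have "card (insert x ((e \<inter> {x<..}) \<union> (e \<inter> {..<x} \<inter> {y<..}))) =
          Suc (card ((e \<inter> {x<..}) \<union> (e \<inter> {..<x} \<inter> {y<..})))"
        using edge[OF e(1)] by (intro card_insert_disjoint) auto
      ultimately show ?thesis by simp
    qed
    have "hweight H e * t ^ card (e \<inter> {x<..}) * (of_bool (e \<inter> {..<x} \<subseteq> B) - t ^ card (e \<inter> {..<x}))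
       = (\<Sum>y\<in>e \<inter> {..<x}. centred t y B * ?g e y)"
      unfolding telescope_product[OF fin] sum_distrib_left
      by (intro sum.cong refl) (simp only: sub crd power_add mult_ac)
    also have "\<dots> = (\<Sum>y=1..N. of_bool (y \<in> e \<and> y < x) * (centred t y B * ?g e y))"
    proof -
      have "e \<inter> {..<x} = {y \<in> {1..N}. y \<in> e \<and> y < x}"
        using edge[OF e(1)] by auto
      then show ?thesis
        by (simp only: sum_filter_of_bool[OF finite_atLeastAtMost])
    qed
    finally show ?thesis .
  qed
  have "degree_dev x B = (\<Sum>e\<in>{e\<in>hedges H. x \<in> e}. \<Sum>y=1..N. of_bool (y \<in> e \<and> y < x) * (centred t y B * ?g e y))"
    unfolding degree_dev_def by (intro sum.cong refl *) auto
  also have "\<dots> = (\<Sum>y=1..N. \<Sum>e\<in>{e\<in>hedges H. x \<in> e}. of_bool (y \<in> e \<and> y < x) * (centred t y B * ?g e y))"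
    by (rule sum.swap)
  also have "\<dots> = (\<Sum>y=1..N. centred t y B * (if y < x then codegree x y B else 0))"
  proof (intro sum.cong refl)
    fix y
    have "codegree x y B = (\<Sum>e\<in>{e\<in>hedges H. x \<in> e}. of_bool (y \<in> e) * ?g e y)"
      unfolding codegree_def by (subst (1 2) sum.inter_filter) (auto intro!: sum.cong)
    then show "(\<Sum>e\<in>{e\<in>hedges H. x \<in> e}. of_bool (y \<in> e \<and> y < x) * (centred t y B * ?g e y)) =
       centred t y B * (if y < x then codegree x y B else 0)"
      by (simp add: sum_distrib_left mult_ac)
  qed
  finally show ?thesis .
qed

text \<open>Telescoping an edge gives the increment at x a power of t for the vertices above x and
  an indicator for those below. The linear form has the mean of this indicator in its place, since
  the vertices above and below x number k - 1; the difference is \<open>degree_dev\<close>.\<close>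

lemma remainder_eq: "remainder B = (\<Sum>x=1..N. centred t x B * degree_dev x B)"
proof -
  let ?h = "\<lambda>e x. hweight H e * t ^ card (e \<inter> {x<..})"
  have filt: "(\<Sum>x\<in>e. g x) = (\<Sum>x=1..N. of_bool (x \<in> e) * g x)" if "e \<in> hedges H" for e and g :: "nat \<Rightarrow> real"
  proof -
    have "e = {x \<in> {1..N}. x \<in> e}" using edge[OF that] by auto
    then have "(\<Sum>x\<in>e. g x) = (\<Sum>x\<in>{x \<in> {1..N}. x \<in> e}. g x)" by simp
    also have "\<dots> = (\<Sum>x=1..N. of_bool (x \<in> e) * g x)"
      by (rule sum_filter_of_bool) simp
    finally show ?thesis .
  qed
  have 1: "edge_count H B - t ^ k * total_weight H =
      (\<Sum>e\<in>hedges H. \<Sum>x=1..N. of_bool (x \<in> e) * (centred t x B * (?h e x * of_bool (e \<inter> {..<x} \<subseteq> B))))"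
  proof -
    have "edge_count H B - t ^ k * total_weight H = (\<Sum>e\<in>hedges H. hweight H e * (of_bool (e \<subseteq> B) - t ^ card e))"
      unfolding edge_count_eq total_weight_def sum_distrib_left sum_subtractf[symmetric]
      using edge by (intro sum.cong refl) (simp add: right_diff_distrib mult.commute)
    also have "\<dots> = (\<Sum>e\<in>hedges H. \<Sum>x=1..N. of_bool (x \<in> e) * (centred t x B * (?h e x * of_bool (e \<inter> {..<x} \<subseteq> B))))"
    proof (intro sum.cong refl)
      fix e assume e: "e \<in> hedges H"
      show "hweight H e * (of_bool (e \<subseteq> B) - t ^ card e) =
        (\<Sum>x=1..N. of_bool (x \<in> e) * (centred t x B * (?h e x * of_bool (e \<inter> {..<x} \<subseteq> B))))"
        unfolding telescope_product[OF edge(4)[OF e]] filt[OF e, symmetric] sum_distrib_left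
        by (intro sum.cong refl) (simp add: mult_ac)
    qed
    finally show ?thesis .
  qed
  have 2: "t ^ (k - 1) * (\<Sum>x=1..N. vertex_degree H x * centred t x B) =
     (\<Sum>x=1..N. \<Sum>e\<in>hedges H. of_bool (x \<in> e) * (centred t x B * (?h e x * t ^ card (e \<inter> {..<x}))))"
    unfolding sum_distrib_left
  proof (intro sum.cong refl)
    fix x
    have "k - 1 = card (e \<inter> {x<..}) + card (e \<inter> {..<x})" if e: "e \<in> hedges H" "x \<in> e" for e
    proof -
      have "e = insert x ((e \<inter> {x<..}) \<union> (e \<inter> {..<x}))" using e by auto
      moreover have "card ((e \<inter> {x<..}) \<union> (e \<inter> {..<x})) = card (e \<inter> {x<..}) + card (e \<inter> {..<x})"
        using edge[OF e(1)] by (intro card_Un_disjoint) auto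
      ultimately have "card e = Suc (card (e \<inter> {x<..}) + card (e \<inter> {..<x}))"
        using edge(4)[OF e(1)] by (metis (no_types, lifting) Int_iff Un_iff card_insert_disjoint finite_Int finite_UnI greaterThan_iff lessThan_iff less_irrefl)
      then show ?thesis using edge[OF e(1)] by simp
    qed
    then show "t ^ (k - 1) * (vertex_degree H x * centred t x B) =
     (\<Sum>e\<in>hedges H. of_bool (x \<in> e) * (centred t x B * (?h e x * t ^ card (e \<inter> {..<x}))))"
      unfolding vertex_degree_def degree_set_eq sum_distrib_left sum_distrib_right
      by (intro sum.cong refl) (auto simp: power_add)
  qed
  have "remainder B = (\<Sum>x=1..N. \<Sum>e\<in>hedges H. of_bool (x \<in> e) * (centred t x B * (?h e x * (of_bool (e \<inter> {..<x} \<subseteq> B) - t ^ card (e \<inter> {..<x})))))"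
    unfolding remainder_def 1 2 by (subst sum.swap) (simp add: sum_subtractf[symmetric] algebra_simps)
  also have "\<dots> = (\<Sum>x=1..N. centred t x B * degree_dev x B)"
    unfolding degree_dev_def sum_distrib_left
    by (simp add: sum_filter_of_bool)
  finally show ?thesis .
qed

section \<open>Tail bounds for codegrees, degree deviations and the remainder\<close>

lemma codegree_nonneg: "0 \<le> codegree x y B"
  unfolding codegree_def using t weight_nonneg by (intro sum_nonneg mult_nonneg_nonneg) auto

lemma codegree_tail:
  assumes xy: "x \<in> {1..N}" "y \<in> {1..N}" "y < x"
    and \<Phi>: "0 < \<Phi>" "\<And>U. U \<subseteq> {1..N} \<Longrightarrow> card U \<le> k * q \<Longrightarrow> cond_degree {x, y} U \<le> \<Phi>"
  shows "bernoulli_prob t N (\<lambda>B. exp 1 * \<Phi> \<le> codegree x y B) \<le> exp (- real q)"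
  unfolding codegree_def
proof (rule bernoulli_moment_tail[where \<kappa> = k])
  let ?I = "{e\<in>hedges H. x \<in> e \<and> y \<in> e}"
  show "0 \<le> t" "t \<le> 1" "0 < \<Phi>" using t \<Phi> by auto
  show "0 \<le> hweight H e * t ^ (card (e \<inter> {y<..}) - 1)" if "e \<in> ?I" for e
    using that t weight_nonneg by auto
  show "e \<inter> {..<y} \<subseteq> {1..N} \<and> card (e \<inter> {..<y}) \<le> k" if "e \<in> ?I" for e
    using that edge[of e] card_mono[of e "e \<inter> {..<y}"] by auto
  fix U assume U: "U \<subseteq> {1..N}" "card U \<le> k * q"
  \<comment> \<open>On the left only vertices of U below y are discounted, whereas
    \<open>cond_degree\<close> also discounts those above y. This lowers the exponent of t and so
    can only increase the sum, as t \<le> 1.\<close>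
  have "(\<Sum>e\<in>?I. hweight H e * t ^ (card (e \<inter> {y<..}) - 1) * t ^ card (e \<inter> {..<y} - U))
      \<le> (\<Sum>e\<in>?I. hweight H e * t ^ card (e - {x, y} - U))"
  proof (rule sum_mono)
    fix e assume e: "e \<in> ?I"
    then have fin: "finite e" using edge by auto
    have "card (e - {x, y} - U) \<le> card ((e \<inter> {y<..} - {x}) \<union> (e \<inter> {..<y} - U))"
      using fin by (intro card_mono) auto
    also have "\<dots> \<le> card (e \<inter> {y<..} - {x}) + card (e \<inter> {..<y} - U)" by (rule card_Un_le)
    also have "card (e \<inter> {y<..} - {x}) = card (e \<inter> {y<..}) - 1"
      using e xy fin by (subst card_Diff_singleton) auto
    finally have "t ^ (card (e \<inter> {y<..}) - 1 + card (e \<inter> {..<y} - U)) \<le> t ^ card (e - {x, y} - U)"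
      using t by (intro power_decreasing) auto
    then show "hweight H e * t ^ (card (e \<inter> {y<..}) - 1) * t ^ card (e \<inter> {..<y} - U)
        \<le> hweight H e * t ^ card (e - {x, y} - U)"
      using weight_nonneg e by (simp add: power_add mult.assoc mult_left_mono)
  qed
  also have "\<dots> = cond_degree {x, y} U"
    unfolding cond_degree_def by (simp add: sum_filter_of_bool)
  also have "\<dots> \<le> \<Phi>" using \<Phi> U by simp
  finally show "(\<Sum>e\<in>?I. hweight H e * t ^ (card (e \<inter> {y<..}) - 1) * t ^ card (e \<inter> {..<y} - U)) \<le> \<Phi>" .
qed

text \<open>Together with a bound on the largest codegree, this bound on the sum controls the sum of
  squares. The factor t restores the vertex y, so that every term is of the size of a mean degree;
  an edge is counted once for each of its vertices below x, whence the factor k.\<close>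

lemma codegree_sum_tail:
  assumes x: "x \<in> {1..N}"
    and \<Phi>: "0 < \<Phi>" "\<And>U. U \<subseteq> {1..N} \<Longrightarrow> card U \<le> k * q \<Longrightarrow> cond_degree {x} U \<le> \<Phi>"
  shows "bernoulli_prob t N (\<lambda>B. exp 1 * (real k * \<Phi>) \<le> t * (\<Sum>y=1..N. if y < x then codegree x y B else 0))
     \<le> exp (- real q)"
proof -
  let ?E = "{e\<in>hedges H. x \<in> e}"
  let ?I = "Sigma ?E (\<lambda>e. e \<inter> {..<x})"
  let ?c = "\<lambda>(e, y). hweight H e * t ^ card (e \<inter> {y<..})"
  let ?T = "\<lambda>(e, y). e \<inter> {..<y}"
  have finE: "finite ?E" by simp
  have finI: "\<forall>e\<in>?E. finite (e \<inter> {..<x})" using edge by auto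
  have eq: "t * (\<Sum>y=1..N. if y < x then codegree x y B else 0) = (\<Sum>i\<in>?I. ?c i * of_bool (?T i \<subseteq> B))" for B
  proof -
    have "(\<Sum>i\<in>?I. ?c i * of_bool (?T i \<subseteq> B)) =
       (\<Sum>e\<in>?E. \<Sum>y\<in>e \<inter> {..<x}. hweight H e * t ^ card (e \<inter> {y<..}) * of_bool (e \<inter> {..<y} \<subseteq> B))"
      by (subst sum.Sigma[OF finE finI]) (simp add: split_beta)
    also have "\<dots> = (\<Sum>e\<in>?E. \<Sum>y=1..N. of_bool (y \<in> e \<and> y < x) * (hweight H e * t ^ card (e \<inter> {y<..}) * of_bool (e \<inter> {..<y} \<subseteq> B)))"
    proof (rule sum.cong[OF refl])
      fix e assume e: "e \<in> ?E"
      have "e \<inter> {..<x} = {y \<in> {1..N}. y \<in> e \<and> y < x}"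
        using edge[of e] e by auto
      then show "(\<Sum>y\<in>e \<inter> {..<x}. hweight H e * t ^ card (e \<inter> {y<..}) * of_bool (e \<inter> {..<y} \<subseteq> B)) =
        (\<Sum>y=1..N. of_bool (y \<in> e \<and> y < x) * (hweight H e * t ^ card (e \<inter> {y<..}) * of_bool (e \<inter> {..<y} \<subseteq> B)))"
        by (simp only: sum_filter_of_bool[OF finite_atLeastAtMost])
    qed
    also have "\<dots> = (\<Sum>y=1..N. \<Sum>e\<in>?E. of_bool (y \<in> e \<and> y < x) * (hweight H e * t ^ card (e \<inter> {y<..}) * of_bool (e \<inter> {..<y} \<subseteq> B)))"
      by (rule sum.swap)
    also have "\<dots> = (\<Sum>y=1..N. t * (if y < x then codegree x y B else 0))"
    proof (intro sum.cong refl)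
      fix y
      have "t * codegree x y B = (\<Sum>e\<in>?E. of_bool (y \<in> e) * (hweight H e * t ^ card (e \<inter> {y<..}) * of_bool (e \<inter> {..<y} \<subseteq> B)))"
        if "y < x"
      proof -
        have "{e \<in> hedges H. x \<in> e \<and> y \<in> e} = {e \<in> ?E. y \<in> e}" by auto
        then have "t * codegree x y B = (\<Sum>e\<in>?E. of_bool (y \<in> e) * (t * (hweight H e * t ^ (card (e \<inter> {y<..}) - 1) * of_bool (e \<inter> {..<y} \<subseteq> B))))"
          unfolding codegree_def sum_distrib_left by (simp only: sum_filter_of_bool[OF finE])
        also have "\<dots> = (\<Sum>e\<in>?E. of_bool (y \<in> e) * (hweight H e * t ^ card (e \<inter> {y<..}) * of_bool (e \<inter> {..<y} \<subseteq> B)))"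
        proof (intro sum.cong refl)
          fix e assume e: "e \<in> ?E"
          have "card (e \<inter> {y<..}) \<noteq> 0" using e edge[of e] that by auto
          then have "t * t ^ (card (e \<inter> {y<..}) - 1) = t ^ card (e \<inter> {y<..})"
            by (metis power_minus_mult mult.commute neq0_conv)
          then show "of_bool (y \<in> e) * (t * (hweight H e * t ^ (card (e \<inter> {y<..}) - 1) * of_bool (e \<inter> {..<y} \<subseteq> B))) =
            of_bool (y \<in> e) * (hweight H e * t ^ card (e \<inter> {y<..}) * of_bool (e \<inter> {..<y} \<subseteq> B))"
            by (simp add: mult_ac)
        qed
        finally show ?thesis .
      qed
      then show "(\<Sum>e\<in>?E. of_bool (y \<in> e \<and> y < x) * (hweight H e * t ^ card (e \<inter> {y<..}) * of_bool (e \<inter> {..<y} \<subseteq> B))) =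
        t * (if y < x then codegree x y B else 0)"
        by simp
    qed
    finally show ?thesis by (simp only: sum_distrib_left)
  qed
  show ?thesis
    unfolding eq
  proof (rule bernoulli_moment_tail[where \<kappa> = k])
    show "0 \<le> t" "t \<le> 1" using t by auto
    show "0 < real k * \<Phi>" using r \<Phi> by simp
    show "0 \<le> ?c i" if "i \<in> ?I" for i
      using that t weight_nonneg by auto
    show "?T i \<subseteq> {1..N} \<and> card (?T i) \<le> k" if iI: "i \<in> ?I" for i
    proof -
      obtain e y where i: "i = (e, y)" "e \<in> hedges H" using iI by (cases i) auto
      show ?thesis using edge[OF i(2)] card_mono[of e "e \<inter> {..<y}"] i by auto
    qed
    fix U assume U: "U \<subseteq> {1..N}" "card U \<le> k * q"
    have "(\<Sum>i\<in>?I. ?c i * t ^ card (?T i - U)) =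
        (\<Sum>e\<in>?E. \<Sum>y\<in>e \<inter> {..<x}. hweight H e * t ^ card (e \<inter> {y<..}) * t ^ card (e \<inter> {..<y} - U))"
      by (subst sum.Sigma[OF finE finI]) (simp add: split_beta)
    also have "\<dots> \<le> (\<Sum>e\<in>?E. real k * (hweight H e * t ^ card (e - {x} - U)))"
    proof (rule sum_mono)
      fix e assume e: "e \<in> ?E"
      then have fin: "finite e" using edge by auto
      have "(\<Sum>y\<in>e \<inter> {..<x}. hweight H e * t ^ card (e \<inter> {y<..}) * t ^ card (e \<inter> {..<y} - U))
        \<le> real (card (e \<inter> {..<x})) * (hweight H e * t ^ card (e - {x} - U))"
      proof (rule sum_bounded_above)
        fix y assume y: "y \<in> e \<inter> {..<x}"
        have "card (e - {x} - U) \<le> card (insert y (e \<inter> {y<..} - {x}) \<union> (e \<inter> {..<y} - U))"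
          using fin by (intro card_mono) auto
        also have "\<dots> \<le> card (insert y (e \<inter> {y<..} - {x})) + card (e \<inter> {..<y} - U)" by (rule card_Un_le)
        also have "card (insert y (e \<inter> {y<..} - {x})) = Suc (card (e \<inter> {y<..} - {x}))"
          using fin by (intro card_insert_disjoint) auto
        also have "Suc (card (e \<inter> {y<..} - {x})) = card (e \<inter> {y<..})"
          using e y fin by (intro card_Suc_Diff1) auto
        finally have "t ^ (card (e \<inter> {y<..}) + card (e \<inter> {..<y} - U)) \<le> t ^ card (e - {x} - U)"
          using t by (intro power_decreasing) auto
        then show "hweight H e * t ^ card (e \<inter> {y<..}) * t ^ card (e \<inter> {..<y} - U)
            \<le> hweight H e * t ^ card (e - {x} - U)"
          using weight_nonneg e by (simp add: power_add mult.assoc mult_left_mono)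
      qed
      also have "\<dots> \<le> real k * (hweight H e * t ^ card (e - {x} - U))"
        using t weight_nonneg[of e] e edge[of e] card_mono[OF fin, of "e \<inter> {..<x}"]
        by (intro mult_right_mono) auto
      finally show "(\<Sum>y\<in>e \<inter> {..<x}. hweight H e * t ^ card (e \<inter> {y<..}) * t ^ card (e \<inter> {..<y} - U))
        \<le> real k * (hweight H e * t ^ card (e - {x} - U))" .
    qed
    also have "\<dots> = real k * cond_degree {x} U"
      unfolding cond_degree_def sum_distrib_left by (simp add: sum_filter_of_bool mult_ac)
    also have "\<dots> \<le> real k * \<Phi>" using \<Phi> U by (intro mult_left_mono) auto
    finally show "(\<Sum>i\<in>?I. ?c i * t ^ card (?T i - U)) \<le> real k * \<Phi>" .
  qed
qed

lemma codegree_insert: "y \<le> z \<Longrightarrow> codegree x y (insert z B) = codegree x y B"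
proof -
  assume "y \<le> z"
  then have "e \<inter> {..<y} \<subseteq> insert z B \<longleftrightarrow> e \<inter> {..<y} \<subseteq> B" for e by auto
  then show ?thesis by (simp add: codegree_def)
qed

lemma degree_dev_insert: "x \<le> z \<Longrightarrow> degree_dev x (insert z B) = degree_dev x B"
proof -
  assume "x \<le> z"
  then have "e \<inter> {..<x} \<subseteq> insert z B \<longleftrightarrow> e \<inter> {..<x} \<subseteq> B" for e by auto
  then show ?thesis by (simp add: degree_dev_def)
qed

text \<open>Freedman's inequality, with the quadratic variation bounded by the largest jump times
  the sum of the jumps; this exploits that codegrees are nonnegative.\<close>

lemma degree_dev_tail:
  assumes \<theta>: "0 \<le> \<theta>" and b: "0 \<le> b"
  shows "bernoulli_prob t N (\<lambda>B. s \<le> \<bar>degree_dev x B\<bar> \<and> (\<forall>y\<in>{1..N}. y < x \<longrightarrow> codegree x y B \<le> b) \<and>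
      t * (\<Sum>y=1..N. if y < x then codegree x y B else 0) \<le> A)
    \<le> 2 * exp (- \<theta> * s + \<theta>\<^sup>2 / 2 * exp (\<theta> * b) * (b * A))"
proof -
  let ?G = "\<lambda>y B. if y < x then codegree x y B else 0"
  have t': "0 \<le> t" "t \<le> 1" using t by auto
  have "bernoulli_prob t N (\<lambda>B. s \<le> \<bar>degree_dev x B\<bar> \<and> (\<forall>y\<in>{1..N}. y < x \<longrightarrow> codegree x y B \<le> b) \<and>
      t * (\<Sum>y=1..N. ?G y B) \<le> A)
   \<le> bernoulli_prob t N (\<lambda>B. s \<le> \<bar>\<Sum>y=1..N. centred t y B * ?G y B\<bar> \<and>
            (\<forall>y\<in>{1..N}. \<bar>?G y B\<bar> \<le> b) \<and> t * (1 - t) * (\<Sum>y=1..N. (?G y B)\<^sup>2) \<le> b * A)"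
  proof (rule bernoulli_prob_mono[OF t'], elim conjE, intro conjI)
    fix B
    assume 1: "s \<le> \<bar>degree_dev x B\<bar>" and 2: "\<forall>y\<in>{1..N}. y < x \<longrightarrow> codegree x y B \<le> b"
      and 3: "t * (\<Sum>y=1..N. ?G y B) \<le> A"
    show "s \<le> \<bar>\<Sum>y=1..N. centred t y B * ?G y B\<bar>" using 1 unfolding degree_dev_eq .
    show G: "\<forall>y\<in>{1..N}. \<bar>?G y B\<bar> \<le> b" using 2 codegree_nonneg b by auto
    have "t * (1 - t) * (\<Sum>y=1..N. (?G y B)\<^sup>2) \<le> t * (b * (\<Sum>y=1..N. ?G y B))"
    proof (intro mult_mono)
      show "t * (1 - t) \<le> t" using t by (simp add: mult_left_le)
      show "(\<Sum>y=1..N. (?G y B)\<^sup>2) \<le> b * (\<Sum>y=1..N. ?G y B)"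
        unfolding sum_distrib_left
      proof (rule sum_mono)
        fix y assume "y \<in> {1..N}"
        then show "(?G y B)\<^sup>2 \<le> b * ?G y B"
          using G codegree_nonneg unfolding power2_eq_square by (intro mult_right_mono) auto
      qed
    qed (use t in \<open>auto intro: sum_nonneg\<close>)
    also have "\<dots> = b * (t * (\<Sum>y=1..N. ?G y B))" by simp
    also have "\<dots> \<le> b * A" by (intro mult_left_mono 3 b)
    finally show "t * (1 - t) * (\<Sum>y=1..N. (?G y B)\<^sup>2) \<le> b * A" .
  qed
  also have "\<dots> \<le> 2 * exp (- \<theta> * s + \<theta>\<^sup>2 / 2 * exp (\<theta> * b) * (b * A))"
    by (rule freedman_tail_abs[OF t' \<theta>]) (simp add: codegree_insert)
  finally show ?thesis .
qed

lemma remainder_tail: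
  assumes \<theta>: "0 \<le> \<theta>" and s: "0 \<le> s"
  shows "bernoulli_prob t N (\<lambda>B. z \<le> \<bar>remainder B\<bar> \<and> (\<forall>x\<in>{1..N}. \<bar>degree_dev x B\<bar> \<le> s))
    \<le> 2 * exp (- \<theta> * z + \<theta>\<^sup>2 / 2 * exp (\<theta> * s) * (t * real N * s\<^sup>2))"
proof -
  have t': "0 \<le> t" "t \<le> 1" using t by auto
  have "bernoulli_prob t N (\<lambda>B. z \<le> \<bar>remainder B\<bar> \<and> (\<forall>x\<in>{1..N}. \<bar>degree_dev x B\<bar> \<le> s))
   \<le> bernoulli_prob t N (\<lambda>B. z \<le> \<bar>\<Sum>x=1..N. centred t x B * degree_dev x B\<bar> \<and>
            (\<forall>x\<in>{1..N}. \<bar>degree_dev x B\<bar> \<le> s) \<and> t * (1 - t) * (\<Sum>x=1..N. (degree_dev x B)\<^sup>2) \<le> t * real N * s\<^sup>2)"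
  proof (rule bernoulli_prob_mono[OF t'], elim conjE, intro conjI)
    fix B
    assume 1: "z \<le> \<bar>remainder B\<bar>" and 2: "\<forall>x\<in>{1..N}. \<bar>degree_dev x B\<bar> \<le> s"
    show "z \<le> \<bar>\<Sum>x=1..N. centred t x B * degree_dev x B\<bar>" using 1 unfolding remainder_eq .
    show "\<forall>x\<in>{1..N}. \<bar>degree_dev x B\<bar> \<le> s" by (rule 2)
    have "(\<Sum>x=1..N. (degree_dev x B)\<^sup>2) \<le> real (card {1..N}) * s\<^sup>2"
      by (rule sum_bounded_above) (use 2 in \<open>simp add: abs_le_square_iff[symmetric] s\<close>)
    then have "t * (1 - t) * (\<Sum>x=1..N. (degree_dev x B)\<^sup>2) \<le> t * (real N * s\<^sup>2)"
      using t by (intro mult_mono) (auto simp: mult_left_le intro: sum_nonneg)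
    then show "t * (1 - t) * (\<Sum>x=1..N. (degree_dev x B)\<^sup>2) \<le> t * real N * s\<^sup>2" by simp
  qed
  also have "\<dots> \<le> 2 * exp (- \<theta> * z + \<theta>\<^sup>2 / 2 * exp (\<theta> * s) * (t * real N * s\<^sup>2))"
    by (rule freedman_tail_abs[OF t' \<theta>]) (simp add: degree_dev_insert)
  finally show ?thesis .
qed

text \<open>L is the target exponent. Moments of order q, the ceiling of L, condition on at most v =
  2 k L vertices. The choice of \<theta> makes the linear term of Freedman's exponent equal to -2 L,
  and \<open>small\<close> keeps the quadratic term below L.\<close>

lemma degree_dev_uniform:
  assumes N: "0 < N" and L: "1 \<le> L" and \<delta>: "0 < \<delta>" "\<delta> \<le> 1" and \<epsilon>: "0 \<le> \<epsilon>" "\<epsilon> \<le> 1"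
    and small: "27 * C\<^sup>2 * (real r)\<^sup>2 * \<epsilon> \<le> \<delta>\<^sup>2"
    and u: "(2 * real k * L) ^ (r - 1) \<le> \<epsilon> ^ (r - 1) * typical_degree"
  shows "bernoulli_prob t N (\<lambda>B. \<exists>x\<in>{1..N}. \<delta> * typical_degree < \<bar>degree_dev x B\<bar>) \<le> 4 * (real N)\<^sup>2 * exp (- L)"
proof -
  define M where "M = typical_degree"
  define v where "v = 2 * real k * L"
  define q where "q = nat \<lceil>L\<rceil>"
  define \<Phi>1 where "\<Phi>1 = C * (real r * M)"
  define \<Phi>2 where "\<Phi>2 = C * (real r * (\<epsilon> * M)) / v"
  define b where "b = exp 1 * \<Phi>2"
  define A where "A = exp 1 * (real k * \<Phi>1)"
  define \<theta> where "\<theta> = 2 * L / (\<delta> * M)"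
  have t': "0 \<le> t" "t \<le> 1" using t by auto
  have M0: "0 < M" using N t by (simp add: M_def typical_degree_def)
  have v0: "0 < v" using L r by (simp add: v_def)
  have k0: "0 < real k" "1 \<le> real k" and r0: "1 \<le> real r" using r by auto
  have \<epsilon>0: "0 < \<epsilon>"
  proof (rule ccontr)
    assume "\<not> 0 < \<epsilon>"
    then have "\<epsilon> = 0" using \<epsilon> by simp
    then have "v ^ (r - 1) \<le> 0" using u r by (simp add: v_def power_0_left)
    then show False using zero_less_power[OF v0, of "r - 1"] by linarith
  qed
  have q: "L \<le> real q" "real q \<le> 2 * L"
  proof -
    have "real q = real_of_int \<lceil>L\<rceil>" using L by (simp add: q_def)
    then show "L \<le> real q" "real q \<le> 2 * L" using L by linarith+
  qed
  have card_v: "real (card U) \<le> v" if "card U \<le> k * q" for U :: "nat set"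
  proof -
    have "real (card U) \<le> real k * real q" using that by (metis of_nat_mult of_nat_le_iff)
    also have "\<dots> \<le> real k * (2 * L)" using q by (intro mult_left_mono) auto
    finally show ?thesis by (simp add: v_def)
  qed
  have \<Phi>1: "0 < \<Phi>1" and \<Phi>2: "0 < \<Phi>2"
    using C M0 v0 \<epsilon>0 r0 by (simp_all add: \<Phi>1_def \<Phi>2_def)
  have e3: "exp 1 < (3::real)" using e_less_272 by simp
  have expq: "exp (- real q) \<le> exp (- L)" using q by simp
  have "v ^ (r - 1) \<le> M"
  proof -
    have "v ^ (r - 1) \<le> \<epsilon> ^ (r - 1) * M" using u by (simp add: v_def M_def)
    also have "\<dots> \<le> 1 * M" using \<epsilon> M0 by (intro mult_right_mono power_le_one) auto
    finally show ?thesis by simp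
  qed
  then have deg1: "cond_degree {x} U \<le> \<Phi>1" if "x \<in> {1..N}" "U \<subseteq> {1..N}" "card U \<le> k * q" for x U
    using cond_degree_vertex_le[of x U v] card_v[of U] that unfolding \<Phi>1_def M_def by simp
  have deg2: "cond_degree {x, y} U \<le> \<Phi>2"
    if "x \<in> {1..N}" "y \<in> {1..N}" "y < x" "U \<subseteq> {1..N}" "card U \<le> k * q" for x y U
  proof -
    have "v * cond_degree {x, y} U \<le> C * (real r * (\<epsilon> * M))"
      unfolding M_def
      by (rule cond_degree_pair_le) (use that card_v[of U] u \<epsilon> in \<open>auto simp: v_def\<close>)
    then show ?thesis using v0 by (simp add: \<Phi>2_def field_simps)
  qed
  have E1: "bernoulli_prob t N (\<lambda>B. b \<le> codegree x y B) \<le> exp (- L)"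
    if "x \<in> {1..N}" "y \<in> {1..N}" "y < x" for x y
    unfolding b_def
    by (rule order_trans[OF codegree_tail[OF that \<Phi>2] expq]) (rule deg2[OF that])
  have E2: "bernoulli_prob t N (\<lambda>B. A \<le> t * (\<Sum>y=1..N. if y < x then codegree x y B else 0)) \<le> exp (- L)"
    if "x \<in> {1..N}" for x
    unfolding A_def
    by (rule order_trans[OF codegree_sum_tail[OF that \<Phi>1] expq]) (rule deg1[OF that])
  have b0: "0 \<le> b" using \<Phi>2 by (simp add: b_def)
  have \<theta>0: "0 \<le> \<theta>" using L \<delta> M0 by (simp add: \<theta>_def)
  have \<theta>b: "\<theta> * b \<le> 1"
  proof -
    have "exp 1 * C * real r * \<epsilon> \<le> 27 * C\<^sup>2 * (real r)\<^sup>2 * \<epsilon>"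
    proof (intro mult_right_mono)
      have "exp 1 * (C * real r) \<le> 27 * ((C * real r) * (C * real r))"
        using e3 C_ge_1 r0 mult_mono[OF C_ge_1 r0] by (intro mult_mono mult_le_cancel_left1[THEN iffD2]) auto
      then show "exp 1 * C * real r \<le> 27 * C\<^sup>2 * (real r)\<^sup>2"
        by (simp add: power2_eq_square mult_ac)
    qed (use \<epsilon> in auto)
    also have "\<dots> \<le> \<delta>\<^sup>2" by (rule small)
    also have "\<dots> \<le> \<delta> * real k"
      unfolding power2_eq_square using \<delta> k0 by (intro mult_left_mono) auto
    finally have "exp 1 * C * real r * \<epsilon> \<le> \<delta> * real k" .
    moreover have "\<theta> * b = exp 1 * C * real r * \<epsilon> / (\<delta> * real k)"
      using M0 L k0 \<delta> by (simp add: \<theta>_def b_def \<Phi>2_def v_def field_simps)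
    moreover have "0 < \<delta> * real k" using \<delta> k0 by simp
    ultimately show ?thesis by (simp only: divide_le_eq_1_pos)
  qed
  \<comment> \<open>Three factors e arise, from \<open>exp (\<theta> * b) \<le> exp 1\<close>, from
    b and from A; their product is below 27, the constant in \<open>small\<close>. The powers of M
    and k cancel, and one factor L is left.\<close>
  have expo: "- \<theta> * (\<delta> * M) + \<theta>\<^sup>2 / 2 * exp (\<theta> * b) * (b * A) \<le> - L"
  proof -
    have "\<theta>\<^sup>2 / 2 * exp (\<theta> * b) * (b * A) \<le> \<theta>\<^sup>2 / 2 * exp 1 * (b * A)"
      using \<theta>b b0 \<Phi>1 by (intro mult_right_mono mult_left_mono) (auto simp: A_def)
    also have "\<dots> = L * (exp 1 ^ 3 * (C\<^sup>2 * (real r)\<^sup>2 * \<epsilon>)) / \<delta>\<^sup>2"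
      using M0 L k0 \<delta> by (simp add: \<theta>_def b_def A_def \<Phi>1_def \<Phi>2_def v_def field_simps power2_eq_square power3_eq_cube)
    also have "\<dots> \<le> L * (27 * (C\<^sup>2 * (real r)\<^sup>2 * \<epsilon>)) / \<delta>\<^sup>2"
    proof -
      have "exp 1 ^ 3 \<le> (3::real) ^ 3" using e3 by (intro power_mono) auto
      then show ?thesis using L \<epsilon> by (intro divide_right_mono mult_left_mono mult_right_mono) auto
    qed
    also have "\<dots> \<le> L * \<delta>\<^sup>2 / \<delta>\<^sup>2"
      using small L by (intro divide_right_mono mult_left_mono) (auto simp: mult_ac)
    also have "\<dots> = L" using \<delta> by simp
    finally have "\<theta>\<^sup>2 / 2 * exp (\<theta> * b) * (b * A) \<le> L" .
    moreover have "\<theta> * (\<delta> * M) = 2 * L" using \<delta> M0 by (simp add: \<theta>_def)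
    ultimately show ?thesis by simp
  qed
  \<comment> \<open>A large degree deviation requires a large codegree, a large sum of codegrees, or
    the event of \<open>degree_dev_tail\<close>; these contribute N^2, N and 2 N times
    \<open>exp (- L)\<close>.\<close>
  let ?Q1 = "\<lambda>B. \<exists>i\<in>{1..N} \<times> {1..N}. snd i < fst i \<and> b \<le> codegree (fst i) (snd i) B"
  let ?Q2 = "\<lambda>B. \<exists>x\<in>{1..N}. A \<le> t * (\<Sum>y=1..N. if y < x then codegree x y B else 0)"
  let ?Q3 = "\<lambda>B. \<exists>x\<in>{1..N}. \<delta> * M \<le> \<bar>degree_dev x B\<bar> \<and> (\<forall>y\<in>{1..N}. y < x \<longrightarrow> codegree x y B \<le> b) \<and>
      t * (\<Sum>y=1..N. if y < x then codegree x y B else 0) \<le> A"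
  have "bernoulli_prob t N (\<lambda>B. \<exists>x\<in>{1..N}. \<delta> * M < \<bar>degree_dev x B\<bar>)
     \<le> bernoulli_prob t N (\<lambda>B. ?Q1 B \<or> ?Q2 B) + bernoulli_prob t N ?Q3"
  proof (rule bernoulli_prob_Un[OF t'])
    fix B
    assume "\<exists>x\<in>{1..N}. \<delta> * M < \<bar>degree_dev x B\<bar>"
    then obtain x where x: "x \<in> {1..N}" "\<delta> * M < \<bar>degree_dev x B\<bar>" by blast
    show "(?Q1 B \<or> ?Q2 B) \<or> ?Q3 B"
    proof (rule disjCI)
      assume "\<not> ?Q3 B"
      then have "\<not> ((\<forall>y\<in>{1..N}. y < x \<longrightarrow> codegree x y B \<le> b) \<and>
          t * (\<Sum>y=1..N. if y < x then codegree x y B else 0) \<le> A)"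
        using x by (metis less_imp_le)
      then consider y where "y \<in> {1..N}" "y < x" "b < codegree x y B"
        | "A < t * (\<Sum>y=1..N. if y < x then codegree x y B else 0)"
        by force
      then show "?Q1 B \<or> ?Q2 B"
      proof cases
        case 1
        then have "(x, y) \<in> {1..N} \<times> {1..N}" "snd (x, y) < fst (x, y) \<and> b \<le> codegree (fst (x, y)) (snd (x, y)) B"
          using x by auto
        then show ?thesis by blast
      next
        case 2
        then show ?thesis using x less_imp_le by blast
      qed
    qed
  qed
  also have "bernoulli_prob t N (\<lambda>B. ?Q1 B \<or> ?Q2 B) \<le> bernoulli_prob t N ?Q1 + bernoulli_prob t N ?Q2"
    by (rule bernoulli_prob_Un[OF t'])
  also have "bernoulli_prob t N ?Q1 \<le> real (card ({1..N} \<times> {1..N})) * exp (- L)"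
  proof (rule bernoulli_prob_UN[OF t'])
    fix i assume i: "i \<in> {1..N} \<times> {1..N}"
    show "bernoulli_prob t N (\<lambda>B. snd i < fst i \<and> b \<le> codegree (fst i) (snd i) B) \<le> exp (- L)"
    proof (cases "snd i < fst i")
      case True
      then show ?thesis using E1[of "fst i" "snd i"] i by (auto simp: mem_Times_iff)
    next
      case False
      then show ?thesis by (simp add: bernoulli_exp_def)
    qed
  qed simp
  also have "bernoulli_prob t N ?Q2 \<le> real (card {1..N}) * exp (- L)"
    by (rule bernoulli_prob_UN[OF t']) (use E2 in auto)
  also have "bernoulli_prob t N ?Q3 \<le> real (card {1..N}) * (2 * exp (- L))"
  proof (rule bernoulli_prob_UN[OF t'])
    fix x
    show "bernoulli_prob t N (\<lambda>B. \<delta> * M \<le> \<bar>degree_dev x B\<bar> \<and> (\<forall>y\<in>{1..N}. y < x \<longrightarrow> codegree x y B \<le> b) \<and>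
      t * (\<Sum>y=1..N. if y < x then codegree x y B else 0) \<le> A) \<le> 2 * exp (- L)"
      using degree_dev_tail[OF \<theta>0 b0, of "\<delta> * M" x A] expo by (smt (verit) exp_le_cancel_iff)
  qed simp
  also have "real (card ({1..N} \<times> {1..N})) * exp (- L) + real (card {1..N}) * exp (- L) + real (card {1..N}) * (2 * exp (- L))
     = ((real N)\<^sup>2 + 3 * real N) * exp (- L)"
    by (simp add: algebra_simps power2_eq_square)
  also have "\<dots> \<le> 4 * (real N)\<^sup>2 * exp (- L)"
    using N self_le_power[of "real N" 2] by (intro mult_right_mono) auto
  finally show ?thesis by (simp add: M_def)
qed

text \<open>\<rho> is the square of a measured in units of sqrt (t N) times the typical degree. If
  all degree deviations are below \<delta>' times the typical degree, the quadratic variation is at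
  most \<delta>'^2 a^2 / \<rho>, so a small \<delta>' copes with any fixed K.\<close>

lemma remainder_bound:
  assumes N: "0 < N" and K: "1 \<le> K" and \<rho>: "1 \<le> \<rho>" and \<delta>: "0 < \<delta>" "\<delta> \<le> 1" and \<epsilon>: "0 \<le> \<epsilon>" "\<epsilon> \<le> 1"
    and a: "0 < a" "a\<^sup>2 = \<rho> * (t * real N) * typical_degree\<^sup>2"
    and small: "27 * C\<^sup>2 * (real r)\<^sup>2 * \<epsilon> \<le> (\<delta>\<^sup>2 / (6 * K))\<^sup>2"
    and u: "(2 * real k * (K * \<rho>)) ^ (r - 1) \<le> \<epsilon> ^ (r - 1) * typical_degree"
  shows "bernoulli_prob t N (\<lambda>B. \<delta> * a \<le> \<bar>remainder B\<bar>) \<le> 6 * (real N)\<^sup>2 * exp (- (K * \<rho>))"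
proof -
  define M where "M = typical_degree"
  \<comment> \<open>Chosen so that the quadratic term of Freedman's exponent is at most
    \<open>\<delta>\<^sup>2 / 6 * \<rho>\<close>, while \<theta> makes the linear term
    \<open>- 2 * K * \<rho>\<close>.\<close>
  define \<delta>' where "\<delta>' = \<delta>\<^sup>2 / (6 * K)"
  define \<theta> where "\<theta> = 2 * K * \<rho> / (\<delta> * a)"
  have t': "0 \<le> t" "t \<le> 1" using t by auto
  have M0: "0 < M" using N t by (simp add: M_def typical_degree_def)
  have \<delta>': "0 < \<delta>'" "\<delta>' \<le> 1" "\<delta>' * K = \<delta>\<^sup>2 / 6"
  proof -
    have "\<delta>\<^sup>2 \<le> 1" using \<delta> by (simp add: power_le_one)
    then show "0 < \<delta>'" "\<delta>' \<le> 1" "\<delta>' * K = \<delta>\<^sup>2 / 6"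
      using \<delta> K by (simp_all add: \<delta>'_def field_simps)
  qed
  have K\<rho>: "1 \<le> K * \<rho>" using mult_mono[OF K \<rho>] K by simp
  have \<rho>_le: "\<rho> \<le> t * real N"
  proof -
    have "2 * real k * (K * \<rho>) \<le> \<epsilon> * (t * real N)"
      by (rule small_exponent_bound) (use u \<epsilon> K\<rho> in auto)
    also have "\<dots> \<le> t * real N" using \<epsilon> t by (simp add: mult_left_le_one_le)
    finally have 1: "2 * real k * (K * \<rho>) \<le> t * real N" .
    have "\<rho> \<le> K * \<rho>" using K \<rho> by (simp add: mult_le_cancel_right1)
    also have "\<dots> \<le> 2 * real k * (K * \<rho>)" using r K\<rho> by (simp add: mult_le_cancel_right1)
    finally show ?thesis using 1 by simp
  qed
  \<comment> \<open>This bound keeps \<theta> times the largest jump bounded.\<close>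
  have \<rho>M: "\<rho> * M \<le> a"
  proof (rule power2_le_imp_le)
    have "(\<rho> * M)\<^sup>2 = \<rho> * \<rho> * M\<^sup>2" by (simp add: power2_eq_square mult_ac)
    also have "\<dots> \<le> \<rho> * (t * real N) * M\<^sup>2"
      using \<rho> \<rho>_le by (intro mult_right_mono mult_left_mono) auto
    finally show "(\<rho> * M)\<^sup>2 \<le> a\<^sup>2" using a by (simp add: M_def)
  qed (use a in simp)
  have \<theta>0: "0 \<le> \<theta>" using K\<rho> a \<delta> by (simp add: \<theta>_def)
  have \<theta>s: "\<theta> * (\<delta>' * M) \<le> 1"
  proof -
    have "\<theta> * (\<delta>' * M) = 2 * (\<delta>' * K) * (\<rho> * M) / (\<delta> * a)"
      by (simp add: \<theta>_def mult_ac)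
    also have "\<dots> \<le> 2 * (\<delta>' * K) * a / (\<delta> * a)"
      using \<rho>M a \<delta> \<delta>' K by (intro divide_right_mono mult_left_mono) auto
    also have "\<dots> = \<delta> / 3" using a \<delta> by (simp add: \<delta>'(3) power2_eq_square)
    also have "\<dots> \<le> 1" using \<delta> by simp
    finally show ?thesis .
  qed
  have expo: "- \<theta> * (\<delta> * a) + \<theta>\<^sup>2 / 2 * exp (\<theta> * (\<delta>' * M)) * (t * real N * (\<delta>' * M)\<^sup>2) \<le> - (K * \<rho>)"
  proof -
    have "\<theta>\<^sup>2 / 2 * exp (\<theta> * (\<delta>' * M)) * (t * real N * (\<delta>' * M)\<^sup>2) \<le> \<theta>\<^sup>2 / 2 * 3 * (t * real N * (\<delta>' * M)\<^sup>2)"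
    proof -
      have "exp (\<theta> * (\<delta>' * M)) \<le> exp 1" using \<theta>s by simp
      also have "\<dots> \<le> 3" using e_less_272 by simp
      finally show ?thesis using t by (intro mult_right_mono mult_left_mono) auto
    qed
    also have "\<dots> = 6 * (\<delta>' * K)\<^sup>2 * \<rho> * (\<rho> * (t * real N) * M\<^sup>2) / (\<delta>\<^sup>2 * a\<^sup>2)"
      by (simp add: \<theta>_def power2_eq_square field_simps)
    also have "\<dots> = 6 * (\<delta>' * K)\<^sup>2 * \<rho> / \<delta>\<^sup>2"
      unfolding a(2)[folded M_def, symmetric] using a(1) by simp
    also have "\<dots> = \<delta>\<^sup>2 / 6 * \<rho>"
      unfolding \<delta>'(3) using \<delta> by (simp add: power2_eq_square)
    also have "\<dots> \<le> K * \<rho>"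
    proof -
      have "\<delta>\<^sup>2 \<le> 1" using \<delta> by (simp add: power_le_one)
      then show ?thesis using K \<rho> by (intro mult_right_mono) auto
    qed
    finally have "\<theta>\<^sup>2 / 2 * exp (\<theta> * (\<delta>' * M)) * (t * real N * (\<delta>' * M)\<^sup>2) \<le> K * \<rho>" .
    moreover have "\<theta> * (\<delta> * a) = 2 * (K * \<rho>)" using \<delta> a by (simp add: \<theta>_def)
    ultimately show ?thesis by simp
  qed
  have "bernoulli_prob t N (\<lambda>B. \<delta> * a \<le> \<bar>remainder B\<bar>)
    \<le> bernoulli_prob t N (\<lambda>B. \<exists>x\<in>{1..N}. \<delta>' * M < \<bar>degree_dev x B\<bar>) +
      bernoulli_prob t N (\<lambda>B. \<delta> * a \<le> \<bar>remainder B\<bar> \<and> (\<forall>x\<in>{1..N}. \<bar>degree_dev x B\<bar> \<le> \<delta>' * M))"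
    by (rule bernoulli_prob_Un[OF t']) force
  also have "bernoulli_prob t N (\<lambda>B. \<exists>x\<in>{1..N}. \<delta>' * M < \<bar>degree_dev x B\<bar>) \<le> 4 * (real N)\<^sup>2 * exp (- (K * \<rho>))"
    unfolding M_def
    by (rule degree_dev_uniform[OF N K\<rho> \<delta>'(1,2) \<epsilon>]) (use small u in \<open>auto simp: \<delta>'_def\<close>)
  also have "bernoulli_prob t N (\<lambda>B. \<delta> * a \<le> \<bar>remainder B\<bar> \<and> (\<forall>x\<in>{1..N}. \<bar>degree_dev x B\<bar> \<le> \<delta>' * M))
     \<le> 2 * exp (- (K * \<rho>))"
    using remainder_tail[OF \<theta>0, of "\<delta>' * M" "\<delta> * a"] \<delta>' M0 expo by (smt (verit) exp_le_cancel_iff mult_pos_pos)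
  also have "4 * (real N)\<^sup>2 * exp (- (K * \<rho>)) + 2 * exp (- (K * \<rho>)) \<le> 6 * (real N)\<^sup>2 * exp (- (K * \<rho>))"
  proof -
    have "1 \<le> (real N)\<^sup>2" using N by simp
    then have "2 * exp (- (K * \<rho>)) \<le> 2 * (real N)\<^sup>2 * exp (- (K * \<rho>))" by simp
    then show ?thesis by (simp add: algebra_simps)
  qed
  finally show ?thesis by simp
qed

end

section \<open>Linear forms of a random subset of given size\<close>

text \<open>Generating function, by size, of the subsets of 1..n, where B has as weight the product
  of \<alpha> over B and of \<beta> off B. For exponential weights the m-th coefficient is a Laplace
  transform on the slice.\<close>

definition subset_poly :: "(nat \<Rightarrow> real) \<Rightarrow> (nat \<Rightarrow> real) \<Rightarrow> nat \<Rightarrow> real poly" where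
  "subset_poly \<alpha> \<beta> n = (\<Prod>x=1..n. [:\<beta> x, \<alpha> x:])"

lemma coeff_subset_poly_Suc:
  "coeff (subset_poly \<alpha> \<beta> (Suc n)) 0 = \<beta> (Suc n) * coeff (subset_poly \<alpha> \<beta> n) 0"
  "coeff (subset_poly \<alpha> \<beta> (Suc n)) (Suc j) =
     \<alpha> (Suc n) * coeff (subset_poly \<alpha> \<beta> n) j + \<beta> (Suc n) * coeff (subset_poly \<alpha> \<beta> n) (Suc j)"
  by (simp_all add: subset_poly_def mult.commute[of _ "[:_, _:]"])

lemma coeff_subset_poly:
  "coeff (subset_poly \<alpha> \<beta> n) m =
     (\<Sum>B\<in>Pow {1..n}. of_bool (card B = m) * ((\<Prod>x\<in>B. \<alpha> x) * (\<Prod>x\<in>{1..n}-B. \<beta> x)))"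
proof -
  have mon: "(\<Prod>x\<in>B. [:0, \<alpha> x:]) = monom (\<Prod>x\<in>B. \<alpha> x) (card B)" if "finite B" for B
    using that
  proof (induction B)
    case (insert x B)
    then show ?case by (simp add: monom_Suc smult_monom)
  qed (simp add: monom_0 one_pCons)
  have con: "(\<Prod>x\<in>B. [:\<beta> x:]) = [:\<Prod>x\<in>B. \<beta> x:]" if "finite B" for B
    using that by induction (simp_all add: one_pCons)
  have "subset_poly \<alpha> \<beta> n = (\<Prod>x=1..n. [:0, \<alpha> x:] + [:\<beta> x:])"
    by (simp add: subset_poly_def)
  also have "\<dots> = (\<Sum>B\<in>Pow {1..n}. (\<Prod>x\<in>B. [:0, \<alpha> x:]) * (\<Prod>x\<in>{1..n}-B. [:\<beta> x:]))"
    by (rule prod_add) simp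
  also have "\<dots> = (\<Sum>B\<in>Pow {1..n}. monom ((\<Prod>x\<in>B. \<alpha> x) * (\<Prod>x\<in>{1..n}-B. \<beta> x)) (card B))"
  proof (rule sum.cong[OF refl])
    fix B assume "B \<in> Pow {1..n}"
    then have "finite B" using finite_subset by auto
    then show "(\<Prod>x\<in>B. [:0, \<alpha> x:]) * (\<Prod>x\<in>{1..n}-B. [:\<beta> x:]) =
        monom ((\<Prod>x\<in>B. \<alpha> x) * (\<Prod>x\<in>{1..n}-B. \<beta> x)) (card B)"
      by (simp add: mon con smult_monom mult.commute)
  qed
  finally show ?thesis
    by (simp add: coeff_sum of_bool_def if_distrib[of "\<lambda>c. c * _"] cong: if_cong)
qed

context
  fixes \<alpha> \<beta> :: "nat \<Rightarrow> real"
  assumes pos: "\<And>x. 0 < \<alpha> x" "\<And>x. 0 < \<beta> x"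
begin

lemma coeff_subset_poly_nonneg: "0 \<le> coeff (subset_poly \<alpha> \<beta> n) j"
  unfolding coeff_subset_poly using pos less_imp_le
  by (intro sum_nonneg mult_nonneg_nonneg prod_nonneg) (auto intro: less_imp_le)

lemma coeff_subset_poly_pos: "j \<le> n \<Longrightarrow> 0 < coeff (subset_poly \<alpha> \<beta> n) j"
proof (induction n arbitrary: j)
  case 0
  then show ?case by (simp add: subset_poly_def)
next
  case (Suc n)
  show ?case
  proof (cases j)
    case 0
    then show ?thesis using Suc.IH[of 0] pos by (simp add: coeff_subset_poly_Suc)
  next
    case (Suc i)
    then show ?thesis
      using Suc.IH[of i] Suc.prems pos coeff_subset_poly_nonneg[of n "Suc i"]
      by (simp add: coeff_subset_poly_Suc add_pos_nonneg less_imp_le)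
  qed
qed

text \<open>A linear factor preserves log-concavity. The form with i \<le> j, rather than
  consecutive indices only, makes the induction work without division: the mixed term follows from
  two instances of the hypothesis, through \<open>s i * s j\<close>.\<close>

lemma coeff_subset_poly_log_concave:
  "i \<le> j \<Longrightarrow> coeff (subset_poly \<alpha> \<beta> n) i * coeff (subset_poly \<alpha> \<beta> n) (Suc j)
      \<le> coeff (subset_poly \<alpha> \<beta> n) (Suc i) * coeff (subset_poly \<alpha> \<beta> n) j"
proof (induction n arbitrary: i j)
  case 0
  then show ?case by (simp add: subset_poly_def)
next
  case (Suc n)
  define s where "s = coeff (subset_poly \<alpha> \<beta> n)"
  define a where "a = \<alpha> (Suc n)"
  define b where "b = \<beta> (Suc n)"
  have ab: "0 < a" "0 < b" using pos by (simp_all add: a_def b_def)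
  have s0: "0 \<le> s l" for l by (simp add: s_def coeff_subset_poly_nonneg)
  have IH: "s i * s (Suc j) \<le> s (Suc i) * s j" if "i \<le> j" for i j
    using Suc.IH that by (simp add: s_def)
  note rec = coeff_subset_poly_Suc[of \<alpha> \<beta> n, folded s_def a_def b_def]
  show ?case
  proof (cases "i = j")
    case True
    then show ?thesis by simp
  next
    case False
    then obtain j' where j: "j = Suc j'" "i \<le> j'" using Suc.prems by (cases j) auto
    show ?thesis
    proof (cases i)
      case 0
      have "b * s 0 * (a * s j + b * s (Suc j)) \<le> (a * s 0 + b * s 1) * (a * s j' + b * s j)"
      proof -
        have "b * b * (s 0 * s (Suc j)) \<le> b * b * (s 1 * s j)"
          using IH[of 0 j] ab by (intro mult_left_mono) auto
        moreover have "0 \<le> a * a * (s 0 * s j')" "0 \<le> a * b * (s 1 * s j')"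
          using s0 ab by auto
        ultimately show ?thesis by (simp add: algebra_simps)
      qed
      then show ?thesis using 0 j by (simp add: rec)
    next
      case (Suc i')
      have "(a * s i' + b * s i) * (a * s j + b * s (Suc j)) \<le> (a * s i + b * s (Suc i)) * (a * s j' + b * s j)"
      proof -
        have "b * b * (s i * s (Suc j)) \<le> b * b * (s (Suc i) * s j)"
          using IH[of i j] Suc.prems ab by (intro mult_left_mono) auto
        moreover have "a * a * (s i' * s j) \<le> a * a * (s i * s j')"
          using IH[of i' j'] Suc j ab by (intro mult_left_mono) auto
        moreover have "a * b * (s i' * s (Suc j)) \<le> a * b * (s (Suc i) * s j')"
        proof -
          have "s i' * s (Suc j) \<le> s i * s j" using IH[of i' j] Suc j by simp
          also have "\<dots> \<le> s (Suc i) * s j'" using IH[of i j'] j by simp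
          finally show ?thesis using ab by (intro mult_left_mono) auto
        qed
        ultimately show ?thesis by (simp add: algebra_simps)
      qed
      then show ?thesis using Suc j by (simp add: rec)
    qed
  qed
qed

text \<open>By log-concavity the coefficient of index \<open>m\<close> becomes the largest one after a rescaling of the
  variable.\<close>

lemma coeff_subset_poly_ge:
  assumes m: "1 \<le> m" "m \<le> n"
  obtains z where "0 < z" "(\<Prod>x=1..n. \<beta> x + \<alpha> x * z) \<le> real (n + 1) * (coeff (subset_poly \<alpha> \<beta> n) m * z ^ m)"
proof -
  define s where "s = coeff (subset_poly \<alpha> \<beta> n)"
  \<comment> \<open>This z makes the terms of index m - 1 and m equal. By log-concavity the terms
    then do not decrease up to m and do not increase afterwards.\<close>
  define z where "z = s (m - 1) / s m"
  have sm: "0 < s m" "0 < s (m - 1)" using m coeff_subset_poly_pos by (auto simp: s_def)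
  have z0: "0 < z" using sm by (simp add: z_def)
  have LC: "s i * s (Suc j) \<le> s (Suc i) * s j" if "i \<le> j" for i j
    using coeff_subset_poly_log_concave[OF that] by (simp add: s_def)
  have up: "s (Suc j) * z ^ Suc j \<le> s j * z ^ j" if "m \<le> j" for j
  proof -
    have "s (m - 1) * s (Suc j) \<le> s m * s j" using LC[of "m - 1" j] m that by simp
    then have "s (Suc j) * z \<le> s j" using sm by (simp add: z_def field_simps)
    then show ?thesis using z0 by (simp add: mult.assoc[symmetric] mult_right_mono)
  qed
  have dn: "s j * z ^ j \<le> s (Suc j) * z ^ Suc j" if "Suc j \<le> m" for j
  proof -
    have "s j * s m \<le> s (Suc j) * s (m - 1)" using LC[of j "m - 1"] m that by simp
    then have "s j \<le> s (Suc j) * z" using sm by (simp add: z_def field_simps)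
    then show ?thesis using z0 by (simp add: mult.assoc[symmetric] mult_right_mono)
  qed
  have le: "s j * z ^ j \<le> s m * z ^ m" for j
  proof (cases "m \<le> j")
    case True
    then show ?thesis by (induction j rule: dec_induct) (use up in \<open>auto intro: order_trans\<close>)
  next
    case False
    then have "j \<le> m" by simp
    then show ?thesis by (induction j rule: inc_induct) (use dn Suc_leI order_trans in blast)+
  qed
  have deg: "degree (subset_poly \<alpha> \<beta> n) \<le> n"
  proof -
    have "degree (subset_poly \<alpha> \<beta> n) \<le> (\<Sum>x=1..n. degree [:\<beta> x, \<alpha> x:])"
      unfolding subset_poly_def using degree_prod_sum_le[of "{1..n}" "\<lambda>x. [:\<beta> x, \<alpha> x:]"] by (simp add: comp_def)
    also have "\<dots> \<le> (\<Sum>x=1..n. 1)"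
      by (rule sum_mono) (simp add: degree_pCons_le)
    finally show ?thesis by simp
  qed
  have "(\<Prod>x=1..n. \<beta> x + \<alpha> x * z) = poly (subset_poly \<alpha> \<beta> n) z"
    by (simp add: subset_poly_def poly_prod mult.commute)
  also have "\<dots> = (\<Sum>j\<le>degree (subset_poly \<alpha> \<beta> n). s j * z ^ j)"
    by (simp add: poly_altdef s_def)
  also have "\<dots> \<le> real (card {..degree (subset_poly \<alpha> \<beta> n)}) * (s m * z ^ m)"
    by (rule sum_bounded_above) (rule le)
  also have "\<dots> \<le> real (n + 1) * (s m * z ^ m)"
    using deg sm z0 by (intro mult_right_mono) auto
  finally show ?thesis using that z0 by (simp add: s_def)
qed

end

definition bernoulli_mgf :: "real \<Rightarrow> real \<Rightarrow> real" where
  "bernoulli_mgf t u = t * exp (u * (1 - t)) + (1 - t) * exp (- (u * t))"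

text \<open>With z = exp \<nu>, the rescaling adds \<nu> to every \<open>h x\<close>. On the slice
  the centred variables sum to 0, because m = t N, so this shift leaves the exponential unchanged
  there. The value of \<nu> is not known.\<close>

lemma bernoulli_slice_exp_ge:
  fixes h :: "nat \<Rightarrow> real"
  assumes t: "0 < t" "t < 1" and m: "1 \<le> m" "m \<le> N" "real m = t * real N"
  obtains \<nu> where "(\<Prod>x=1..N. bernoulli_mgf t (h x + \<nu>)) \<le>
    real (N + 1) * bernoulli_exp t N (\<lambda>B. of_bool (card B = m) * exp (\<Sum>x=1..N. h x * centred t x B))"
proof -
  let ?\<alpha> = "\<lambda>x. t * exp (h x * (1 - t))"
  let ?\<beta> = "\<lambda>x. (1 - t) * exp (- (h x * t))"
  have pos: "0 < ?\<alpha> x" "0 < ?\<beta> x" for x using t by auto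
  obtain z where z: "0 < z"
    "(\<Prod>x=1..N. ?\<beta> x + ?\<alpha> x * z) \<le> real (N + 1) * (coeff (subset_poly ?\<alpha> ?\<beta> N) m * z ^ m)"
    using coeff_subset_poly_ge[of ?\<alpha> ?\<beta> m N] pos m by blast
  define \<nu> where "\<nu> = ln z"
  have z_eq: "z = exp \<nu>" using z by (simp add: \<nu>_def)
  have c: "coeff (subset_poly ?\<alpha> ?\<beta> N) m =
     bernoulli_exp t N (\<lambda>B. of_bool (card B = m) * exp (\<Sum>x=1..N. h x * centred t x B))"
    unfolding coeff_subset_poly bernoulli_exp_def
  proof (rule sum.cong[OF refl])
    fix B assume "B \<in> Pow {1..N}"
    then have B: "B \<subseteq> {1..N}" and fin: "finite B" using finite_subset by auto
    have "(\<Sum>x=1..N. h x * centred t x B) = (\<Sum>x\<in>{1..N}-B. h x * centred t x B) + (\<Sum>x\<in>B. h x * centred t x B)"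
      using B by (intro sum.subset_diff) auto
    also have "(\<Sum>x\<in>{1..N}-B. h x * centred t x B) = (\<Sum>x\<in>{1..N}-B. - (h x * t))"
      by (intro sum.cong) (auto simp: centred_def)
    also have "(\<Sum>x\<in>B. h x * centred t x B) = (\<Sum>x\<in>B. h x * (1 - t))"
      by (intro sum.cong) (auto simp: centred_def)
    finally have *: "exp (\<Sum>x=1..N. h x * centred t x B) =
       (\<Prod>x\<in>{1..N}-B. exp (- (h x * t))) * (\<Prod>x\<in>B. exp (h x * (1 - t)))"
      using fin by (simp add: exp_add exp_sum)
    have "card ({1..N} - B) = N - card B" using B fin by (simp add: card_Diff_subset)
    then show "of_bool (card B = m) * ((\<Prod>x\<in>B. ?\<alpha> x) * (\<Prod>x\<in>{1..N}-B. ?\<beta> x)) =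
       t ^ card B * (1 - t) ^ (N - card B) * (of_bool (card B = m) * exp (\<Sum>x=1..N. h x * centred t x B))"
      unfolding * by (simp add: prod.distrib mult_ac)
  qed
  have "(\<Prod>x=1..N. bernoulli_mgf t (h x + \<nu>)) = (\<Prod>x=1..N. (?\<beta> x + ?\<alpha> x * z) * exp (- (\<nu> * t)))"
  proof (rule prod.cong[OF refl])
    fix x
    have "exp ((h x + \<nu>) * (1 - t)) = exp (h x * (1 - t)) * z * exp (- (\<nu> * t))"
      "exp (- ((h x + \<nu>) * t)) = exp (- (h x * t)) * exp (- (\<nu> * t))"
      unfolding z_eq exp_add[symmetric] by (simp_all add: algebra_simps)
    then show "bernoulli_mgf t (h x + \<nu>) = (?\<beta> x + ?\<alpha> x * z) * exp (- (\<nu> * t))"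
      unfolding bernoulli_mgf_def by (simp only: algebra_simps)
  qed
  also have "\<dots> = (\<Prod>x=1..N. ?\<beta> x + ?\<alpha> x * z) * exp (- (\<nu> * t)) ^ N"
    by (simp add: prod.distrib)
  also have "exp (- (\<nu> * t)) ^ N = exp (- (\<nu> * real m))"
    unfolding m(3) exp_of_nat_mult[symmetric] by (simp add: mult_ac)
  also have "(\<Prod>x=1..N. ?\<beta> x + ?\<alpha> x * z) * exp (- (\<nu> * real m)) \<le>
     real (N + 1) * (coeff (subset_poly ?\<alpha> ?\<beta> N) m * z ^ m) * exp (- (\<nu> * real m))"
    using z(2) by (intro mult_right_mono) auto
  also have "\<dots> = real (N + 1) * coeff (subset_poly ?\<alpha> ?\<beta> N) m"
  proof -
    have "z ^ m * exp (- (\<nu> * real m)) = 1"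
      unfolding z_eq exp_of_nat_mult[symmetric] exp_add[symmetric] by (simp add: mult_ac)
    then show ?thesis by (simp add: mult.assoc)
  qed
  finally show ?thesis using that c by metis
qed

section \<open>Lower bounds for the Bernoulli Laplace transform\<close>

lemma bernoulli_mgf_ge_1:
  assumes "0 < t" "t < 1"
  shows "1 \<le> bernoulli_mgf t u"
proof -
  have "t * (1 + u * (1 - t)) + (1 - t) * (1 + - (u * t)) \<le> bernoulli_mgf t u"
    unfolding bernoulli_mgf_def using assms
    by (intro add_mono mult_left_mono exp_ge_add_one_self) auto
  then show ?thesis by (simp add: algebra_simps)
qed

text \<open>The transform is convex with its minimum 1 at 0, so it does not decrease along rays from
  0.\<close>

lemma bernoulli_mgf_scale:
  assumes t: "0 < t" "t < 1" and s: "0 \<le> s" "s \<le> 1"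
  shows "bernoulli_mgf t (s * u) \<le> bernoulli_mgf t u"
proof -
  have conv: "exp (s * x) \<le> s * exp x + (1 - s)" for x :: real
  proof -
    have "exp ((1 - s) *\<^sub>R 0 + s *\<^sub>R x) \<le> (1 - s) * exp 0 + s * exp x"
      by (rule convex_onD[OF exp_convex]) (use s in auto)
    then show ?thesis by simp
  qed
  have "bernoulli_mgf t (s * u) \<le> t * (s * exp (u * (1 - t)) + (1 - s)) + (1 - t) * (s * exp (- (u * t)) + (1 - s))"
    unfolding bernoulli_mgf_def
    using conv[of "u * (1 - t)"] conv[of "- (u * t)"] t
    by (intro add_mono mult_left_mono) (auto simp: mult_ac)
  also have "\<dots> = s * bernoulli_mgf t u + (1 - s) * 1"
    by (simp add: bernoulli_mgf_def algebra_simps)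
  also have "\<dots> \<le> s * bernoulli_mgf t u + (1 - s) * bernoulli_mgf t u"
    using s bernoulli_mgf_ge_1[OF t] by (intro add_left_mono mult_left_mono) auto
  also have "\<dots> = bernoulli_mgf t u" by (simp add: algebra_simps)
  finally show ?thesis .
qed

text \<open>Third-order Taylor expansion, a lower bound because the fourth-order remainder is
  nonnegative. The third central moment t (1 - t) (1 - 2 t) is at most the variance in modulus, so
  the cubic term costs a relative |u| / 3; the slack up to |u| pays for passing from 1 + c to exp
  c.\<close>

lemma bernoulli_mgf_ge:
  assumes t: "0 < t" "t < 1" and u: "\<bar>u\<bar> \<le> 1"
  shows "exp ((1 - \<bar>u\<bar>) * (t * (1 - t) / 2 * u\<^sup>2)) \<le> bernoulli_mgf t u"
proof -
  have ex: "1 + x + x\<^sup>2 / 2 + x ^ 3 / 6 \<le> exp x" for x :: real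
  proof -
    obtain s where "exp x = (\<Sum>m<4. x ^ m / fact m) + exp s / fact 4 * x ^ 4"
      using Maclaurin_exp_le[of x 4] by blast
    moreover have "0 \<le> exp s / fact 4 * x ^ 4" by simp
    ultimately show ?thesis by (simp add: eval_nat_numeral)
  qed
  define T where "T = t * (1 - t) / 2 * u\<^sup>2"
  define c where "c = (1 - \<bar>u\<bar>) * T"
  have tt: "t * (1 - t) \<le> 1 / 4"
  proof -
    have "0 \<le> (t - 1 / 2)\<^sup>2" by simp
    then show ?thesis by (simp add: power2_eq_square algebra_simps)
  qed
  have u2: "u\<^sup>2 \<le> \<bar>u\<bar>" using u mult_left_le[of "\<bar>u\<bar>" "\<bar>u\<bar>"] by (simp add: power2_eq_square abs_mult[symmetric])
  have T: "0 \<le> T" "T \<le> \<bar>u\<bar> / 8"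
  proof -
    show "0 \<le> T" using t by (simp add: T_def)
    have "T \<le> (1 / 4) / 2 * \<bar>u\<bar>"
      unfolding T_def using tt u2 t by (intro mult_mono divide_right_mono) auto
    then show "T \<le> \<bar>u\<bar> / 8" by simp
  qed
  have c: "0 \<le> c" "c \<le> T" "c \<le> 1"
  proof -
    show "0 \<le> c" using T u by (simp add: c_def)
    show "c \<le> T" using T u by (simp add: c_def mult_left_le_one_le)
    then show "c \<le> 1" using T u by simp
  qed
  have "exp c \<le> 1 + c + c\<^sup>2" by (rule exp_bound) (use c in auto)
  also have "c\<^sup>2 \<le> T * (\<bar>u\<bar> / 8)"
    unfolding power2_eq_square using c T by (intro mult_mono) auto
  also have "1 + c + T * (\<bar>u\<bar> / 8) \<le> 1 + T * (1 - \<bar>u\<bar> / 3)"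
    using T by (simp add: c_def algebra_simps)
  also have "\<dots> \<le> 1 + T * (1 + (1 - 2 * t) * u / 3)"
  proof -
    have "- \<bar>u\<bar> \<le> (1 - 2 * t) * u"
    proof -
      have "\<bar>(1 - 2 * t) * u\<bar> \<le> 1 * \<bar>u\<bar>"
        unfolding abs_mult using t by (intro mult_right_mono) auto
      then show ?thesis by linarith
    qed
    then show ?thesis using T by (intro add_left_mono mult_left_mono) auto
  qed
  also have "\<dots> = t * (1 + u * (1 - t) + (u * (1 - t))\<^sup>2 / 2 + (u * (1 - t)) ^ 3 / 6) +
      (1 - t) * (1 + (- (u * t)) + (- (u * t))\<^sup>2 / 2 + (- (u * t)) ^ 3 / 6)"
    by (simp add: T_def field_simps power2_eq_square power3_eq_cube)
  also have "\<dots> \<le> bernoulli_mgf t u"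
    unfolding bernoulli_mgf_def using t by (intro add_mono mult_left_mono ex) auto
  finally show ?thesis by (simp add: c_def T_def)
qed

text \<open>The bound holds whatever the shift \<nu>. If \<nu> is at most 2 v in modulus, all
  arguments stay within 3 v and the sum of squares can only grow, as h has sum 0. Otherwise every
  shifted argument is at least as large in modulus as \<open>h x\<close>, and
  \<open>bernoulli_mgf_scale\<close> brings it back to that modulus.\<close>

lemma prod_bernoulli_mgf_ge:
  fixes h :: "nat \<Rightarrow> real"
  assumes t: "0 < t" "t < 1" and h: "\<And>x. x \<in> {1..N} \<Longrightarrow> \<bar>h x\<bar> \<le> v" "(\<Sum>x=1..N. h x) = 0"
    and v: "0 \<le> v" "3 * v \<le> 1"
  shows "exp ((1 - 3 * v) * (t * (1 - t) / 2 * (\<Sum>x=1..N. (h x)\<^sup>2))) \<le> (\<Prod>x=1..N. bernoulli_mgf t (h x + \<nu>))"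
proof -
  have lower: "exp ((1 - 3 * v) * (t * (1 - t) / 2 * u\<^sup>2)) \<le> bernoulli_mgf t u" if "\<bar>u\<bar> \<le> 3 * v" for u
  proof -
    have "exp ((1 - 3 * v) * (t * (1 - t) / 2 * u\<^sup>2)) \<le> exp ((1 - \<bar>u\<bar>) * (t * (1 - t) / 2 * u\<^sup>2))"
      unfolding exp_le_cancel_iff using that t by (intro mult_right_mono) auto
    also have "\<dots> \<le> bernoulli_mgf t u" by (rule bernoulli_mgf_ge[OF t]) (use that v in simp)
    finally show ?thesis .
  qed
  show ?thesis
  proof (cases "\<bar>\<nu>\<bar> \<le> 2 * v")
    case True
    have "(\<Sum>x=1..N. (h x)\<^sup>2) \<le> (\<Sum>x=1..N. (h x + \<nu>)\<^sup>2)"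
    proof -
      have "(\<Sum>x=1..N. (h x + \<nu>)\<^sup>2) = (\<Sum>x=1..N. (h x)\<^sup>2) + 2 * \<nu> * (\<Sum>x=1..N. h x) + real N * \<nu>\<^sup>2"
        by (simp add: power2_sum sum.distrib sum_distrib_left mult_ac)
      then show ?thesis using h(2) by simp
    qed
    then have "exp ((1 - 3 * v) * (t * (1 - t) / 2 * (\<Sum>x=1..N. (h x)\<^sup>2))) \<le>
       exp ((1 - 3 * v) * (t * (1 - t) / 2 * (\<Sum>x=1..N. (h x + \<nu>)\<^sup>2)))"
      unfolding exp_le_cancel_iff using v t by (intro mult_left_mono) auto
    also have "\<dots> = (\<Prod>x=1..N. exp ((1 - 3 * v) * (t * (1 - t) / 2 * (h x + \<nu>)\<^sup>2)))"
      by (simp add: exp_sum[symmetric] sum_distrib_left)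
    also have "\<dots> \<le> (\<Prod>x=1..N. bernoulli_mgf t (h x + \<nu>))"
    proof (rule prod_mono)
      fix x assume "x \<in> {1..N}"
      then have "\<bar>h x + \<nu>\<bar> \<le> 3 * v" using h(1)[of x] True by linarith
      then show "0 \<le> exp ((1 - 3 * v) * (t * (1 - t) / 2 * (h x + \<nu>)\<^sup>2)) \<and>
          exp ((1 - 3 * v) * (t * (1 - t) / 2 * (h x + \<nu>)\<^sup>2)) \<le> bernoulli_mgf t (h x + \<nu>)"
        using lower by simp
    qed
    finally show ?thesis .
  next
    case False
    have "exp ((1 - 3 * v) * (t * (1 - t) / 2 * (\<Sum>x=1..N. (h x)\<^sup>2))) =
       (\<Prod>x=1..N. exp ((1 - 3 * v) * (t * (1 - t) / 2 * (h x)\<^sup>2)))"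
      by (simp add: exp_sum[symmetric] sum_distrib_left)
    also have "\<dots> \<le> (\<Prod>x=1..N. bernoulli_mgf t (h x + \<nu>))"
    proof (rule prod_mono)
      fix x assume x: "x \<in> {1..N}"
      define y where "y = h x + \<nu>"
      define s where "s = \<bar>h x\<bar> / \<bar>y\<bar>"
      have y: "\<bar>h x\<bar> \<le> \<bar>y\<bar>" "0 < \<bar>y\<bar>" using h(1)[OF x] False v unfolding y_def by linarith+
      have s: "0 \<le> s" "s \<le> 1" using y by (auto simp: s_def)
      \<comment> \<open>The sign may differ from that of \<open>h x\<close>; only the square enters
        \<open>lower\<close>.\<close>
      have sy: "\<bar>s * y\<bar> = \<bar>h x\<bar>" using y by (simp add: s_def abs_mult)
      then have "(h x)\<^sup>2 = (s * y)\<^sup>2" by (metis power2_abs)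
      then have "exp ((1 - 3 * v) * (t * (1 - t) / 2 * (h x)\<^sup>2)) \<le> bernoulli_mgf t (s * y)"
        using lower[of "s * y"] sy h(1)[OF x] v by simp
      also have "\<dots> \<le> bernoulli_mgf t y" by (rule bernoulli_mgf_scale[OF t s])
      finally show "0 \<le> exp ((1 - 3 * v) * (t * (1 - t) / 2 * (h x)\<^sup>2)) \<and>
         exp ((1 - 3 * v) * (t * (1 - t) / 2 * (h x)\<^sup>2)) \<le> bernoulli_mgf t (h x + \<nu>)"
        by (simp add: y_def)
    qed
    finally show ?thesis .
  qed
qed

section \<open>Comparison of the slice with the Bernoulli model\<close>

locale slice =
  fixes N m :: nat and t :: real
  assumes m: "1 \<le> m" and t: "0 < t" "t < 1" and mt: "real m = t * real N"
begin

lemma N_pos: "0 < N"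
  using m mt by (cases N) auto

lemma m_le: "m \<le> N"
proof -
  have "real m \<le> 1 * real N" unfolding mt using t by (intro mult_right_mono) auto
  then show ?thesis by simp
qed

lemma t01: "0 \<le> t" "t \<le> 1"
  using t by auto

abbreviation slice_sets :: "nat set set" where
  "slice_sets \<equiv> {B. B \<subseteq> {1..N} \<and> card B = m}"

lemma slice_sets: "finite slice_sets" "slice_sets \<noteq> {}" "card slice_sets = N choose m"
proof -
  show "finite slice_sets" by simp
  show c: "card slice_sets = N choose m" using n_subsets[of "{1..N}" m] by simp
  have "0 < N choose m" using m_le by simp
  then show "slice_sets \<noteq> {}" using c by (metis card.empty less_irrefl)
qed

lemma set_random_subset: "set_pmf (random_subset N m) = slice_sets"
  unfolding random_subset_def by (rule set_pmf_of_set) (use slice_sets in auto)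

lemma expectation_random_subset:
  "measure_pmf.expectation (random_subset N m) g = (\<Sum>B\<in>slice_sets. g B) / real (N choose m)"
  unfolding random_subset_def
  by (subst integral_pmf_of_set) (use slice_sets in auto)

lemma bernoulli_slice:
  "bernoulli_exp t N (\<lambda>B. of_bool (card B = m) * g B) = t ^ m * (1 - t) ^ (N - m) * (\<Sum>B\<in>slice_sets. g B)"
proof -
  have "bernoulli_exp t N (\<lambda>B. of_bool (card B = m) * g B) =
      (\<Sum>B\<in>Pow {1..N}. of_bool (card B = m) * (t ^ m * (1 - t) ^ (N - m) * g B))"
    unfolding bernoulli_exp_def by (intro sum.cong) auto
  also have "\<dots> = (\<Sum>B\<in>{B \<in> Pow {1..N}. card B = m}. t ^ m * (1 - t) ^ (N - m) * g B)"
    by (rule sum_filter_of_bool[symmetric]) simp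
  also have "{B \<in> Pow {1..N}. card B = m} = slice_sets" by auto
  finally show ?thesis by (simp add: sum_distrib_left)
qed

text \<open>The case h = 0 of the slice bound for Laplace transforms, where every factor is at least
  1; it takes the place of Stirling's formula.\<close>

lemma slice_prob_ge: "1 \<le> real (N + 1) * bernoulli_prob t N (\<lambda>B. card B = m)"
proof -
  obtain \<nu> where \<nu>: "(\<Prod>x=1..N. bernoulli_mgf t (0 + \<nu>)) \<le>
    real (N + 1) * bernoulli_exp t N (\<lambda>B. of_bool (card B = m) * exp (\<Sum>x=1..N. 0 * centred t x B))"
    using bernoulli_slice_exp_ge[OF t m m_le mt, of "\<lambda>_. 0"] by blast
  have "1 \<le> (\<Prod>x=1..N. bernoulli_mgf t (0 + \<nu>))"
    by (rule prod_ge_1) (rule bernoulli_mgf_ge_1[OF t])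
  with \<nu> show ?thesis by simp
qed

lemma expectation_slice:
  "measure_pmf.expectation (random_subset N m) g * bernoulli_prob t N (\<lambda>B. card B = m) =
     bernoulli_exp t N (\<lambda>B. of_bool (card B = m) * g B)"
proof -
  have "bernoulli_prob t N (\<lambda>B. card B = m) = t ^ m * (1 - t) ^ (N - m) * real (N choose m)"
    using bernoulli_slice[of "\<lambda>_. 1"] slice_sets(3) by simp
  moreover have "0 < N choose m" using m_le by simp
  ultimately show ?thesis
    unfolding expectation_random_subset bernoulli_slice by simp
qed

lemma expectation_slice_le:
  assumes "\<And>B. 0 \<le> g B"
  shows "measure_pmf.expectation (random_subset N m) g \<le> real (N + 1) * bernoulli_exp t N g"
proof -
  let ?p = "bernoulli_prob t N (\<lambda>B. card B = m)"
  let ?E = "measure_pmf.expectation (random_subset N m) g"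
  have E0: "0 \<le> ?E" using assms by simp
  have "?E * 1 \<le> ?E * (real (N + 1) * ?p)"
    using slice_prob_ge E0 by (intro mult_left_mono) auto
  also have "\<dots> = real (N + 1) * bernoulli_exp t N (\<lambda>B. of_bool (card B = m) * g B)"
    by (simp add: expectation_slice[symmetric])
  also have "\<dots> \<le> real (N + 1) * bernoulli_exp t N g"
    using assms by (intro mult_left_mono bernoulli_exp_mono t01) auto
  finally show ?thesis by simp
qed

lemma expectation_slice_ge:
  assumes "\<And>B. 0 \<le> g B"
  shows "bernoulli_exp t N (\<lambda>B. of_bool (card B = m) * g B) \<le> measure_pmf.expectation (random_subset N m) g"
proof -
  have "bernoulli_prob t N (\<lambda>B. card B = m) \<le> bernoulli_prob t N (\<lambda>B. {} \<subseteq> B)"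
    by (rule bernoulli_prob_mono[OF t01]) simp
  also have "\<dots> = 1" by (subst bernoulli_prob_subset) auto
  finally have "bernoulli_prob t N (\<lambda>B. card B = m) \<le> 1" .
  moreover have "0 \<le> measure_pmf.expectation (random_subset N m) g" using assms by simp
  ultimately show ?thesis
    unfolding expectation_slice[symmetric] by (rule mult_left_le)
qed

lemma prob_slice_le:
  "measure_pmf.prob (random_subset N m) {B. Q B} \<le> real (N + 1) * bernoulli_prob t N Q"
proof -
  have "measure_pmf.prob (random_subset N m) {B. Q B} = measure_pmf.expectation (random_subset N m) (\<lambda>B. of_bool (Q B))"
  proof -
    have "(\<lambda>B. of_bool (Q B)) = indicat_real {B. Q B}" by (auto simp: indicator_def)
    then show ?thesis by simp
  qed
  also have "\<dots> \<le> real (N + 1) * bernoulli_prob t N Q"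
    by (rule expectation_slice_le) simp
  finally show ?thesis .
qed

definition linear_form :: "(nat \<Rightarrow> real) \<Rightarrow> nat set \<Rightarrow> real" where
  "linear_form w B = (\<Sum>x=1..N. w x * centred t x B)"

lemma linear_form_laplace_le:
  assumes w: "\<And>x. x \<in> {1..N} \<Longrightarrow> \<bar>w x\<bar> \<le> b" and \<theta>: "0 \<le> \<theta>"
  shows "measure_pmf.expectation (random_subset N m) (\<lambda>B. exp (\<theta> * linear_form w B))
     \<le> real (N + 1) * exp (exp (\<theta> * b) * (\<theta>\<^sup>2 * (t * (1 - t) * (\<Sum>x=1..N. (w x)\<^sup>2)) / 2))"
proof -
  let ?c = "exp (\<theta> * b) * (\<theta>\<^sup>2 * (t * (1 - t) * (\<Sum>x=1..N. (w x)\<^sup>2)) / 2)"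
  have bnd: "\<forall>x\<in>{1..N}. \<bar>\<theta> * w x\<bar> \<le> \<theta> * b"
    using w \<theta> by (auto simp: abs_mult intro!: mult_left_mono)
  have "(\<Sum>x=1..N. centred t x B * (\<theta> * w x) - exp (\<theta> * b) / 2 * (t * (1 - t)) * (\<theta> * w x)\<^sup>2) =
      \<theta> * linear_form w B - ?c" for B
    by (simp add: linear_form_def sum_subtractf sum_distrib_left power_mult_distrib mult_ac)
  then have "bernoulli_exp t N (\<lambda>B. exp (\<theta> * linear_form w B - ?c)) \<le> 1"
    using freedman_supermartingale[OF t01, of "\<lambda>x B. \<theta> * w x" N "\<theta> * b"] bnd by simp
  moreover have "bernoulli_exp t N (\<lambda>B. exp (\<theta> * linear_form w B)) =
      exp ?c * bernoulli_exp t N (\<lambda>B. exp (\<theta> * linear_form w B - ?c))"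
    unfolding bernoulli_exp_cmult[symmetric] by (simp add: exp_diff)
  ultimately have "bernoulli_exp t N (\<lambda>B. exp (\<theta> * linear_form w B)) \<le> exp ?c"
    by (simp add: mult_left_le)
  moreover have "measure_pmf.expectation (random_subset N m) (\<lambda>B. exp (\<theta> * linear_form w B))
    \<le> real (N + 1) * bernoulli_exp t N (\<lambda>B. exp (\<theta> * linear_form w B))"
    by (rule expectation_slice_le) simp
  ultimately show ?thesis
    by (meson mult_left_mono of_nat_0_le_iff order_trans)
qed

lemma linear_form_laplace_ge:
  assumes w: "\<And>x. x \<in> {1..N} \<Longrightarrow> \<bar>w x\<bar> \<le> b" "(\<Sum>x=1..N. w x) = 0"
    and \<theta>: "0 \<le> \<theta>" "3 * (\<theta> * b) \<le> 1"
  shows "exp ((1 - 3 * (\<theta> * b)) * (\<theta>\<^sup>2 * (t * (1 - t) * (\<Sum>x=1..N. (w x)\<^sup>2)) / 2))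
     \<le> real (N + 1) * measure_pmf.expectation (random_subset N m) (\<lambda>B. exp (\<theta> * linear_form w B))"
proof -
  have b0: "0 \<le> b" using w(1)[of 1] N_pos by force
  have bnd: "\<bar>\<theta> * w x\<bar> \<le> \<theta> * b" if "x \<in> {1..N}" for x
    using w(1)[OF that] \<theta> by (auto simp: abs_mult intro!: mult_left_mono)
  obtain \<nu> where \<nu>: "(\<Prod>x=1..N. bernoulli_mgf t (\<theta> * w x + \<nu>)) \<le>
    real (N + 1) * bernoulli_exp t N (\<lambda>B. of_bool (card B = m) * exp (\<Sum>x=1..N. \<theta> * w x * centred t x B))"
    using bernoulli_slice_exp_ge[OF t m m_le mt, of "\<lambda>x. \<theta> * w x"] by blast
  have "exp ((1 - 3 * (\<theta> * b)) * (\<theta>\<^sup>2 * (t * (1 - t) * (\<Sum>x=1..N. (w x)\<^sup>2)) / 2)) =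
      exp ((1 - 3 * (\<theta> * b)) * (t * (1 - t) / 2 * (\<Sum>x=1..N. (\<theta> * w x)\<^sup>2)))"
    by (simp add: power_mult_distrib sum_distrib_left[symmetric] mult_ac)
  also have "\<dots> \<le> (\<Prod>x=1..N. bernoulli_mgf t (\<theta> * w x + \<nu>))"
    by (rule prod_bernoulli_mgf_ge[OF t bnd]) (use \<theta> b0 w(2) in \<open>auto simp: sum_distrib_left[symmetric]\<close>)
  also note \<nu>
  also have "(\<lambda>B. of_bool (card B = m) * exp (\<Sum>x=1..N. \<theta> * w x * centred t x B)) =
     (\<lambda>B. of_bool (card B = m) * exp (\<theta> * linear_form w B))"
    by (simp add: linear_form_def sum_distrib_left mult.assoc)
  also have "real (N + 1) * bernoulli_exp t N \<dots> \<le>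
      real (N + 1) * measure_pmf.expectation (random_subset N m) (\<lambda>B. exp (\<theta> * linear_form w B))"
    by (intro mult_left_mono expectation_slice_ge) auto
  finally show ?thesis .
qed

end

text \<open>The exponentially tilted law concentrates on \<open>(1 - \<delta>) s < X < (1 + \<delta>) s\<close>: the two Laplace
  transforms that are subtracted bound the contributions of \<open>X\<close> outside this window.\<close>

lemma tilted_lower_bound:
  fixes X :: "'a \<Rightarrow> real"
  assumes fin: "finite (set_pmf M)" and \<theta>: "0 \<le> \<theta>" "0 \<le> \<delta>"
  shows "measure_pmf.expectation M (\<lambda>B. exp (\<theta> * X B)) -
      exp (- (\<delta> * \<theta> * ((1 + \<delta>) * s))) * measure_pmf.expectation M (\<lambda>B. exp ((1 + \<delta>) * \<theta> * X B)) -
      exp (\<delta> * \<theta> * ((1 - \<delta>) * s)) * measure_pmf.expectation M (\<lambda>B. exp ((1 - \<delta>) * \<theta> * X B))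
    \<le> exp (\<theta> * ((1 + \<delta>) * s)) * measure_pmf.prob M {B. (1 - \<delta>) * s \<le> X B}"
proof -
  note [simp] = integrable_measure_pmf_finite[OF fin]
  have point: "exp (\<theta> * X B) \<le> exp (\<theta> * ((1 + \<delta>) * s)) * indicator {B. (1 - \<delta>) * s \<le> X B} B +
      exp (- (\<delta> * \<theta> * ((1 + \<delta>) * s))) * exp ((1 + \<delta>) * \<theta> * X B) +
      exp (\<delta> * \<theta> * ((1 - \<delta>) * s)) * exp ((1 - \<delta>) * \<theta> * X B)" for B
  proof -
    have *: "exp (- (\<delta> * \<theta> * ((1 + \<delta>) * s))) * exp ((1 + \<delta>) * \<theta> * X B) = exp (\<theta> * X B + \<delta> * \<theta> * (X B - (1 + \<delta>) * s))"
      "exp (\<delta> * \<theta> * ((1 - \<delta>) * s)) * exp ((1 - \<delta>) * \<theta> * X B) = exp (\<theta> * X B + \<delta> * \<theta> * ((1 - \<delta>) * s - X B))"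
      unfolding exp_add[symmetric] by (simp_all add: algebra_simps)
    consider "(1 + \<delta>) * s \<le> X B" | "X B \<le> (1 - \<delta>) * s" | "(1 - \<delta>) * s \<le> X B" "X B \<le> (1 + \<delta>) * s" by linarith
    then show ?thesis
    proof cases
      case 1
      then have "exp (\<theta> * X B) \<le> exp (\<theta> * X B + \<delta> * \<theta> * (X B - (1 + \<delta>) * s))" using \<theta> by simp
      then show ?thesis unfolding * by (smt (verit) exp_ge_zero indicator_pos_le mult_nonneg_nonneg)
    next
      case 2
      then have "exp (\<theta> * X B) \<le> exp (\<theta> * X B + \<delta> * \<theta> * ((1 - \<delta>) * s - X B))" using \<theta> by simp
      then show ?thesis unfolding * by (smt (verit) exp_ge_zero indicator_pos_le mult_nonneg_nonneg)
    next
      case 3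
      then have "exp (\<theta> * X B) \<le> exp (\<theta> * ((1 + \<delta>) * s))" using \<theta> by (simp add: mult_left_mono)
      then show ?thesis using 3 by (simp add: add_nonneg_nonneg add_increasing2)
    qed
  qed
  have "measure_pmf.expectation M (\<lambda>B. exp (\<theta> * X B)) \<le>
     measure_pmf.expectation M (\<lambda>B. exp (\<theta> * ((1 + \<delta>) * s)) * indicator {B. (1 - \<delta>) * s \<le> X B} B +
      exp (- (\<delta> * \<theta> * ((1 + \<delta>) * s))) * exp ((1 + \<delta>) * \<theta> * X B) +
      exp (\<delta> * \<theta> * ((1 - \<delta>) * s)) * exp ((1 - \<delta>) * \<theta> * X B))"
    by (rule integral_mono) (use point in auto)
  also have "\<dots> = exp (\<theta> * ((1 + \<delta>) * s)) * measure_pmf.prob M {B. (1 - \<delta>) * s \<le> X B} +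
      exp (- (\<delta> * \<theta> * ((1 + \<delta>) * s))) * measure_pmf.expectation M (\<lambda>B. exp ((1 + \<delta>) * \<theta> * X B)) +
      exp (\<delta> * \<theta> * ((1 - \<delta>) * s)) * measure_pmf.expectation M (\<lambda>B. exp ((1 - \<delta>) * \<theta> * X B))"
    by simp
  finally show ?thesis by simp
qed

section \<open>Lower tail of linear forms by exponential tilting\<close>

context slice
begin

text \<open>Cramer's argument: the logarithm of the Laplace transform is close to
  \<open>\<theta>\<^sup>2 * V / 2\<close>, so under the tilt by \<theta> the form concentrates near
  \<open>\<theta> * V\<close>. Undoing the tilt costs \<open>(1 + \<delta>) * (2 * Y)\<close>
  against a gain of about Y.\<close>

lemma linear_form_lower_tail:
  assumes w: "\<And>x. x \<in> {1..N} \<Longrightarrow> \<bar>w x\<bar> \<le> b" "(\<Sum>x=1..N. w x) = 0"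
    and V: "V = t * (1 - t) * (\<Sum>x=1..N. (w x)\<^sup>2)"
    and \<theta>: "0 \<le> \<theta>" and \<delta>: "0 < \<delta>" "\<delta> \<le> 1"
    and \<theta>b: "64 * (\<theta> * b) \<le> \<delta>\<^sup>2"
    and Y: "Y = \<theta>\<^sup>2 * V / 2" "4 * (real (N + 1))\<^sup>2 \<le> exp (Y * \<delta>\<^sup>2 / 2)"
  shows "exp (- (1 + 3 * \<delta>) * Y) \<le> measure_pmf.prob (random_subset N m) {B. (1 - \<delta>) * (\<theta> * V) \<le> linear_form w B}"
proof -
  let ?M = "random_subset N m"
  let ?E = "\<lambda>\<theta>. measure_pmf.expectation ?M (\<lambda>B. exp (\<theta> * linear_form w B))"
  let ?P = "measure_pmf.prob ?M {B. (1 - \<delta>) * (\<theta> * V) \<le> linear_form w B}"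
  have b0: "0 \<le> b" using w(1)[of 1] N_pos by force
  have \<theta>b0: "0 \<le> \<theta> * b" using \<theta> b0 by simp
  have \<delta>2: "\<delta>\<^sup>2 \<le> 1" "0 < \<delta>\<^sup>2" "\<delta>\<^sup>2 \<le> \<delta>"
    using \<delta> power_le_one[of \<delta> 2] mult_left_le[of \<delta> \<delta>] by (auto simp: power2_eq_square)
  have V0: "0 \<le> V" unfolding V using t by (intro mult_nonneg_nonneg sum_nonneg) auto
  have Y0: "0 \<le> Y" unfolding Y(1) using V0 by simp
  have N1: "1 \<le> real (N + 1)" by simp
  \<comment> \<open>In units of Y, the subtracted transforms have exponent
    \<open>1 - \<delta>\<^sup>2\<close> plus at most a quarter of \<open>\<delta>\<^sup>2\<close>
    for the error of the quadratic approximation, and \<open>lower\<close> loses at most another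
    quarter. The gap \<open>\<delta>\<^sup>2 / 2\<close> beats the polynomial factor by
    \<open>Y(2)\<close>.\<close>
  define F where "F = exp (Y * (1 - 3 * \<delta>\<^sup>2 / 4))"
  have lower: "exp ((1 - \<delta>\<^sup>2 / 4) * Y) \<le> real (N + 1) * ?E \<theta>"
  proof -
    have "exp ((1 - \<delta>\<^sup>2 / 4) * Y) \<le> exp ((1 - 3 * (\<theta> * b)) * Y)"
      unfolding exp_le_cancel_iff using \<theta>b Y0 \<theta>b0 by (intro mult_right_mono) auto
    also have "\<dots> \<le> real (N + 1) * ?E \<theta>"
      using linear_form_laplace_ge[of w b \<theta>] w \<theta> \<theta>b \<delta>2 unfolding Y(1) V by simp
    finally show ?thesis .
  qed
  \<comment> \<open>d stands for the changed tilts 1 + \<delta> and 1 - \<delta>, and c is the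
    exponent of the prefactor in units of 2 Y; both choices satisfy the same identity.\<close>
  have upper: "exp (c * (2 * Y)) * ?E (d * \<theta>) \<le> real (N + 1) * F"
    if d: "0 \<le> d" "d \<le> 2" and c: "c + c + d\<^sup>2 = 1 - \<delta>\<^sup>2" for c d
  proof -
    have "?E (d * \<theta>) \<le> real (N + 1) * exp (exp (d * \<theta> * b) * ((d * \<theta>)\<^sup>2 * V / 2))"
      using linear_form_laplace_le[of w b "d * \<theta>"] w \<theta> d unfolding V by simp
    also have "\<dots> \<le> real (N + 1) * exp ((1 + \<delta>\<^sup>2 / 16) * ((d * \<theta>)\<^sup>2 * V / 2))"
    proof -
      have x: "0 \<le> d * \<theta> * b" using d \<theta> b0 by simp
      have "d * \<theta> * b \<le> 2 * (\<theta> * b)" using mult_right_mono[OF d(2), of "\<theta> * b"] \<theta> b0 by (simp add: mult_ac)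
      then have x2: "d * \<theta> * b \<le> \<delta>\<^sup>2 / 32" using \<theta>b by simp
      then have x1: "d * \<theta> * b \<le> 1" using \<delta>2 by simp
      have "exp (d * \<theta> * b) \<le> 1 + d * \<theta> * b + (d * \<theta> * b)\<^sup>2" by (rule exp_bound[OF x x1])
      also have "(d * \<theta> * b)\<^sup>2 \<le> d * \<theta> * b" using x x1 by (simp add: power2_eq_square mult_left_le)
      finally have "exp (d * \<theta> * b) \<le> 1 + \<delta>\<^sup>2 / 16" using x2 by linarith
      then show ?thesis using V0 by (intro mult_left_mono exp_le_cancel_iff[THEN iffD2] mult_right_mono) auto
    qed
    finally have "exp (c * (2 * Y)) * ?E (d * \<theta>) \<le>
       exp (c * (2 * Y)) * (real (N + 1) * exp ((1 + \<delta>\<^sup>2 / 16) * ((d * \<theta>)\<^sup>2 * V / 2)))"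
      by (intro mult_left_mono) auto
    also have "\<dots> = real (N + 1) * exp (c * (2 * Y) + (1 + \<delta>\<^sup>2 / 16) * (d\<^sup>2 * Y))"
      by (simp add: exp_add Y(1) power_mult_distrib mult_ac)
    also have "c * (2 * Y) + (1 + \<delta>\<^sup>2 / 16) * (d\<^sup>2 * Y) = Y * ((c + c + d\<^sup>2) + \<delta>\<^sup>2 / 16 * d\<^sup>2)"
      by (simp add: algebra_simps)
    also have "real (N + 1) * exp \<dots> \<le> real (N + 1) * F"
    proof -
      have "d\<^sup>2 \<le> 2\<^sup>2" using d by (intro power_mono) auto
      then have "\<delta>\<^sup>2 / 16 * d\<^sup>2 \<le> \<delta>\<^sup>2 / 16 * 4" by (intro mult_left_mono) auto
      then have "(c + c + d\<^sup>2) + \<delta>\<^sup>2 / 16 * d\<^sup>2 \<le> 1 - 3 * \<delta>\<^sup>2 / 4" unfolding c by simp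
      then show ?thesis unfolding F_def using Y0 by (intro mult_left_mono exp_le_cancel_iff[THEN iffD2]) auto
    qed
    finally show ?thesis .
  qed
  have "?E \<theta> - exp (- (\<delta> * \<theta> * ((1 + \<delta>) * (\<theta> * V)))) * ?E ((1 + \<delta>) * \<theta>) -
      exp (\<delta> * \<theta> * ((1 - \<delta>) * (\<theta> * V))) * ?E ((1 - \<delta>) * \<theta>) \<le> exp (\<theta> * ((1 + \<delta>) * (\<theta> * V))) * ?P"
    by (rule tilted_lower_bound) (use set_random_subset slice_sets \<theta> \<delta> in auto)
  moreover have "- (\<delta> * \<theta> * ((1 + \<delta>) * (\<theta> * V))) = (- \<delta> * (1 + \<delta>)) * (2 * Y)"
    "\<delta> * \<theta> * ((1 - \<delta>) * (\<theta> * V)) = (\<delta> * (1 - \<delta>)) * (2 * Y)"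
    "\<theta> * ((1 + \<delta>) * (\<theta> * V)) = (1 + \<delta>) * (2 * Y)"
    by (simp_all add: Y(1) power2_eq_square algebra_simps)
  moreover have "exp ((- \<delta> * (1 + \<delta>)) * (2 * Y)) * ?E ((1 + \<delta>) * \<theta>) \<le> real (N + 1) * F"
    by (rule upper) (use \<delta> in \<open>auto simp: power2_eq_square algebra_simps\<close>)
  moreover have "exp ((\<delta> * (1 - \<delta>)) * (2 * Y)) * ?E ((1 - \<delta>) * \<theta>) \<le> real (N + 1) * F"
    by (rule upper) (use \<delta> in \<open>auto simp: power2_eq_square algebra_simps\<close>)
  ultimately have main: "?E \<theta> - 2 * (real (N + 1) * F) \<le> exp ((1 + \<delta>) * (2 * Y)) * ?P" by simp
  have "4 * (real (N + 1))\<^sup>2 * F \<le> exp (Y * \<delta>\<^sup>2 / 2) * F"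
    using Y by (intro mult_right_mono) (auto simp: F_def)
  also have "\<dots> = exp ((1 - \<delta>\<^sup>2 / 4) * Y)"
    unfolding F_def exp_add[symmetric] by (simp add: algebra_simps)
  finally have F: "4 * (real (N + 1))\<^sup>2 * F \<le> exp ((1 - \<delta>\<^sup>2 / 4) * Y)" .
  have "exp ((1 - \<delta>\<^sup>2 / 4) * Y) \<le> 2 * (exp ((1 - \<delta>\<^sup>2 / 4) * Y) - 2 * (real (N + 1))\<^sup>2 * F)"
    using F by simp
  also have "\<dots> \<le> 2 * (real (N + 1) * ?E \<theta> - 2 * (real (N + 1))\<^sup>2 * F)"
    using lower by simp
  also have "\<dots> = 2 * real (N + 1) * (?E \<theta> - 2 * (real (N + 1) * F))"
    by (simp add: power2_eq_square algebra_simps)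
  also have "\<dots> \<le> 2 * real (N + 1) * (exp ((1 + \<delta>) * (2 * Y)) * ?P)"
    by (intro mult_left_mono main) auto
  also have "\<dots> \<le> exp (Y * \<delta>\<^sup>2 / 2) * (exp ((1 + \<delta>) * (2 * Y)) * ?P)"
  proof (rule mult_right_mono)
    have "2 * real (N + 1) \<le> 4 * (real (N + 1))\<^sup>2"
      using N1 self_le_power[of "real (N + 1)" 2] by simp
    then show "2 * real (N + 1) \<le> exp (Y * \<delta>\<^sup>2 / 2)" using Y(2) by simp
  qed simp
  also have "\<dots> = exp (Y * \<delta>\<^sup>2 / 2 + (1 + \<delta>) * (2 * Y)) * ?P"
    by (simp add: exp_add)
  finally have "exp ((1 - \<delta>\<^sup>2 / 4) * Y) \<le> exp (Y * \<delta>\<^sup>2 / 2 + (1 + \<delta>) * (2 * Y)) * ?P" .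
  then have "exp (- (Y * \<delta>\<^sup>2 / 2 + (1 + \<delta>) * (2 * Y))) * exp ((1 - \<delta>\<^sup>2 / 4) * Y) \<le>
     exp (- (Y * \<delta>\<^sup>2 / 2 + (1 + \<delta>) * (2 * Y))) * (exp (Y * \<delta>\<^sup>2 / 2 + (1 + \<delta>) * (2 * Y)) * ?P)"
    by (intro mult_left_mono) auto
  also have "\<dots> = ?P"
    unfolding mult.assoc[symmetric] exp_add[symmetric] by simp
  finally have "exp (- (Y * \<delta>\<^sup>2 / 2 + (1 + \<delta>) * (2 * Y)) + (1 - \<delta>\<^sup>2 / 4) * Y) \<le> ?P"
    by (simp only: exp_add)
  moreover have "- (1 + 3 * \<delta>) * Y \<le> - (Y * \<delta>\<^sup>2 / 2 + (1 + \<delta>) * (2 * Y)) + (1 - \<delta>\<^sup>2 / 4) * Y"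
  proof -
    have "3 / 4 * \<delta>\<^sup>2 \<le> \<delta>" using \<delta>2(3) \<delta>(1) by linarith
    then have "(3 / 4 * \<delta>\<^sup>2) * Y \<le> \<delta> * Y" by (intro mult_right_mono Y0)
    then show ?thesis by (simp add: algebra_simps)
  qed
  ultimately show ?thesis by (meson exp_le_cancel_iff order_trans)
qed

end

section \<open>The deviation of the edge count\<close>

text \<open>\<open>q k\<close> is the probability that a fixed k-set lies in the random m-set. Each
  new factor (m - k) / (N - k) is below t by at most k / N, and these errors accumulate to at most
  k^2 t^(k-1) / N.\<close>

lemma choose_ratio_bounds:
  fixes N m k :: nat
  assumes "k \<le> m" "m \<le> N" "0 < N"
  defines "q \<equiv> \<lambda>k. real (m choose k) / real (N choose k)"
  defines "t \<equiv> real m / real N"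
  shows "q k \<le> t ^ k \<and> t ^ k - q k \<le> (real k)\<^sup>2 * t ^ (k - 1) / real N"
  using assms(1)
proof (induction k)
  case 0
  then show ?case by (simp add: q_def)
next
  case (Suc k)
  have t0: "0 \<le> t" "t \<le> 1" using assms by (auto simp: t_def)
  have kN: "k < N" "k < m" using Suc.prems assms by auto
  have IH: "q k \<le> t ^ k" "t ^ k - q k \<le> (real k)\<^sup>2 * t ^ (k - 1) / real N"
    using Suc by auto
  have q0: "0 \<le> q k" by (simp add: q_def)
  define f where "f = (real m - real k) / (real N - real k)"
  have rec: "q (Suc k) = q k * f"
  proof -
    have *: "real (Suc k) * real (n choose Suc k) = real (n choose k) * (real n - real k)" if "k < n" for n
    proof -
      have "Suc k * (n choose Suc k) = (n - k) * (n choose k)"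
        using that by (metis binomial_absorb_comp binomial_absorption mult.commute Suc_diff_Suc)
      then have "real (Suc k) * real (n choose Suc k) = real (n - k) * real (n choose k)"
        by (metis of_nat_mult)
      then show ?thesis using that by (simp add: of_nat_diff mult.commute)
    qed
    have "q (Suc k) = (real (Suc k) * real (m choose Suc k)) / (real (Suc k) * real (N choose Suc k))"
      by (simp add: q_def del: of_nat_Suc)
    also have "\<dots> = q k * f"
      unfolding *[OF kN(1)] *[OF kN(2)] by (simp add: q_def f_def)
    finally show ?thesis .
  qed
  have f: "0 \<le> f" "f \<le> t" "t - f \<le> real k / real N"
  proof -
    show "0 \<le> f" using kN by (simp add: f_def)
    have "real m * (real N - real k) - real N * (real m - real k) = real k * (real N - real m)"
      by (simp add: algebra_simps)
    moreover have "0 \<le> real k * (real N - real m)" using assms by simp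
    ultimately have "real N * (real m - real k) \<le> real m * (real N - real k)" by linarith
    then show "f \<le> t" using kN assms by (simp add: f_def t_def divide_simps mult.commute)
    have "(real m - real k) / real N \<le> f"
      unfolding f_def using kN by (intro divide_left_mono) auto
    then show "t - f \<le> real k / real N" by (simp add: t_def diff_divide_distrib)
  qed
  have "q (Suc k) \<le> t ^ k * t" unfolding rec using IH f q0 t0 by (intro mult_mono) auto
  moreover have "t ^ Suc k - q (Suc k) \<le> (real (Suc k))\<^sup>2 * t ^ (Suc k - 1) / real N"
  proof -
    have "t ^ Suc k - q (Suc k) = t * (t ^ k - q k) + q k * (t - f)"
      unfolding rec by (simp add: algebra_simps)
    also have "\<dots> \<le> t * ((real k)\<^sup>2 * t ^ (k - 1) / real N) + t ^ k * (real k / real N)"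
      using IH f t0 q0 by (intro add_mono mult_mono) auto
    also have "t * ((real k)\<^sup>2 * t ^ (k - 1) / real N) = (real k)\<^sup>2 * t ^ k / real N"
      by (cases k) auto
    also have "(real k)\<^sup>2 * t ^ k / real N + t ^ k * (real k / real N) = ((real k)\<^sup>2 + real k) * (t ^ k / real N)"
      by (simp add: distrib_left add_divide_distrib mult.commute)
    also have "\<dots> \<le> (real (Suc k))\<^sup>2 * (t ^ k / real N)"
      using t0 by (intro mult_right_mono) (auto simp: power2_eq_square algebra_simps)
    finally show ?thesis by simp
  qed
  ultimately show ?case by (simp add: mult.commute)
qed

locale slice_hypergraph = bounded_hypergraph k r N C t H + slice N m t
  for k r N C t H m +
  assumes t_half: "t \<le> 1 / 2"
    and variance: "real N ^ (2 * r - 2) / C \<le> degree_variance N H"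
begin

lemma card_slice_superset:
  assumes e: "e \<subseteq> {1..N}" "card e = k" "k \<le> m"
  shows "card {B \<in> slice_sets. e \<subseteq> B} = (N - k) choose (m - k)"
proof -
  have fin: "finite e" using e finite_subset by blast
  have "bij_betw (\<lambda>B. B - e) {B \<in> slice_sets. e \<subseteq> B} {B. B \<subseteq> {1..N} - e \<and> card B = m - k}"
  proof (rule bij_betwI[where g = "\<lambda>B. B \<union> e"])
    show "(\<lambda>B. B - e) \<in> {B \<in> slice_sets. e \<subseteq> B} \<rightarrow> {B. B \<subseteq> {1..N} - e \<and> card B = m - k}"
      using e fin by (auto simp: card_Diff_subset)
    show "(\<lambda>B. B \<union> e) \<in> {B. B \<subseteq> {1..N} - e \<and> card B = m - k} \<rightarrow> {B \<in> slice_sets. e \<subseteq> B}"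
    proof
      fix B assume "B \<in> {B. B \<subseteq> {1..N} - e \<and> card B = m - k}"
      then have B: "B \<subseteq> {1..N} - e" "card B = m - k" by auto
      then have "finite B" by (meson finite_Diff finite_atLeastAtMost finite_subset)
      then have "card (B \<union> e) = (m - k) + k" using B e fin by (subst card_Un_disjoint) auto
      then show "B \<union> e \<in> {B \<in> slice_sets. e \<subseteq> B}" using B e by auto
    qed
  qed auto
  then have "card {B \<in> slice_sets. e \<subseteq> B} = card {B. B \<subseteq> {1..N} - e \<and> card B = m - k}"
    by (rule bij_betw_same_card)
  also have "\<dots> = (N - k) choose (m - k)"
    using n_subsets[of "{1..N} - e" "m - k"] e fin by (simp add: card_Diff_subset)
  finally show ?thesis .
qed

text \<open>The slice and Bernoulli means differ by a relative error of order 1 / (t N). As the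
  total weight is at most C N^r, this amounts to a multiple of the typical degree, which is
  negligible against a.\<close>

lemma mean_edge_count:
  assumes km: "k \<le> m"
  shows "\<bar>measure_pmf.expectation (random_subset N m) (edge_count H) - t ^ k * total_weight H\<bar>
    \<le> C * (real k)\<^sup>2 * typical_degree"
proof -
  define q where "q = real (m choose k) / real (N choose k)"
  have tq: "t = real m / real N" using mt N_pos by simp
  have q: "q \<le> t ^ k" "t ^ k - q \<le> (real k)\<^sup>2 * t ^ (k - 1) / real N"
    using choose_ratio_bounds[OF km m_le N_pos] unfolding q_def tq by auto
  have "measure_pmf.expectation (random_subset N m) (edge_count H) =
      (\<Sum>B\<in>slice_sets. \<Sum>e\<in>hedges H. hweight H e * of_bool (e \<subseteq> B)) / real (N choose m)"
    unfolding expectation_random_subset edge_count_eq ..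
  also have "\<dots> = (\<Sum>e\<in>hedges H. hweight H e * (\<Sum>B\<in>slice_sets. of_bool (e \<subseteq> B))) / real (N choose m)"
    by (subst sum.swap) (simp only: sum_distrib_left)
  also have "\<dots> = (\<Sum>e\<in>hedges H. hweight H e * (q * real (N choose m))) / real (N choose m)"
  proof (intro arg_cong2[where f = "(/)"] sum.cong refl arg_cong2[where f = "(*)"])
    fix e assume e: "e \<in> hedges H"
    have "(\<Sum>B\<in>slice_sets. of_bool (e \<subseteq> B)) = real (card {B \<in> slice_sets. e \<subseteq> B})"
      using slice_sets(1) by (simp add: of_bool_def sum.inter_filter[symmetric])
    also have "\<dots> = real ((N - k) choose (m - k))"
      using card_slice_superset edge[OF e] km by simp
    also have "\<dots> = q * real (N choose m)"
    proof -
      have "(N choose m) * (m choose k) = (N choose k) * ((N - k) choose (m - k))"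
        using choose_mult[OF km m_le] by simp
      then have "real (N choose m) * real (m choose k) = real (N choose k) * real ((N - k) choose (m - k))"
        by (metis of_nat_mult)
      moreover have "0 < N choose k" using km m_le by simp
      ultimately show ?thesis by (simp add: q_def field_simps)
    qed
    finally show "(\<Sum>B\<in>slice_sets. of_bool (e \<subseteq> B)) = q * real (N choose m)" .
  qed
  also have "\<dots> = q * total_weight H"
  proof -
    have "0 < N choose m" using m_le by simp
    then show ?thesis
      unfolding total_weight_def sum_distrib_right[symmetric] by simp
  qed
  finally have "measure_pmf.expectation (random_subset N m) (edge_count H) - t ^ k * total_weight H =
      - ((t ^ k - q) * total_weight H)"
    by (simp add: algebra_simps)
  moreover have tw: "0 \<le> total_weight H" "total_weight H \<le> C * real N ^ r"
  proof -
    show "0 \<le> total_weight H" unfolding total_weight_def by (intro sum_nonneg weight_nonneg)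
    show "total_weight H \<le> C * real N ^ r"
      using degree_set_le[of "{}"] by (simp add: total_weight_def degree_set_def)
  qed
  moreover have "(t ^ k - q) * total_weight H \<le> ((real k)\<^sup>2 * t ^ (k - 1) / real N) * (C * real N ^ r)"
    using q tw t by (intro mult_mono) auto
  moreover have "real N ^ r = real N * real N ^ (r - 1)"
    using r by (metis One_nat_def Suc_pred gr0I not_numeral_le_zero power_Suc)
  ultimately show ?thesis
    using q N_pos by (simp add: typical_degree_def mult_ac)
qed

section \<open>Centred degrees and the linear part of the deviation\<close>

definition centred_degree :: "nat \<Rightarrow> real" where
  "centred_degree x = vertex_degree H x - avg_degree N H"

lemma sum_centred_degree: "(\<Sum>x=1..N. centred_degree x) = 0"
  using N_pos by (simp add: centred_degree_def sum_subtractf avg_degree_def)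

lemma sum_centred_degree_power2: "(\<Sum>x=1..N. (centred_degree x)\<^sup>2) = real N * degree_variance N H"
  using N_pos by (simp add: centred_degree_def degree_variance_def)

lemma centred_degree_le:
  assumes "x \<in> {1..N}"
  shows "\<bar>centred_degree x\<bar> \<le> C * real N ^ (r - 1)"
proof -
  have vd: "0 \<le> vertex_degree H x" "vertex_degree H x \<le> C * real N ^ (r - 1)" if "x \<in> {1..N}" for x
  proof -
    show "0 \<le> vertex_degree H x"
      unfolding vertex_degree_def degree_set_def by (intro sum_nonneg weight_nonneg) auto
    show "vertex_degree H x \<le> C * real N ^ (r - 1)"
      using degree_set_le[of "{x}"] that r by (simp add: vertex_degree_def)
  qed
  have "0 \<le> avg_degree N H"
    unfolding avg_degree_def using vd by (intro mult_nonneg_nonneg sum_nonneg) auto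
  moreover have "avg_degree N H \<le> C * real N ^ (r - 1)"
  proof -
    have "(\<Sum>x=1..N. vertex_degree H x) \<le> real (card {1..N}) * (C * real N ^ (r - 1))"
      by (rule sum_bounded_above) (rule vd)
    then show ?thesis using N_pos by (simp add: avg_degree_def field_simps)
  qed
  ultimately show ?thesis using vd[OF assms] unfolding centred_degree_def by linarith
qed

text \<open>Together with the lower bound \<open>variance\<close> this makes the exponent comparable
  with \<rho>.\<close>

lemma variance_le: "degree_variance N H \<le> C\<^sup>2 * real N ^ (2 * r - 2)"
proof -
  have double: "2 * r - 2 = (r - 1) * 2" using r by simp
  have "real N * degree_variance N H \<le> real (card {1..N}) * (C * real N ^ (r - 1))\<^sup>2"
    unfolding sum_centred_degree_power2[symmetric]
    by (rule sum_bounded_above)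
       (use centred_degree_le C in \<open>auto simp: abs_le_square_iff[symmetric] abs_mult\<close>)
  also have "(C * real N ^ (r - 1))\<^sup>2 = C\<^sup>2 * real N ^ (2 * r - 2)"
    unfolding double by (simp add: power_mult_distrib power_mult)
  finally show ?thesis using N_pos by simp
qed

lemma deviation_eq:
  assumes B: "B \<in> slice_sets"
  shows "deviation N m H B = t ^ (k - 1) * linear_form centred_degree B + remainder B -
    (measure_pmf.expectation (random_subset N m) (edge_count H) - t ^ k * total_weight H)"
proof -
  have "(\<Sum>x=1..N. centred t x B) = real (card B) - real N * t"
  proof -
    have "(\<Sum>x=1..N. of_bool (x \<in> B) :: real) = real (card {x \<in> {1..N}. x \<in> B})"
      by (simp add: of_bool_def sum.inter_filter[symmetric])
    also have "{x \<in> {1..N}. x \<in> B} = B" using B by auto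
    finally show ?thesis by (simp add: centred_def sum_subtractf)
  qed
  also have "\<dots> = 0" using B mt by simp
  finally have "linear_form centred_degree B = (\<Sum>x=1..N. vertex_degree H x * centred t x B)"
    by (simp add: linear_form_def centred_degree_def left_diff_distrib sum_subtractf sum_distrib_left[symmetric])
  then show ?thesis
    by (simp add: deviation_def remainder_def)
qed

text \<open>The sign sg covers both tails at once, as the centred degrees keep their sum 0 and their
  bounds under a change of sign. Off the event of a large remainder, the deviation differs from the
  linear part by at most 2 \<delta> a: one \<delta> a for the remainder and one for the
  mean.\<close>

lemma deviation_sandwich:
  assumes a: "0 < a" and \<delta>: "0 < \<delta>" "\<delta> \<le> 1 / 100" and km: "k \<le> m"
    and sg: "sg = 1 \<or> sg = (-1 :: real)"
    and mean: "C * (real k)\<^sup>2 * typical_degree \<le> \<delta> * a"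
    and X: "X = a\<^sup>2 / (2 * (1 - t) * t ^ (2 * k - 1) * degree_variance N H * real N)"
    and rem: "bernoulli_prob t N (\<lambda>B. \<delta> * a \<le> \<bar>remainder B\<bar>) \<le> 6 * (real N)\<^sup>2 * exp (- (2 * X))"
    and \<beta>: "256 * C\<^sup>2 * a \<le> \<delta>\<^sup>2 * (t * real N * typical_degree)"
    and log: "28 * real (N + 1) ^ 3 \<le> exp (\<delta>\<^sup>2 * X / 2)"
  shows "exp (- (1 + 17 * \<delta>) * X) \<le> measure_pmf.prob (random_subset N m) {B. a \<le> sg * deviation N m H B}"
    and "measure_pmf.prob (random_subset N m) {B. a \<le> sg * deviation N m H B} \<le> exp (- (1 - 17 * \<delta>) * X)"
proof -
  let ?M = "random_subset N m"
  let ?P = "measure_pmf.prob ?M"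
  define w where "w = (\<lambda>x. sg * centred_degree x)"
  define b where "b = C * real N ^ (r - 1)"
  define \<sigma> where "\<sigma> = degree_variance N H"
  define V where "V = t * (1 - t) * (\<Sum>x=1..N. (w x)\<^sup>2)"
  define s0 where "s0 = a / t ^ (k - 1)"
  define bad where "bad = 6 * real (N + 1) ^ 3 * exp (- (2 * X))"
  have N0: "0 < real N" using N_pos by simp
  have sg2: "sg * sg = 1" "\<bar>sg\<bar> = 1" using sg by auto
  have \<sigma>0: "0 < \<sigma>"
  proof -
    have "0 < real N ^ (2 * r - 2) / C" using N0 C by simp
    then show ?thesis using variance by (simp add: \<sigma>_def)
  qed
  have sumw2: "(\<Sum>x=1..N. (w x)\<^sup>2) = real N * \<sigma>"
    using sum_centred_degree_power2 sg2 by (simp add: w_def \<sigma>_def power_mult_distrib power2_eq_square[of sg])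
  have sumw: "(\<Sum>x=1..N. w x) = 0"
    using sum_centred_degree by (simp add: w_def sum_distrib_left[symmetric])
  have wb: "\<bar>w x\<bar> \<le> b" if "x \<in> {1..N}" for x
    using centred_degree_le[OF that] sg2 by (simp add: w_def b_def abs_mult)
  have V0: "0 < V" unfolding V_def sumw2 using t \<sigma>0 N0 t_half by simp
  have s00: "0 < s0" using a t by (simp add: s0_def)
  have b0: "0 \<le> b" using C by (simp add: b_def)
  have X_eq: "X = s0\<^sup>2 / (2 * V)"
  proof -
    have "2 * k - 1 = Suc ((k - 1) * 2)" using r by simp
    then have "t ^ (2 * k - 1) = t * (t ^ (k - 1))\<^sup>2" by (simp add: power_mult)
    then show ?thesis
      unfolding X V_def sumw2 s0_def \<sigma>_def[symmetric] by (simp add: power_divide mult_ac)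
  qed
  have X0: "0 < X" using s00 V0 by (simp add: X_eq)
  \<comment> \<open>The optimal tilt \<open>s0 / V\<close> times the bound for the coefficients; its
    smallness keeps the linear form in the Gaussian range. The 128 below is twice the 64 of
    \<open>linear_form_lower_tail\<close>, since the tilt is enlarged by \<kappa> \<le> 2, and 1 - t
    \<ge> 1/2 doubles it again to the 256 of the hypothesis.\<close>
  define \<beta>' where "\<beta>' = s0 * b / V"
  have \<beta>'0: "0 \<le> \<beta>'" using s00 b0 V0 by (simp add: \<beta>'_def)
  have \<beta>': "128 * \<beta>' \<le> \<delta>\<^sup>2"
  proof -
    have td0: "0 < typical_degree" using t N0 by (simp add: typical_degree_def)
    have p1: "real N ^ (2 * r - 2) = (real N ^ (r - 1))\<^sup>2"
    proof -
      have "2 * r - 2 = (r - 1) * 2" using r by simp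
      then show ?thesis by (simp only: power_mult)
    qed
    have V_ge: "t * (1 / 2) * (real N * ((real N ^ (r - 1))\<^sup>2 / C)) \<le> V"
      unfolding V_def sumw2
      using variance t_half t N0 C by (intro mult_mono) (auto simp: \<sigma>_def p1)
    have "128 * (s0 * b) * typical_degree = 128 * C * a * (real N ^ (r - 1))\<^sup>2"
      using t by (simp add: s0_def b_def typical_degree_def power2_eq_square)
    then have "128 * (s0 * b) * typical_degree * (2 * C) = 256 * C\<^sup>2 * a * (real N ^ (r - 1))\<^sup>2"
      by (simp add: power2_eq_square)
    also have "\<dots> \<le> \<delta>\<^sup>2 * (t * real N * typical_degree) * (real N ^ (r - 1))\<^sup>2"
      by (intro mult_right_mono \<beta>) auto
    also have "\<dots> = \<delta>\<^sup>2 * (t * (1 / 2) * (real N * ((real N ^ (r - 1))\<^sup>2 / C))) * typical_degree * (2 * C)"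
      using C by (simp add: field_simps)
    also have "\<dots> \<le> \<delta>\<^sup>2 * V * typical_degree * (2 * C)"
      using V_ge td0 C by (intro mult_right_mono mult_left_mono) auto
    finally have "128 * (s0 * b) \<le> \<delta>\<^sup>2 * V" using td0 C by (simp add: mult_ac)
    then show ?thesis using V0 by (simp add: \<beta>'_def field_simps)
  qed
  have \<delta>2: "\<delta>\<^sup>2 \<le> \<delta> / 100" "0 < \<delta>\<^sup>2" "\<delta>\<^sup>2 / 2 * X \<le> \<delta> * X"
  proof -
    show *: "\<delta>\<^sup>2 \<le> \<delta> / 100" using mult_left_mono[OF \<delta>(2), of \<delta>] \<delta>(1) by (simp add: power2_eq_square)
    show "0 < \<delta>\<^sup>2" using \<delta> by simp
    have "\<delta>\<^sup>2 / 2 \<le> \<delta>" using * \<delta>(1) by linarith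
    then show "\<delta>\<^sup>2 / 2 * X \<le> \<delta> * X" by (rule mult_right_mono) (use X0 in simp)
  qed
  have dev_split: "sg * deviation N m H B = t ^ (k - 1) * linear_form w B + sg * remainder B -
      sg * (measure_pmf.expectation ?M (edge_count H) - t ^ k * total_weight H)" if "B \<in> slice_sets" for B
  proof -
    have "linear_form w B = sg * linear_form centred_degree B"
      by (simp add: linear_form_def w_def sum_distrib_left mult.assoc)
    moreover have "sg * (p * L + R - E) = p * (sg * L) + sg * R - sg * E" for p L R E
      by (simp add: algebra_simps)
    ultimately show ?thesis by (simp only: deviation_eq[OF that])
  qed
  have mean': "\<bar>sg * (measure_pmf.expectation ?M (edge_count H) - t ^ k * total_weight H)\<bar> \<le> \<delta> * a"
    using mean_edge_count[OF km] mean sg2 by (simp add: abs_mult)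
  have rem_abs: "\<bar>sg * remainder B\<bar> = \<bar>remainder B\<bar>" for B using sg2 by (simp add: abs_mult)
  have lin_eq: "c * s0 * t ^ (k - 1) = c * a" for c using t by (simp add: s0_def)
  have tk: "0 < t ^ (k - 1)" using t by simp
  have P_restrict: "?P {B. Q B} \<le> ?P {B. Q' B}" if "\<And>B. B \<in> slice_sets \<Longrightarrow> Q B \<Longrightarrow> Q' B" for Q Q'
  proof -
    have "?P {B. Q B} = ?P ({B. Q B} \<inter> set_pmf ?M)" by (simp add: measure_Int_set_pmf)
    also have "\<dots> \<le> ?P {B. Q' B}"
      by (rule measure_pmf.finite_measure_mono) (use that in \<open>auto simp: set_random_subset\<close>)
    finally show ?thesis .
  qed
  have P_un: "?P {B. Q B \<or> Q' B} \<le> ?P {B. Q B} + ?P {B. Q' B}" for Q Q'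
    using measure_Un_le[of "{B. Q B}" "measure_pmf ?M" "{B. Q' B}"] by (simp add: Collect_disj_eq)
  have bad: "?P {B. \<delta> * a \<le> \<bar>remainder B\<bar>} \<le> bad"
  proof -
    have "?P {B. \<delta> * a \<le> \<bar>remainder B\<bar>} \<le> real (N + 1) * bernoulli_prob t N (\<lambda>B. \<delta> * a \<le> \<bar>remainder B\<bar>)"
      by (rule prob_slice_le)
    also have "\<dots> \<le> real (N + 1) * (6 * (real N)\<^sup>2 * exp (- (2 * X)))"
      by (intro mult_left_mono rem) auto
    also have "\<dots> \<le> real (N + 1) * (6 * (real (N + 1))\<^sup>2 * exp (- (2 * X)))"
      by (intro mult_left_mono mult_right_mono power_mono) auto
    finally show ?thesis by (simp add: bad_def power2_eq_square power3_eq_cube mult_ac)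
  qed
  show "?P {B. a \<le> sg * deviation N m H B} \<le> exp (- (1 - 17 * \<delta>) * X)"
  proof -
    define s where "s = (1 - 2 * \<delta>) * s0"
    define \<theta> where "\<theta> = s / V"
    have s: "0 \<le> s" "s \<le> s0" using \<delta> s00 by (auto simp: s_def mult_left_le_one_le)
    have \<theta>0: "0 \<le> \<theta>" using s V0 by (simp add: \<theta>_def)
    have "?P {B. a \<le> sg * deviation N m H B} \<le> ?P {B. s \<le> linear_form w B \<or> \<delta> * a \<le> \<bar>remainder B\<bar>}"
    proof (rule P_restrict)
      fix B assume B: "B \<in> slice_sets" and D: "a \<le> sg * deviation N m H B"
      show "s \<le> linear_form w B \<or> \<delta> * a \<le> \<bar>remainder B\<bar>"
      proof (rule disjCI)
        assume "\<not> \<delta> * a \<le> \<bar>remainder B\<bar>"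
        then have "a - \<delta> * a - \<delta> * a \<le> t ^ (k - 1) * linear_form w B"
          using D dev_split[OF B] mean' rem_abs[of B] by linarith
        also have "a - \<delta> * a - \<delta> * a = t ^ (k - 1) * s"
          using lin_eq[of "1 - 2 * \<delta>"] by (simp add: s_def algebra_simps)
        finally show "s \<le> linear_form w B" using tk by simp
      qed
    qed
    also have "\<dots> \<le> ?P {B. s \<le> linear_form w B} + ?P {B. \<delta> * a \<le> \<bar>remainder B\<bar>}" by (rule P_un)
    also have "?P {B. s \<le> linear_form w B} \<le> real (N + 1) * exp (- (1 - 5 * \<delta>) * X)"
    proof -
      have "?P {B. s \<le> linear_form w B} \<le> real (N + 1) * bernoulli_prob t N (\<lambda>B. s \<le> linear_form w B)"
        by (rule prob_slice_le)
      also have "bernoulli_prob t N (\<lambda>B. s \<le> linear_form w B) \<le> exp (- \<theta> * s + \<theta>\<^sup>2 / 2 * exp (\<theta> * b) * V)"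
      proof -
        have "linear_form w B = (\<Sum>x=1..N. centred t x B * w x)" for B
          by (simp add: linear_form_def mult.commute)
        then show ?thesis
          using freedman_tail[OF t01 \<theta>0, where G = "\<lambda>x B. w x" and n = N and s = s and b = b and V = V] wb
          by (simp add: V_def)
      qed
      also have "- \<theta> * s + \<theta>\<^sup>2 / 2 * exp (\<theta> * b) * V \<le> - (1 - 5 * \<delta>) * X"
      proof -
        have \<theta>b: "\<theta> * b \<le> \<beta>'" using s b0 V0 by (simp add: \<theta>_def \<beta>'_def divide_right_mono mult_right_mono)
        have \<beta>'1: "\<beta>' \<le> 1" using \<beta>' \<delta>2 \<delta> by linarith
        have "exp (\<theta> * b) \<le> exp \<beta>'" using \<theta>b by simp
        also have "\<dots> \<le> 1 + \<beta>' + \<beta>'\<^sup>2" by (rule exp_bound[OF \<beta>'0]) (rule \<beta>'1)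
        also have "\<beta>'\<^sup>2 \<le> \<beta>'" using mult_left_le[OF \<beta>'1 \<beta>'0] by (simp add: power2_eq_square)
        also have "1 + \<beta>' + \<beta>' \<le> 1 + \<delta>" using \<beta>' \<delta>2 \<delta> by linarith
        finally have e: "exp (\<theta> * b) \<le> 1 + \<delta>" by simp
        have "- \<theta> * s + \<theta>\<^sup>2 / 2 * exp (\<theta> * b) * V \<le> - \<theta> * s + \<theta>\<^sup>2 / 2 * (1 + \<delta>) * V"
          using e V0 by (intro add_left_mono mult_right_mono mult_left_mono) auto
        also have "\<dots> = - ((1 - \<delta>) * (1 - 2 * \<delta>)\<^sup>2 * X)"
          using V0 by (simp add: \<theta>_def s_def X_eq field_simps power2_eq_square)
        also have "\<dots> \<le> - (1 - 5 * \<delta>) * X"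
        proof -
          have "(1 - \<delta>) * (1 - 2 * \<delta>)\<^sup>2 = 1 - 5 * \<delta> + 4 * \<delta>\<^sup>2 * (2 - \<delta>)"
            by (simp add: power2_eq_square algebra_simps)
          moreover have "0 \<le> 4 * \<delta>\<^sup>2 * (2 - \<delta>)" using \<delta> by simp
          ultimately have "1 - 5 * \<delta> \<le> (1 - \<delta>) * (1 - 2 * \<delta>)\<^sup>2" by simp
          then have "(1 - 5 * \<delta>) * X \<le> (1 - \<delta>) * (1 - 2 * \<delta>)\<^sup>2 * X" using X0 by (intro mult_right_mono) auto
          then show ?thesis by (simp only: mult_minus_left neg_le_iff_le)
        qed
        finally show ?thesis .
      qed
      finally show ?thesis by simp
    qed
    also note bad
    also have "real (N + 1) * exp (- (1 - 5 * \<delta>) * X) + bad \<le> exp (\<delta> * X) * exp (- (1 - 5 * \<delta>) * X)"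
    proof -
      have "exp (- (2 * X)) \<le> exp (- (1 - 5 * \<delta>) * X)"
        unfolding exp_le_cancel_iff using mult_right_mono[of "-2" "- (1 - 5 * \<delta>)" X] X0 \<delta> by simp
      then have "bad \<le> 6 * real (N + 1) ^ 3 * exp (- (1 - 5 * \<delta>) * X)"
        unfolding bad_def by (intro mult_left_mono) auto
      moreover have "real (N + 1) * exp (- (1 - 5 * \<delta>) * X) \<le> real (N + 1) ^ 3 * exp (- (1 - 5 * \<delta>) * X)"
        using self_le_power[of "real (N + 1)" 3] by (intro mult_right_mono) auto
      moreover have "7 * real (N + 1) ^ 3 * exp (- (1 - 5 * \<delta>) * X) \<le> exp (\<delta> * X) * exp (- (1 - 5 * \<delta>) * X)"
      proof (rule mult_right_mono)
        have "7 * real (N + 1) ^ 3 \<le> 28 * real (N + 1) ^ 3" by simp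
        also note log
        also have "exp (\<delta>\<^sup>2 * X / 2) \<le> exp (\<delta> * X)" using \<delta>2(3) by simp
        finally show "7 * real (N + 1) ^ 3 \<le> exp (\<delta> * X)" .
      qed simp
      ultimately show ?thesis by linarith
    qed
    also have "\<dots> = exp (- (1 - 6 * \<delta>) * X)"
      unfolding exp_add[symmetric] by (simp add: algebra_simps)
    also have "\<dots> \<le> exp (- (1 - 17 * \<delta>) * X)"
      unfolding exp_le_cancel_iff using X0 \<delta> by (intro mult_right_mono) auto
    finally show ?thesis by simp
  qed
  show "exp (- (1 + 17 * \<delta>) * X) \<le> ?P {B. a \<le> sg * deviation N m H B}"
  proof -
    \<comment> \<open>1 + 2 \<delta> pays for the mean and the remainder, 1 / (1 - \<delta>) for the
      lower end of the window of the tilted law. The square of \<kappa> times 1 + 3 \<delta> stays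
      below 1 + 16 \<delta>; the last \<delta> of the 17 absorbs the factor 2 lost to
      \<open>bad\<close>.\<close>
    define \<kappa> where "\<kappa> = (1 + 2 * \<delta>) / (1 - \<delta>)"
    define \<theta> where "\<theta> = \<kappa> * s0 / V"
    define Y where "Y = \<theta>\<^sup>2 * V / 2"
    have \<kappa>: "1 \<le> \<kappa>" "\<kappa> \<le> 1 + 4 * \<delta>"
    proof -
      show "1 \<le> \<kappa>" using \<delta> by (simp add: \<kappa>_def field_simps)
      have "(1 + 4 * \<delta>) * (1 - \<delta>) = 1 + 3 * \<delta> - 4 * \<delta>\<^sup>2"
        by (simp add: algebra_simps power2_eq_square)
      then have "1 + 2 * \<delta> \<le> (1 + 4 * \<delta>) * (1 - \<delta>)" using \<delta>2(1) \<delta>(1) by linarith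
      then show "\<kappa> \<le> 1 + 4 * \<delta>" using \<delta> by (simp add: \<kappa>_def divide_le_eq)
    qed
    have Y_eq: "Y = \<kappa>\<^sup>2 * X" using V0 by (simp add: Y_def \<theta>_def X_eq power2_eq_square field_simps)
    have XY: "X \<le> Y" unfolding Y_eq using \<kappa> X0 by (simp add: mult_le_cancel_right1)
    have YX: "(1 + 3 * \<delta>) * Y \<le> (1 + 16 * \<delta>) * X"
    proof -
      have "\<kappa>\<^sup>2 \<le> (1 + 4 * \<delta>)\<^sup>2" using \<kappa> by (intro power_mono) auto
      also have "\<dots> = 1 + 8 * \<delta> + 16 * \<delta>\<^sup>2" by (simp add: power2_eq_square algebra_simps)
      also have "\<dots> \<le> 1 + 9 * \<delta>" using \<delta>2(1) \<delta>(1) by linarith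
      finally have "(1 + 3 * \<delta>) * \<kappa>\<^sup>2 \<le> (1 + 3 * \<delta>) * (1 + 9 * \<delta>)" using \<delta> by (intro mult_left_mono) auto
      also have "\<dots> = 1 + 12 * \<delta> + 27 * \<delta>\<^sup>2" by (simp add: power2_eq_square algebra_simps)
      also have "\<dots> \<le> 1 + 16 * \<delta>" using \<delta>2(1) \<delta>(1) by linarith
      finally have "((1 + 3 * \<delta>) * \<kappa>\<^sup>2) * X \<le> (1 + 16 * \<delta>) * X" using X0 by (intro mult_right_mono) auto
      then show ?thesis by (simp add: Y_eq mult.assoc)
    qed
    have \<theta>0: "0 \<le> \<theta>" using \<kappa> s00 V0 by (simp add: \<theta>_def)
    have \<theta>V: "(1 - \<delta>) * (\<theta> * V) = (1 + 2 * \<delta>) * s0"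
      using V0 \<delta> by (simp add: \<theta>_def \<kappa>_def)
    have "exp (- (1 + 3 * \<delta>) * Y) \<le> ?P {B. (1 - \<delta>) * (\<theta> * V) \<le> linear_form w B}"
    proof (rule linear_form_lower_tail[OF wb sumw V_def \<theta>0 \<delta>(1) _ _ Y_def])
      show "\<delta> \<le> 1" using \<delta> by simp
      have "64 * (\<theta> * b) = \<kappa> * (64 * \<beta>')" by (simp add: \<theta>_def \<beta>'_def)
      also have "\<dots> \<le> 2 * (64 * \<beta>')" using \<kappa> \<delta> \<beta>'0 by (intro mult_right_mono) auto
      finally show "64 * (\<theta> * b) \<le> \<delta>\<^sup>2" using \<beta>' by simp
      have "4 * (real (N + 1))\<^sup>2 \<le> 28 * real (N + 1) ^ 3"
        by (intro mult_mono power_increasing) auto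
      also note log
      also have "exp (\<delta>\<^sup>2 * X / 2) \<le> exp (Y * \<delta>\<^sup>2 / 2)" using XY \<delta>2 by (simp add: mult.commute)
      finally show "4 * (real (N + 1))\<^sup>2 \<le> exp (Y * \<delta>\<^sup>2 / 2)" .
    qed
    then have lin: "exp (- (1 + 16 * \<delta>) * X) \<le> ?P {B. (1 + 2 * \<delta>) * s0 \<le> linear_form w B}"
      unfolding \<theta>V using YX by (smt (verit) exp_le_cancel_iff minus_mult_left)
    also have "\<dots> \<le> ?P {B. a \<le> sg * deviation N m H B \<or> \<delta> * a \<le> \<bar>remainder B\<bar>}"
    proof (rule P_restrict)
      fix B assume B: "B \<in> slice_sets" and L: "(1 + 2 * \<delta>) * s0 \<le> linear_form w B"
      show "a \<le> sg * deviation N m H B \<or> \<delta> * a \<le> \<bar>remainder B\<bar>"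
      proof (rule disjCI)
        assume nr: "\<not> \<delta> * a \<le> \<bar>remainder B\<bar>"
        have "(1 + 2 * \<delta>) * a \<le> t ^ (k - 1) * linear_form w B"
        proof -
          have "(1 + 2 * \<delta>) * a = t ^ (k - 1) * ((1 + 2 * \<delta>) * s0)"
            using lin_eq[of "1 + 2 * \<delta>"] by (metis mult.commute)
          also have "\<dots> \<le> t ^ (k - 1) * linear_form w B"
            using L tk by (intro mult_left_mono) auto
          finally show ?thesis .
        qed
        moreover have "(1 + 2 * \<delta>) * a = a + \<delta> * a + \<delta> * a" by (simp add: algebra_simps)
        ultimately show "a \<le> sg * deviation N m H B"
          using nr dev_split[OF B] mean' rem_abs[of B] by linarith
      qed
    qed
    also have "\<dots> \<le> ?P {B. a \<le> sg * deviation N m H B} + ?P {B. \<delta> * a \<le> \<bar>remainder B\<bar>}" by (rule P_un)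
    also note bad
    finally have main: "exp (- (1 + 16 * \<delta>) * X) \<le> ?P {B. a \<le> sg * deviation N m H B} + bad" by simp
    \<comment> \<open>As 17 \<delta> \<le> 1, the exponent -2 X of the remainder event is negligible
      even against the lower bound.\<close>
    have "2 * bad \<le> exp (- (1 + 16 * \<delta>) * X)"
    proof -
      have "12 * real (N + 1) ^ 3 \<le> 28 * real (N + 1) ^ 3" by simp
      also note log
      also have "exp (\<delta>\<^sup>2 * X / 2) \<le> exp (\<delta> * X)" using \<delta>2(3) by simp
      finally have "2 * bad \<le> exp (\<delta> * X) * exp (- (2 * X))"
        unfolding bad_def by (simp add: mult_right_mono)
      also have "\<dots> = exp ((\<delta> - 2) * X)" unfolding exp_add[symmetric] by (simp add: algebra_simps)
      also have "\<dots> \<le> exp (- (1 + 16 * \<delta>) * X)"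
        unfolding exp_le_cancel_iff using X0 \<delta> by (intro mult_right_mono) auto
      finally show ?thesis .
    qed
    then have half: "exp (- (1 + 16 * \<delta>) * X) \<le> 2 * ?P {B. a \<le> sg * deviation N m H B}"
      using main by simp
    have "2 \<le> exp (\<delta> * X)"
    proof -
      have "1 \<le> real (N + 1) ^ 3" by (rule one_le_power) simp
      then have "2 \<le> 28 * real (N + 1) ^ 3" by linarith
      also note log
      also have "exp (\<delta>\<^sup>2 * X / 2) \<le> exp (\<delta> * X)" using \<delta>2(3) by simp
      finally show ?thesis .
    qed
    then have "2 * exp (- (1 + 17 * \<delta>) * X) \<le> exp (\<delta> * X) * exp (- (1 + 17 * \<delta>) * X)"
      by (intro mult_right_mono) auto
    also have "\<dots> = exp (- (1 + 16 * \<delta>) * X)" unfolding exp_add[symmetric] by (simp add: algebra_simps)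
    also note half
    finally show ?thesis by simp
  qed
qed

text \<open>The two-sided bounds on the variance and on 1 - t give \<rho> / (2 C^2) \<le> X \<le> C
  \<rho>. Hence \<open>remainder_bound\<close> with K = 2 C yields an error of order
  \<open>exp (- (2 * X))\<close>, and all largeness conditions can be put on \<rho>, which does not
  involve the variance.\<close>

lemma deviation_bounds:
  assumes a: "0 < a" "a\<^sup>2 = \<rho> * (t * real N) * typical_degree\<^sup>2" and \<delta>: "0 < \<delta>" "\<delta> \<le> 1 / 100"
    and sg: "sg = 1 \<or> sg = (-1 :: real)"
    and \<epsilon>: "0 \<le> \<epsilon>" "\<epsilon> \<le> 1" "27 * C\<^sup>2 * (real r)\<^sup>2 * \<epsilon> \<le> (\<delta>\<^sup>2 / (6 * (2 * C)))\<^sup>2"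
      "\<epsilon> \<le> (\<delta>\<^sup>2 / (256 * C\<^sup>2))\<^sup>2"
    and u: "(2 * real k * (2 * C * \<rho>)) ^ (r - 1) \<le> \<epsilon> ^ (r - 1) * typical_degree"
    and large: "C * (real k)\<^sup>2 \<le> \<delta> * \<rho>"
    and log: "28 * real (N + 1) ^ 3 \<le> exp (\<delta>\<^sup>2 * (\<rho> / (2 * C\<^sup>2)) / 2)"
    and X: "X = a\<^sup>2 / (2 * (1 - t) * t ^ (2 * k - 1) * degree_variance N H * real N)"
  shows "0 < X"
    and "exp (- (1 + 17 * \<delta>) * X) \<le> measure_pmf.prob (random_subset N m) {B. a \<le> sg * deviation N m H B}"
    and "measure_pmf.prob (random_subset N m) {B. a \<le> sg * deviation N m H B} \<le> exp (- (1 - 17 * \<delta>) * X)"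
proof -
  define \<sigma> where "\<sigma> = degree_variance N H"
  define D where "D = real N ^ (2 * r - 2)"
  have N0: "0 < real N" using N_pos by simp
  have td0: "0 < typical_degree" using t N0 by (simp add: typical_degree_def)
  have D0: "0 < D" using N0 by (simp add: D_def)
  have k1: "1 \<le> real k" using r by simp
  have \<sigma>: "D / C \<le> \<sigma>" "\<sigma> \<le> C\<^sup>2 * D" using variance variance_le by (simp_all add: \<sigma>_def D_def)
  have \<sigma>0: "0 < \<sigma>" using \<sigma>(1) D0 C by (metis divide_pos_pos less_le_trans)
  have k\<rho>: "real k \<le> \<rho>" and \<rho>1: "1 \<le> \<rho>"
  proof -
    have \<rho>0: "0 < \<delta> * \<rho>"
    proof -
      have "0 < C * (real k)\<^sup>2" using C k1 by simp
      then show ?thesis using large by linarith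
    qed
    then have \<rho>0: "0 < \<rho>" using \<delta> by (simp add: zero_less_mult_iff)
    have "1 * real k * 1 \<le> C * real k * real k"
      using C_ge_1 k1 by (intro mult_mono) auto
    also have "\<dots> \<le> \<delta> * \<rho>" using large by (simp add: power2_eq_square mult.assoc)
    also have "\<dots> \<le> \<rho>" using \<delta> \<rho>0 by (simp add: mult_left_le_one_le)
    finally show "real k \<le> \<rho>" by simp
    then show "1 \<le> \<rho>" using k1 by linarith
  qed
  have \<rho>t: "\<rho> \<le> \<epsilon> * (t * real N)"
  proof -
    have "1 * \<rho> \<le> (4 * real k * C) * \<rho>"
      using \<rho>1 mult_mono[of 1 "4 * real k" 1 C] k1 C_ge_1 by (intro mult_right_mono) auto
    also have "\<dots> = 2 * real k * (2 * C * \<rho>)" by simp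
    also have "\<dots> \<le> \<epsilon> * (t * real N)"
      by (rule small_exponent_bound) (use u \<epsilon> \<rho>1 C in auto)
    finally show ?thesis by simp
  qed
  have \<rho>m: "\<rho> \<le> t * real N"
    using \<rho>t \<epsilon> t by (smt (verit) N0 mult_left_le_one_le mult_pos_pos)
  have km: "k \<le> m" using k\<rho> \<rho>m mt by linarith
  have \<rho>a: "\<rho> * typical_degree \<le> a"
  proof (rule power2_le_imp_le)
    have "(\<rho> * typical_degree)\<^sup>2 = \<rho> * \<rho> * typical_degree\<^sup>2" by (simp add: power2_eq_square mult_ac)
    also have "\<dots> \<le> a\<^sup>2" unfolding a(2) using \<rho>1 \<rho>m by (intro mult_right_mono mult_left_mono) auto
    finally show "(\<rho> * typical_degree)\<^sup>2 \<le> a\<^sup>2" .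
  qed (use a in simp)
  have X_eq: "X = \<rho> * D / (2 * (1 - t) * \<sigma>)"
  proof -
    have "2 * k - 1 = Suc ((k - 1) * 2)" "2 * r - 2 = (r - 1) * 2" using r by simp_all
    then have "typical_degree\<^sup>2 * t = t ^ (2 * k - 1) * D"
      by (simp add: typical_degree_def D_def power_mult_distrib power_mult)
    then have "a\<^sup>2 = \<rho> * D * (t ^ (2 * k - 1) * real N)"
      unfolding a(2) by (metis (no_types, opaque_lifting) mult.assoc mult.commute)
    then have "X = (\<rho> * D * (t ^ (2 * k - 1) * real N)) / ((2 * (1 - t) * \<sigma>) * (t ^ (2 * k - 1) * real N))"
      unfolding X \<sigma>_def by (simp add: mult_ac)
    also have "\<dots> = \<rho> * D / (2 * (1 - t) * \<sigma>)"
      by (rule mult_divide_mult_cancel_right) (use t N0 in simp)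
    finally show ?thesis .
  qed
  have den: "D / C \<le> 2 * (1 - t) * \<sigma>" "2 * (1 - t) * \<sigma> \<le> 2 * C\<^sup>2 * D"
  proof -
    have "1 * \<sigma> \<le> 2 * (1 - t) * \<sigma>" using t_half \<sigma>0 by (intro mult_right_mono) auto
    then show "D / C \<le> 2 * (1 - t) * \<sigma>" using \<sigma>(1) by simp
    have "2 * (1 - t) * \<sigma> \<le> 2 * (C\<^sup>2 * D)" using t \<sigma> \<sigma>0 by (intro mult_mono) auto
    then show "2 * (1 - t) * \<sigma> \<le> 2 * C\<^sup>2 * D" by simp
  qed
  have den0: "0 < 2 * (1 - t) * \<sigma>" using t_half \<sigma>0 by simp
  have \<rho>D0: "0 < \<rho> * D" using \<rho>1 D0 by simp
  show "0 < X" unfolding X_eq using \<rho>D0 den0 by simp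
  have X_le: "X \<le> C * \<rho>"
  proof -
    have "X \<le> \<rho> * D / (D / C)"
      unfolding X_eq using den D0 C \<rho>D0 den0 by (intro divide_left_mono) auto
    then show ?thesis using D0 C by (simp add: mult.commute)
  qed
  have X_ge: "\<rho> / (2 * C\<^sup>2) \<le> X"
  proof -
    have "\<rho> * D / (2 * C\<^sup>2 * D) \<le> X"
      unfolding X_eq using den D0 C \<rho>D0 den0 by (intro divide_left_mono) auto
    then show ?thesis using D0 by simp
  qed
  have mean: "C * (real k)\<^sup>2 * typical_degree \<le> \<delta> * a"
  proof -
    have "C * (real k)\<^sup>2 * typical_degree \<le> \<delta> * \<rho> * typical_degree"
      using large td0 by (intro mult_right_mono) auto
    also have "\<dots> = \<delta> * (\<rho> * typical_degree)" by simp
    also have "\<dots> \<le> \<delta> * a" using \<rho>a \<delta> by (intro mult_left_mono) auto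
    finally show ?thesis .
  qed
  have rem: "bernoulli_prob t N (\<lambda>B. \<delta> * a \<le> \<bar>remainder B\<bar>) \<le> 6 * (real N)\<^sup>2 * exp (- (2 * X))"
  proof -
    have "bernoulli_prob t N (\<lambda>B. \<delta> * a \<le> \<bar>remainder B\<bar>) \<le> 6 * (real N)\<^sup>2 * exp (- (2 * C * \<rho>))"
      by (rule remainder_bound[OF N_pos _ \<rho>1 \<delta>(1) _ \<epsilon>(1,2) a \<epsilon>(3) u]) (use C_ge_1 \<delta> in auto)
    also have "\<dots> \<le> 6 * (real N)\<^sup>2 * exp (- (2 * X))"
      using X_le by (intro mult_left_mono) auto
    finally show ?thesis .
  qed
  \<comment> \<open>The ratio of a to t N times the typical degree is the square root of \<rho> / (t
    N), hence at most the square root of \<epsilon>.\<close>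
  have \<beta>: "256 * C\<^sup>2 * a \<le> \<delta>\<^sup>2 * (t * real N * typical_degree)"
  proof (rule power2_le_imp_le)
    have tN0: "0 < t * real N" using t N0 by simp
    have "\<rho> \<le> (\<delta>\<^sup>2 / (256 * C\<^sup>2))\<^sup>2 * (t * real N)"
      using \<rho>t mult_right_mono[OF \<epsilon>(4), of "t * real N"] tN0 by simp
    then have "(256 * C\<^sup>2)\<^sup>2 * \<rho> \<le> (256 * C\<^sup>2)\<^sup>2 * ((\<delta>\<^sup>2 / (256 * C\<^sup>2))\<^sup>2 * (t * real N))"
      by (intro mult_left_mono) auto
    also have "\<dots> = (\<delta>\<^sup>2)\<^sup>2 * (t * real N)"
      using C by (simp add: power_divide)
    finally have *: "(256 * C\<^sup>2)\<^sup>2 * \<rho> \<le> (\<delta>\<^sup>2)\<^sup>2 * (t * real N)" .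
    have "(256 * C\<^sup>2 * a)\<^sup>2 = (256 * C\<^sup>2)\<^sup>2 * \<rho> * ((t * real N) * typical_degree\<^sup>2)"
      by (simp add: power_mult_distrib a(2))
    also have "\<dots> \<le> (\<delta>\<^sup>2)\<^sup>2 * (t * real N) * ((t * real N) * typical_degree\<^sup>2)"
      using * tN0 by (intro mult_right_mono) auto
    also have "\<dots> = (\<delta>\<^sup>2 * (t * real N * typical_degree))\<^sup>2"
      by (simp add: power2_eq_square)
    finally show "(256 * C\<^sup>2 * a)\<^sup>2 \<le> (\<delta>\<^sup>2 * (t * real N * typical_degree))\<^sup>2" .
  qed (use t td0 in simp)
  have log': "28 * real (N + 1) ^ 3 \<le> exp (\<delta>\<^sup>2 * X / 2)"
  proof -
    have "\<delta>\<^sup>2 * (\<rho> / (2 * C\<^sup>2)) / 2 \<le> \<delta>\<^sup>2 * X / 2"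
      by (intro divide_right_mono mult_left_mono X_ge) auto
    then show ?thesis using log by (meson exp_le_cancel_iff order_trans)
  qed
  note sandwich = deviation_sandwich[OF a(1) \<delta> km sg mean X rem \<beta> log']
  show "exp (- (1 + 17 * \<delta>) * X) \<le> measure_pmf.prob (random_subset N m) {B. a \<le> sg * deviation N m H B}"
    by (rule sandwich(1))
  show "measure_pmf.prob (random_subset N m) {B. a \<le> sg * deviation N m H B} \<le> exp (- (1 - 17 * \<delta>) * X)"
    by (rule sandwich(2))
qed

end

section \<open>From bounds for fixed N to the asymptotic formula\<close>

lemma exp_rate_of_sandwich:
  fixes P X :: "nat \<Rightarrow> real"
  assumes "\<And>\<delta>. 0 < \<delta> \<Longrightarrow> \<delta> \<le> 1 / 100 \<Longrightarrow> \<forall>\<^sub>F N in sequentially. 0 < X N \<and>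
      exp (- (1 + 17 * \<delta>) * X N) \<le> P N \<and> P N \<le> exp (- (1 - 17 * \<delta>) * X N)"
  shows "\<exists>\<epsilon>. \<epsilon> \<longlonglongrightarrow> 0 \<and> (\<forall>\<^sub>F N in sequentially. P N = exp (- (1 + \<epsilon> N) * X N))"
proof (intro exI conjI)
  \<comment> \<open>The value forced by the formula; the sandwich with \<delta> = 1/100 makes the
    logarithm meaningful for large N.\<close>
  define \<epsilon> where "\<epsilon> = (\<lambda>N. - ln (P N) / X N - 1)"
  show "\<forall>\<^sub>F N in sequentially. P N = exp (- (1 + \<epsilon> N) * X N)"
  proof (rule eventually_mono)
    show "\<forall>\<^sub>F N in sequentially. 0 < X N \<and>
      exp (- (1 + 17 * (1 / 100)) * X N) \<le> P N \<and> P N \<le> exp (- (1 - 17 * (1 / 100)) * X N)"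
      by (rule assms) auto
    fix N
    assume *: "0 < X N \<and> exp (- (1 + 17 * (1 / 100)) * X N) \<le> P N \<and> P N \<le> exp (- (1 - 17 * (1 / 100)) * X N)"
    then have "0 < P N" using exp_gt_zero less_le_trans by blast
    then show "P N = exp (- (1 + \<epsilon> N) * X N)" using * by (simp add: \<epsilon>_def)
  qed
  show "\<epsilon> \<longlonglongrightarrow> 0"
  proof (rule LIMSEQ_I)
    fix e :: real assume e: "0 < e"
    define \<delta> where "\<delta> = min (1 / 100) (e / 18)"
    have \<delta>: "0 < \<delta>" "\<delta> \<le> 1 / 100" "17 * \<delta> < e" using e by (auto simp: \<delta>_def min_def)
    have "\<forall>\<^sub>F N in sequentially. norm (\<epsilon> N - 0) < e"
      using assms[OF \<delta>(1,2)]
    proof eventually_elim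
      fix N
      assume *: "0 < X N \<and> exp (- (1 + 17 * \<delta>) * X N) \<le> P N \<and> P N \<le> exp (- (1 - 17 * \<delta>) * X N)"
      then have P0: "0 < P N" using exp_gt_zero less_le_trans by blast
      have bounds: "- (1 + 17 * \<delta>) * X N \<le> ln (P N)" "ln (P N) \<le> - (1 - 17 * \<delta>) * X N"
      proof -
        show "- (1 + 17 * \<delta>) * X N \<le> ln (P N)" using * P0 by (simp add: ln_ge_iff)
        have "ln (P N) \<le> ln (exp (- (1 - 17 * \<delta>) * X N))" using * P0 by (subst ln_le_cancel_iff) auto
        then show "ln (P N) \<le> - (1 - 17 * \<delta>) * X N" by simp
      qed
      then have "- ln (P N) / X N \<le> 1 + 17 * \<delta>" "1 - 17 * \<delta> \<le> - ln (P N) / X N"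
      proof -
        have X0: "0 < X N" using * by simp
        show "- ln (P N) / X N \<le> 1 + 17 * \<delta>"
          unfolding pos_divide_le_eq[OF X0] using bounds(1) by linarith
        show "1 - 17 * \<delta> \<le> - ln (P N) / X N"
          unfolding pos_le_divide_eq[OF X0] using bounds(2) by linarith
      qed
      then show "norm (\<epsilon> N - 0) < e" using \<delta>(3) by (simp add: \<epsilon>_def abs_if)
    qed
    then show "\<exists>no. \<forall>n\<ge>no. norm (\<epsilon> n - 0) < e" by (simp add: eventually_sequentially)
  qed
qed

text \<open>\<open>\<rho>\<close> is the rate \<open>a\<^sup>2 / (t\<^bsup>2k-1\<^esup> N\<^bsup>2r-1\<^esup>)\<close>, which has the order of the exponent. The upper
  hypothesis on \<open>a\<close> says precisely that \<open>\<rho>\<^bsup>r-1\<^esup>\<close> is small compared with \<open>t\<^bsup>k-1\<^esup> N\<^bsup>r-1\<^esup>\<close>.\<close>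

lemma deviation_rate_identities:
  fixes a t :: real and N k r :: nat
  assumes t: "0 < t" and N: "1 < N" and a: "0 < a" and r: "2 \<le> r" "r \<le> k"
  defines "\<rho> \<equiv> a\<^sup>2 / (t ^ (2 * k - 1) * real N ^ (2 * r - 1))"
  shows "(t powr (real k - 1/2) * real N powr (real r - 1/2) * sqrt (ln (real N)) / a)\<^sup>2 = ln (real N) / \<rho>"
    and "\<rho> ^ (r - 1) = ((a / (t powr (real k - 1/2 + (real k - 1) / (2 * (real r - 1))) * real N ^ r))\<^sup>2) ^ (r - 1)
           * (t ^ (k - 1) * real N ^ (r - 1))"
proof -
  have N0: "0 < real N" using N by simp
  have powr2: "(x powr e)\<^sup>2 = x powr (2 * e)" for x e :: real
    by (simp add: power2_eq_square powr_add[symmetric])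
  have tk: "t powr (2 * real k - 1) = t ^ (2 * k - 1)"
    using t r by (subst powr_realpow[symmetric]) (auto simp: of_nat_diff)
  have Nr: "real N powr (2 * real r - 1) = real N ^ (2 * r - 1)"
    using N0 r by (subst powr_realpow[symmetric]) (auto simp: of_nat_diff)
  have "(t powr (real k - 1/2) * real N powr (real r - 1/2) * sqrt (ln (real N)) / a)\<^sup>2 =
      t ^ (2 * k - 1) * real N ^ (2 * r - 1) * ln (real N) / a\<^sup>2"
    using N by (simp add: power_divide power_mult_distrib powr2 right_diff_distrib tk Nr)
  then show "(t powr (real k - 1/2) * real N powr (real r - 1/2) * sqrt (ln (real N)) / a)\<^sup>2 = ln (real N) / \<rho>"
    by (simp add: \<rho>_def mult_ac)
  define q where "q = (real k - 1) / (real r - 1)"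
  let ?\<alpha> = "a / (t powr (real k - 1/2 + (real k - 1) / (2 * (real r - 1))) * real N ^ r)"
  have "2 * (real k - 1/2 + (real k - 1) / (2 * (real r - 1))) = (2 * real k - 1) + q"
    using r by (simp add: q_def field_simps)
  then have "(t powr (real k - 1/2 + (real k - 1) / (2 * (real r - 1))))\<^sup>2 = t ^ (2 * k - 1) * t powr q"
    unfolding powr2 by (simp add: powr_add tk)
  moreover have "(real N ^ r)\<^sup>2 = real N ^ (2 * r - 1) * real N"
  proof -
    have "r * 2 = Suc (2 * r - 1)" using r by simp
    then show ?thesis by (metis power_Suc2 power_mult)
  qed
  ultimately have "?\<alpha>\<^sup>2 = a\<^sup>2 / (t ^ (2 * k - 1) * t powr q * (real N ^ (2 * r - 1) * real N))"
    by (simp add: power_divide power_mult_distrib)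
  then have "\<rho> = ?\<alpha>\<^sup>2 * (t powr q * real N)"
    using t N0 by (simp add: \<rho>_def)
  moreover have "(t powr q) ^ (r - 1) = t ^ (k - 1)"
  proof -
    have "(t powr q) ^ (r - 1) = t powr (q * real (r - 1))"
      using t by (simp add: powr_powr[symmetric] powr_realpow)
    also have "q * real (r - 1) = real (k - 1)" using r by (simp add: q_def of_nat_diff)
    also have "t powr real (k - 1) = t ^ (k - 1)" using t by (rule powr_realpow)
    finally show ?thesis .
  qed
  ultimately show "\<rho> ^ (r - 1) = (?\<alpha>\<^sup>2) ^ (r - 1) * (t ^ (k - 1) * real N ^ (r - 1))"
    by (simp only: power_mult_distrib)
qed

theorem theorem1p2:
  fixes r k C :: nat
    and H :: "nat \<Rightarrow> whypergraph"
    and m :: "nat \<Rightarrow> nat"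
    and t a :: "nat \<Rightarrow> real"
  assumes "2 \<le> r" and "r \<le> k" and "1 \<le> C"
    and "\<forall>\<^sub>F N in sequentially. uniform_whypergraph k N (H N)"
    and "\<forall>\<^sub>F N in sequentially. max_degree r N (H N) \<le> real C"
    and "\<forall>\<^sub>F N in sequentially. degree_variance N (H N) \<ge> real N ^ (2 * r - 2) / real C"
    and "\<forall>\<^sub>F N in sequentially. m N > 0"
    and "\<And>N. t N = real (m N) / real N"
    and "\<forall>\<^sub>F N in sequentially. t N \<le> 1 / 2"
    and "\<forall>\<^sub>F N in sequentially. a N > 0"
    and "(\<lambda>N. (t N powr (real k - 1/2) * real N powr (real r - 1/2) * sqrt (ln (real N))) / a N)
           \<longlonglongrightarrow> 0"
    and "(\<lambda>N. a N /
            (t N powr (real k - 1/2 + (real k - 1) / (2 * (real r - 1))) * real N ^ r))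
           \<longlonglongrightarrow> 0"
  shows "(\<exists>\<epsilon> :: nat \<Rightarrow> real. \<epsilon> \<longlonglongrightarrow> 0 \<and>
            (\<forall>\<^sub>F N in sequentially.
               measure_pmf.prob (random_subset N (m N)) {B. deviation N (m N) (H N) B \<ge> a N} =
               exp (- (1 + \<epsilon> N) * (a N)\<^sup>2 /
                      (2 * (1 - t N) * t N ^ (2 * k - 1) * degree_variance N (H N) * real N)))) \<and>
         (\<exists>\<epsilon> :: nat \<Rightarrow> real. \<epsilon> \<longlonglongrightarrow> 0 \<and>
            (\<forall>\<^sub>F N in sequentially.
               measure_pmf.prob (random_subset N (m N)) {B. deviation N (m N) (H N) B \<le> - a N} =
               exp (- (1 + \<epsilon> N) * (a N)\<^sup>2 /
                      (2 * (1 - t N) * t N ^ (2 * k - 1) * degree_variance N (H N) * real N))))"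
proof -
  note r = assms(1,2)
  define \<rho> where "\<rho> N = (a N)\<^sup>2 / (t N ^ (2 * k - 1) * real N ^ (2 * r - 1))" for N
  define \<alpha> where "\<alpha> N = a N / (t N powr (real k - 1/2 + (real k - 1) / (2 * (real r - 1))) * real N ^ r)" for N
  define X where "X N = (a N)\<^sup>2 / (2 * (1 - t N) * t N ^ (2 * k - 1) * degree_variance N (H N) * real N)" for N
  have C1: "1 \<le> real C" using assms(3) by simp
  have k1: "1 \<le> real k" using r by simp
  have large_N: "\<forall>\<^sub>F N in sequentially. n \<le> N" for n :: nat by (rule eventually_ge_at_top)
  have t_pos: "\<forall>\<^sub>F N in sequentially. 0 < t N"
    using assms(7) large_N[of 1] by eventually_elim (simp add: assms(8))
  \<comment> \<open>The lower hypothesis on a, squared: log N / \<rho> tends to 0.\<close>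
  have ln_small: "\<forall>\<^sub>F N in sequentially. ln (real N) \<le> c * \<rho> N" if c: "0 < c" for c
  proof -
    have "(\<lambda>N. (t N powr (real k - 1/2) * real N powr (real r - 1/2) * sqrt (ln (real N)) / a N)\<^sup>2) \<longlonglongrightarrow> 0\<^sup>2"
      by (intro tendsto_power assms(11))
    then have "\<forall>\<^sub>F N in sequentially. (t N powr (real k - 1/2) * real N powr (real r - 1/2) * sqrt (ln (real N)) / a N)\<^sup>2 < c"
      using c by (intro order_tendstoD(2)[where y = 0]) auto
    then show ?thesis
      using t_pos assms(10) large_N[of 2]
    proof eventually_elim
      case (elim N)
      then have "ln (real N) / \<rho> N < c"
        using deviation_rate_identities(1)[of "t N" N "a N" r k] r by (simp add: \<rho>_def)
      moreover have "0 < \<rho> N" using elim by (simp add: \<rho>_def)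
      ultimately show ?case by (simp add: divide_less_eq)
    qed
  qed
  have \<alpha>_small: "\<forall>\<^sub>F N in sequentially. (\<alpha> N)\<^sup>2 < c" if c: "0 < c" for c
  proof -
    have "(\<lambda>N. (\<alpha> N)\<^sup>2) \<longlonglongrightarrow> 0\<^sup>2"
      unfolding \<alpha>_def by (intro tendsto_power assms(12))
    then show ?thesis using c by (intro order_tendstoD(2)[where y = 0]) auto
  qed
  have main: "\<forall>\<^sub>F N in sequentially. 0 < X N \<and>
      exp (- (1 + 17 * \<delta>) * X N) \<le> measure_pmf.prob (random_subset N (m N)) {B. a N \<le> sg * deviation N (m N) (H N) B} \<and>
      measure_pmf.prob (random_subset N (m N)) {B. a N \<le> sg * deviation N (m N) (H N) B} \<le> exp (- (1 - 17 * \<delta>) * X N)"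
    if \<delta>: "0 < \<delta>" "\<delta> \<le> 1 / 100" and sg: "sg = 1 \<or> sg = (-1 :: real)" for \<delta> sg
  proof -
    define c where "c = 27 * (real C)\<^sup>2 * (real r)\<^sup>2"
    \<comment> \<open>This depends only on \<delta>, C and r, so it is fixed before the limits in N
      are taken.\<close>
    define \<epsilon> where "\<epsilon> = min 1 (min ((\<delta>\<^sup>2 / (6 * (2 * real C)))\<^sup>2 / c) ((\<delta>\<^sup>2 / (256 * (real C)\<^sup>2))\<^sup>2))"
    have c0: "0 < c" using C1 r by (simp add: c_def)
    have \<epsilon>0: "0 < \<epsilon>" using \<delta> C1 c0 by (simp add: \<epsilon>_def)
    have \<epsilon>: "0 \<le> \<epsilon>" "\<epsilon> \<le> 1" "c * \<epsilon> \<le> (\<delta>\<^sup>2 / (6 * (2 * real C)))\<^sup>2" "\<epsilon> \<le> (\<delta>\<^sup>2 / (256 * (real C)\<^sup>2))\<^sup>2"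
    proof -
      show "0 \<le> \<epsilon>" using \<epsilon>0 by simp
      show "\<epsilon> \<le> 1" "\<epsilon> \<le> (\<delta>\<^sup>2 / (256 * (real C)\<^sup>2))\<^sup>2" by (simp_all add: \<epsilon>_def)
      have "\<epsilon> \<le> (\<delta>\<^sup>2 / (6 * (2 * real C)))\<^sup>2 / c" by (simp add: \<epsilon>_def)
      then show "c * \<epsilon> \<le> (\<delta>\<^sup>2 / (6 * (2 * real C)))\<^sup>2" using c0 by (simp add: le_divide_eq mult.commute)
    qed
    \<comment> \<open>Thresholds for the limits. The first bounds 4 k C \<rho> through the identity
      for \<open>\<rho> ^ (r - 1)\<close>, the second lets the exponential absorb N^4, and the third
      gives C k^2 \<le> \<delta> \<rho> because ln N \<ge> 1.\<close>
    have e1: "0 < \<epsilon> / (4 * real k * real C)" using \<epsilon>0 k1 C1 by simp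
    have e2: "0 < \<delta>\<^sup>2 / (16 * (real C)\<^sup>2)" using \<delta> C1 by simp
    have e3: "0 < \<delta> / (real C * (real k)\<^sup>2)" using \<delta> C1 k1 by simp
    show ?thesis
      using assms(4-7,9,10) t_pos \<alpha>_small[OF e1] ln_small[OF e2] ln_small[OF e3] large_N[of 224]
    proof eventually_elim
      case (elim N)
      have N0: "0 < real N" "1 < N" using elim(11) by auto
      have \<rho>0: "0 < \<rho> N" using elim N0 by (simp add: \<rho>_def)
      interpret slice_hypergraph k r N "real C" "t N" "H N" "m N"
      proof unfold_locales
        show "uniform_whypergraph k N (H N)" "2 \<le> r" "r \<le> k" "1 \<le> real C" "0 < t N" "1 \<le> m N" "t N \<le> 1 / 2"
          "real N ^ (2 * r - 2) / real C \<le> degree_variance N (H N)"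
          using elim r C1 by auto
        show "t N \<le> 1" "t N < 1" using elim by auto
        show "real (m N) = t N * real N" using N0 by (simp add: assms(8))
        fix R assume R: "R \<subseteq> {1..N}" "card R = r"
        have "finite {R. R \<subseteq> {1..N} \<and> card R = r}" by simp
        then have "degree_set (H N) R \<le> max_degree r N (H N)"
          unfolding max_degree_def using R by (intro Max_ge) auto
        then show "degree_set (H N) R \<le> real C" using elim(2) by simp
      qed
      have a2: "(a N)\<^sup>2 = \<rho> N * (t N * real N) * typical_degree\<^sup>2"
      proof -
        have "2 * k - 1 = Suc ((k - 1) * 2)" "2 * r - 1 = Suc ((r - 1) * 2)" using r by simp_all
        then have "t N ^ (2 * k - 1) * real N ^ (2 * r - 1) = t N * real N * typical_degree\<^sup>2"
          by (simp only: typical_degree_def power_Suc power_mult power_mult_distrib mult_ac)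
        moreover have "(a N)\<^sup>2 = \<rho> N * (t N ^ (2 * k - 1) * real N ^ (2 * r - 1))"
          using elim N0 by (simp add: \<rho>_def)
        ultimately show ?thesis by (simp add: mult.assoc)
      qed
      have u: "(2 * real k * (2 * real C * \<rho> N)) ^ (r - 1) \<le> \<epsilon> ^ (r - 1) * typical_degree"
      proof -
        have "(2 * real k * (2 * real C * \<rho> N)) ^ (r - 1) = (4 * real k * real C) ^ (r - 1) * \<rho> N ^ (r - 1)"
          by (simp add: power_mult_distrib[symmetric] mult_ac)
        also have "\<rho> N ^ (r - 1) = ((\<alpha> N)\<^sup>2) ^ (r - 1) * typical_degree"
          using deviation_rate_identities(2)[of "t N" N "a N" r k] elim N0 r
          by (simp add: \<rho>_def \<alpha>_def typical_degree_def)
        also have "(4 * real k * real C) ^ (r - 1) * (((\<alpha> N)\<^sup>2) ^ (r - 1) * typical_degree) =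
            (4 * real k * real C * (\<alpha> N)\<^sup>2) ^ (r - 1) * typical_degree"
          by (simp add: power_mult_distrib)
        also have "\<dots> \<le> \<epsilon> ^ (r - 1) * typical_degree"
        proof (intro mult_right_mono power_mono)
          show "4 * real k * real C * (\<alpha> N)\<^sup>2 \<le> \<epsilon>"
            using elim(8) k1 C1 by (simp add: less_divide_eq mult.commute)
        qed (use t in \<open>auto simp: typical_degree_def\<close>)
        finally show ?thesis .
      qed
      have ln1: "1 \<le> ln (real N)"
      proof -
        have "exp 1 \<le> (3 :: real)" using e_less_272 by simp
        also have "\<dots> \<le> real N" using elim(11) by simp
        finally show ?thesis using N0 by (simp add: ln_ge_iff)
      qed
      have large: "real C * (real k)\<^sup>2 \<le> \<delta> * \<rho> N"
      proof -
        have "1 \<le> \<delta> / (real C * (real k)\<^sup>2) * \<rho> N" using ln1 elim(10) by linarith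
        moreover have "0 < real C * (real k)\<^sup>2" using C1 k1 by simp
        ultimately show ?thesis by (simp add: le_divide_eq)
      qed
      have log: "28 * real (N + 1) ^ 3 \<le> exp (\<delta>\<^sup>2 * (\<rho> N / (2 * (real C)\<^sup>2)) / 2)"
      proof -
        \<comment> \<open>The requirement N \<ge> 224 comes from 224 = 28 * 2^3, which brings the
          cubic factor below N^4.\<close>
        have "28 * real (N + 1) ^ 3 \<le> 28 * (2 * real N) ^ 3"
          using N0 by (intro mult_left_mono power_mono) auto
        also have "\<dots> = 224 * real N ^ 3" by (simp add: power_mult_distrib)
        also have "\<dots> \<le> real N * real N ^ 3" using elim(11) by (intro mult_right_mono) auto
        also have "\<dots> = exp (4 * ln (real N))"
          using N0 exp_of_nat_mult[of 4 "ln (real N)"] by (simp add: power_Suc[symmetric])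
        also have "\<dots> \<le> exp (4 * (\<delta>\<^sup>2 / (16 * (real C)\<^sup>2) * \<rho> N))"
          using mult_left_mono[OF elim(9), of 4] by (simp only: exp_le_cancel_iff zero_le_numeral simp_thms)
        also have "4 * (\<delta>\<^sup>2 / (16 * (real C)\<^sup>2) * \<rho> N) = \<delta>\<^sup>2 * (\<rho> N / (2 * (real C)\<^sup>2)) / 2"
          by simp
        finally show ?thesis .
      qed
      from deviation_bounds[OF elim(6) a2 \<delta> sg \<epsilon>(1,2) \<epsilon>(3)[unfolded c_def] \<epsilon>(4) u large log X_def]
      show ?case by blast
    qed
  qed
  have rate: "(\<forall>\<^sub>F N in sequentially. P N = exp (- (1 + \<epsilon> N) * X N)) \<longleftrightarrow>
     (\<forall>\<^sub>F N in sequentially. P N = exp (- (1 + \<epsilon> N) * (a N)\<^sup>2 /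
         (2 * (1 - t N) * t N ^ (2 * k - 1) * degree_variance N (H N) * real N)))" for P \<epsilon> :: "nat \<Rightarrow> real"
    by (simp add: X_def)
  have "\<exists>\<epsilon>. \<epsilon> \<longlonglongrightarrow> 0 \<and> (\<forall>\<^sub>F N in sequentially.
      measure_pmf.prob (random_subset N (m N)) {B. a N \<le> sg * deviation N (m N) (H N) B} = exp (- (1 + \<epsilon> N) * X N))"
    if "sg = 1 \<or> sg = (-1 :: real)" for sg
    by (rule exp_rate_of_sandwich) (rule main[OF _ _ that])
  from this[of 1] this[of "-1"]
  show ?thesis
    unfolding rate by (simp add: le_minus_iff)
qed

end
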